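(* Let $M$ be a loopfree matroid of rank $r$ on the ground set $E$, with rank function $\mathrm r_M$. Then there exist piecewise linear functions $\varphi_1,\ldots,\varphi_r$ on $B(M)\times B(M)$ which cut out the diagonal, i.e. $\Delta_{B(M)}=\varphi_1\cdots\varphi_r\cdot (B(M)\times B(M))$. In fact, the intermediate matroids $M_i$ ($i=0,\ldots,r$) on $E\sqcup E$ associated with the containment $B(\Delta_M)\subseteq B(M\oplus M)$ have rank function $$\mathrm r_{M_i}(A\sqcup B)=\min\{\mathrm r_M(A\cup B)+i,\ \mathrm r_M(A)+\mathrm r_M(B)\},$$ and one can choose $\varphi_i$ to be the function which is linear on the cones of the fine subdivision of $B(M\oplus M)=B(M)\times B(M)$ and is given by $$\varphi_i(V_F)=\begin{cases}-1,&\text{if }\mathrm r_M(A)+\mathrm r_M(B)-\mathrm r_M(A\cup B)\ge i,\\ 0,&\text{else,}\end{cases}$$ where $F=A\sqcup B$ runs over the flats of $M\oplus M$.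
   Context: Tropical cycles. Let $V=\Lambda\otimes\mathbb R$ for a lattice $\Lambda$. A tropical $k$-cycle in $V$ is a pure $k$-dimensional rational polyhedral complex with integer weights $\omega(\sigma)$ on its facets, satisfying for each codimension one cell $\tau$ the balancing condition $\sum_{\sigma>\tau}\omega(\sigma)v_{\sigma/\tau}\in V_\tau$ ($v_{\sigma/\tau}$ primitive normal vectors, $V_\tau$ the linear space spanned by differences of points of $\tau$), taken modulo refinement and discarding weight $0$ facets. A rational (piecewise linear) function on $C$ is a continuous function $\varphi:|C|\to\mathbb R$ that is integer affine linear on the cells of some polyhedral structure of $C$. Its divisor $\varphi\cdot C$ is the cycle of dimension $\dim C-1$ whose weight at a codimension one cell $\tau$ is $\sum_{\sigma>\tau}\varphi_\sigma(\omega(\sigma)v_{\sigma/\tau})-\varphi_\tau\big(\sum_{\sigma>\tau}\omega(\sigma)v_{\sigma/\tau}\big)$, with $\varphi_\sigma,\varphi_\tau$ the linear parts. Products of several functions with a cycle are iterated divisors. Matroid varieties. Matroids are loopfree (each element of the ground set has rank $1$). For a matroid $M$ on a finite set $E$ and $F\subseteq E$ put $V_F=-\sum_{i\in F}e_i\in\mathbb R^E$. The fine subdivision of $B(M)$ is the fan of all cones $\{\sum_{i=1}^p\lambda_iV_{F_i}:\lambda_1,\ldots,\lambda_{p-1}\ge 0,\ \lambda_p\in\mathbb R\}$ for chains of flats $\emptyset\subsetneq F_1\subsetneq\cdots\subsetneq F_p=E$ of $M$. With weight $1$ on all facets it defines the tropical cycle $B(M)$ in $\mathbb R^E$. One has $B(M\oplus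 M)=B(M)\times B(M)$, and the flats of $M\oplus M$ are the sets $A\sqcup B$ with $A,B$ flats of $M$. $\Delta_{B(M)}$ is the push-forward of $B(M)$ under $x\mapsto(x,x)$ (the diagonal with weights $1$). $\Delta_M$ is the matroid on $E\sqcup E$ with rank function $\mathrm r_{\Delta_M}(A\sqcup B)=\mathrm r_M(A\cup B)$; it satisfies $B(\Delta_M)=\Delta_{B(M)}$. Intermediate matroids. Let $R=\{1,\ldots,r\}$ and let $Q$ be the matroid on $(E\sqcup E)\sqcup R$ with rank function $\mathrm r_Q(I\sqcup J)=\min\{\mathrm r_{M\oplus M}(I)+|J|,\ \mathrm r_{\Delta_M}(I)+r\}$ for $I\subseteq E\sqcup E$, $J\subseteq R$. The intermediate matroids are $M_i:=(Q\setminus\{1,\ldots,i\})/\{i+1,\ldots,r\}$ (deletion followed by contraction); thus $M_0=\Delta_M$ and $M_r=M\oplus M$. *)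

theory Defs
  imports "HOL-Analysis.Analysis"
begin

section \<open>Matroids\<close>

record 'a matroid =
  ground :: "'a set"
  rk :: "'a set \<Rightarrow> nat"

definition is_matroid :: "'a matroid \<Rightarrow> bool" where
  "is_matroid M \<longleftrightarrow> finite (ground M) \<and>
     (\<forall>A \<subseteq> ground M. rk M A \<le> card A) \<and>
     (\<forall>A B. A \<subseteq> B \<and> B \<subseteq> ground M \<longrightarrow> rk M A \<le> rk M B) \<and>
     (\<forall>A B. A \<subseteq> ground M \<and> B \<subseteq> ground M \<longrightarrow>
        rk M (A \<union> B) + rk M (A \<inter> B) \<le> rk M A + rk M B)"

definition loopfree :: "'a matroid \<Rightarrow> bool" where
  "loopfree M \<longleftrightarrow> (\<forall>e \<in> ground M. rk M {e} = 1)"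

definition flat :: "'a matroid \<Rightarrow> 'a set \<Rightarrow> bool" where
  "flat M F \<longleftrightarrow> F \<subseteq> ground M \<and> (\<forall>e \<in> ground M - F. rk M F < rk M (insert e F))"

definition deletion :: "'a matroid \<Rightarrow> 'a set \<Rightarrow> 'a matroid" where
  "deletion M D = \<lparr>ground = ground M - D, rk = rk M\<rparr>"

definition contraction :: "'a matroid \<Rightarrow> 'a set \<Rightarrow> 'a matroid" where
  "contraction M Z = \<lparr>ground = ground M - Z, rk = (\<lambda>A. rk M (A \<union> Z) - rk M Z)\<rparr>"

definition direct_sum :: "'a matroid \<Rightarrow> 'b matroid \<Rightarrow> ('a + 'b) matroid" where
  "direct_sum M N = \<lparr>ground = ground M <+> ground N,
     rk = (\<lambda>S. rk M (Inl -` S) + rk N (Inr -` S))\<rparr>"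

definition diagonal_matroid :: "'a matroid \<Rightarrow> ('a + 'a) matroid" where
  "diagonal_matroid M = \<lparr>ground = ground M <+> ground M,
     rk = (\<lambda>S. rk M (Inl -` S \<union> Inr -` S))\<rparr>"

text \<open>The matroid $Q$ on $(E \sqcup E) \sqcup \{1, \dots, r\}$, where $r$ is the rank of $M$.\<close>

definition linking_matroid :: "'a matroid \<Rightarrow> (('a + 'a) + nat) matroid" where
  "linking_matroid M =
     \<lparr>ground = (ground M <+> ground M) <+> {1..rk M (ground M)},
      rk = (\<lambda>S. min (rk (direct_sum M M) (Inl -` S) + card (Inr -` S))
                     (rk (diagonal_matroid M) (Inl -` S) + rk M (ground M)))\<rparr>"

text \<open>The $i$-th intermediate matroid; its ground set is the copy
  \<open>Inl ` (E <+> E)\<close> of $E \sqcup E$ inside the ground set of $Q$.\<close>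

definition intermediate_matroid :: "'a matroid \<Rightarrow> nat \<Rightarrow> (('a + 'a) + nat) matroid" where
  "intermediate_matroid M i =
     contraction (deletion (linking_matroid M) (Inr ` {1..i}))
                 (Inr ` {i + 1..rk M (ground M)})"

section \<open>Rational polyhedral complexes in $\mathbb R^n$ with lattice $\mathbb Z^n$\<close>

definition lattice_vec :: "real ^ 'n::finite \<Rightarrow> bool" where
  "lattice_vec v \<longleftrightarrow> (\<forall>i. v $ i \<in> \<int>)"

text \<open>Rational slopes, but arbitrary real constants.\<close>

definition rational_polyhedron :: "(real ^ 'n::finite) set \<Rightarrow> bool" where
  "rational_polyhedron \<sigma> \<longleftrightarrow>
     (\<exists>H. finite H \<and> (\<forall>(a, b) \<in> H. lattice_vec a) \<and>
          \<sigma> = {x. \<forall>(a, b) \<in> H. a \<bullet> x \<le> (b :: real)})"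

text \<open>The empty polyhedron is not a cell, although it is a face in the sense of \<open>face_of\<close>.\<close>

definition polyhedral_complex :: "(real ^ 'n::finite) set set \<Rightarrow> bool" where
  "polyhedral_complex X \<longleftrightarrow> finite X \<and>
     (\<forall>\<sigma> \<in> X. \<sigma> \<noteq> {} \<and> rational_polyhedron \<sigma>) \<and>
     (\<forall>\<sigma> \<in> X. \<forall>\<tau>. \<tau> face_of \<sigma> \<and> \<tau> \<noteq> {} \<longrightarrow> \<tau> \<in> X) \<and>
     (\<forall>\<sigma> \<in> X. \<forall>\<tau> \<in> X. (\<sigma> \<inter> \<tau>) face_of \<sigma> \<and> (\<sigma> \<inter> \<tau>) face_of \<tau>)"

text \<open>The weights are real numbers required to be integral on the facets; values of
  \<open>weight\<close> on other sets are irrelevant.\<close>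

record ('n::finite) weighted_complex =
  cells :: "(real ^ 'n) set set"
  weight :: "(real ^ 'n) set \<Rightarrow> real"

definition facets :: "'n::finite weighted_complex \<Rightarrow> (real ^ 'n) set set" where
  "facets X = {\<sigma> \<in> cells X. \<forall>\<rho> \<in> cells X. \<sigma> \<subseteq> \<rho> \<longrightarrow> \<rho> = \<sigma>}"

definition codim1_cells :: "'n::finite weighted_complex \<Rightarrow> (real ^ 'n) set set" where
  "codim1_cells X =
     {\<tau> \<in> cells X. \<exists>\<sigma> \<in> facets X. \<tau> \<subseteq> \<sigma> \<and> aff_dim \<tau> = aff_dim \<sigma> - 1}"

definition pure_weighted_complex :: "'n::finite weighted_complex \<Rightarrow> bool" where
  "pure_weighted_complex X \<longleftrightarrow> polyhedral_complex (cells X) \<and>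
     (\<exists>k. \<forall>\<sigma> \<in> facets X. aff_dim \<sigma> = k) \<and>
     (\<forall>\<sigma> \<in> facets X. weight X \<sigma> \<in> \<int>)"

definition direction_space :: "(real ^ 'n::finite) set \<Rightarrow> (real ^ 'n) set" where
  "direction_space \<tau> = span {x - y |x y. x \<in> \<tau> \<and> y \<in> \<tau>}"

text \<open>\<open>v\<close> generates $\Lambda_\sigma / \Lambda_\tau$ and points from \<open>\<tau>\<close> into \<open>\<sigma>\<close>.\<close>

definition is_primitive_normal ::
    "(real ^ 'n::finite) set \<Rightarrow> (real ^ 'n) set \<Rightarrow> real ^ 'n \<Rightarrow> bool" where
  "is_primitive_normal \<sigma> \<tau> v \<longleftrightarrow>
     lattice_vec v \<and> v \<in> direction_space \<sigma> \<and>
     (\<forall>w \<in> direction_space \<sigma>. lattice_vec w \<longrightarrow>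
        (\<exists>n :: int. w - of_int n *\<^sub>R v \<in> direction_space \<tau>)) \<and>
     (\<exists>x \<in> \<tau>. \<exists>t > 0. x + t *\<^sub>R v \<in> \<sigma>)"

text \<open>Unique modulo $\Lambda_\tau$ only; balancing and divisors do not depend on the choice.\<close>

definition primitive_normal ::
    "(real ^ 'n::finite) set \<Rightarrow> (real ^ 'n) set \<Rightarrow> real ^ 'n" where
  "primitive_normal \<sigma> \<tau> = (SOME v. is_primitive_normal \<sigma> \<tau> v)"

definition normal_sum :: "'n::finite weighted_complex \<Rightarrow> (real ^ 'n) set \<Rightarrow> real ^ 'n" where
  "normal_sum X \<tau> = (\<Sum>\<sigma> \<in> {\<sigma> \<in> facets X. \<tau> \<subset> \<sigma>}. weight X \<sigma> *\<^sub>R primitive_normal \<sigma> \<tau>)"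

definition tropical_complex :: "'n::finite weighted_complex \<Rightarrow> bool" where
  "tropical_complex X \<longleftrightarrow> pure_weighted_complex X \<and>
     (\<forall>\<tau> \<in> codim1_cells X. normal_sum X \<tau> \<in> direction_space \<tau>)"

section \<open>Tropical cycles\<close>

text \<open>A tropical cycle is represented by a tropical complex, and \<open>cycle_eq\<close> is equality of
  cycles: existence of a common refinement after discarding the facets of weight $0$.\<close>

definition nonzero_part :: "'n::finite weighted_complex \<Rightarrow> 'n weighted_complex" where
  "nonzero_part X =
     X\<lparr>cells := {\<tau> \<in> cells X. \<exists>\<sigma> \<in> facets X. weight X \<sigma> \<noteq> 0 \<and> \<tau> \<subseteq> \<sigma>}\<rparr>"

definition support :: "'n::finite weighted_complex \<Rightarrow> (real ^ 'n) set" where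
  "support X = \<Union>(cells (nonzero_part X))"

definition refines :: "'n::finite weighted_complex \<Rightarrow> 'n weighted_complex \<Rightarrow> bool" where
  "refines Z X \<longleftrightarrow> pure_weighted_complex Z \<and> pure_weighted_complex X \<and>
     \<Union>(cells Z) = \<Union>(cells X) \<and>
     (\<forall>\<rho> \<in> cells Z. \<exists>\<sigma> \<in> cells X. \<rho> \<subseteq> \<sigma>) \<and>
     (\<forall>\<rho> \<in> facets Z. \<forall>\<sigma> \<in> facets X. \<rho> \<subseteq> \<sigma> \<longrightarrow> weight Z \<rho> = weight X \<sigma>)"

definition cycle_eq :: "'n::finite weighted_complex \<Rightarrow> 'n weighted_complex \<Rightarrow> bool" where
  "cycle_eq X Y \<longleftrightarrow> tropical_complex X \<and> tropical_complex Y \<and>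
     (\<exists>Z. refines Z (nonzero_part X) \<and> refines Z (nonzero_part Y))"

section \<open>Rational functions and divisors\<close>

definition integer_affine_on :: "(real ^ 'n::finite) set \<Rightarrow> (real ^ 'n \<Rightarrow> real) \<Rightarrow> bool" where
  "integer_affine_on \<sigma> \<phi> \<longleftrightarrow>
     (\<exists>a b. lattice_vec a \<and> (\<forall>x \<in> \<sigma>. \<phi> x = a \<bullet> x + b))"

definition rational_function :: "'n::finite weighted_complex \<Rightarrow> (real ^ 'n \<Rightarrow> real) \<Rightarrow> bool" where
  "rational_function C \<phi> \<longleftrightarrow> continuous_on (support C) \<phi> \<and>
     (\<exists>X. cycle_eq X C \<and> (\<forall>\<sigma> \<in> cells X. integer_affine_on \<sigma> \<phi>))"

text \<open>The linear form is determined by \<open>\<phi>\<close> on \<open>direction_space \<sigma>\<close> only, and is only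
  evaluated there.\<close>

definition linear_part :: "(real ^ 'n::finite \<Rightarrow> real) \<Rightarrow> (real ^ 'n) set \<Rightarrow> real ^ 'n \<Rightarrow> real" where
  "linear_part \<phi> \<sigma> v =
     (SOME a. lattice_vec a \<and> (\<exists>b. \<forall>x \<in> \<sigma>. \<phi> x = a \<bullet> x + b)) \<bullet> v"

text \<open>The divisor on a polyhedral structure \<open>X\<close> on whose cells \<open>\<phi>\<close> is integer affine.\<close>

definition divisor_complex ::
    "(real ^ 'n::finite \<Rightarrow> real) \<Rightarrow> 'n weighted_complex \<Rightarrow> 'n weighted_complex" where
  "divisor_complex \<phi> X =
     \<lparr>cells = cells X - facets X,
      weight = (\<lambda>\<tau>. (\<Sum>\<sigma> \<in> {\<sigma> \<in> facets X. \<tau> \<subset> \<sigma>}.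
                        linear_part \<phi> \<sigma> (weight X \<sigma> *\<^sub>R primitive_normal \<sigma> \<tau>))
                     - linear_part \<phi> \<tau> (normal_sum X \<tau>))\<rparr>"

text \<open>\<open>D\<close> is $\varphi \cdot C$. As usual for divisors, \<open>D\<close> does not depend, up to
  \<open>cycle_eq\<close>, on the polyhedral structure \<open>X\<close> of \<open>C\<close>.\<close>

definition has_divisor ::
    "(real ^ 'n::finite \<Rightarrow> real) \<Rightarrow> 'n weighted_complex \<Rightarrow> 'n weighted_complex \<Rightarrow> bool" where
  "has_divisor \<phi> C D \<longleftrightarrow>
     (\<exists>X. cycle_eq X C \<and> (\<forall>\<sigma> \<in> cells X. integer_affine_on \<sigma> \<phi>) \<and>
          cycle_eq D (divisor_complex \<phi> X))"

text \<open>\<open>D\<close> is $\varphi_1 \cdots \varphi_m \cdot C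
  = \varphi_1 \cdot (\varphi_2 \cdots (\varphi_m \cdot C))$.\<close>

fun has_divisor_product ::
    "(real ^ 'n::finite \<Rightarrow> real) list \<Rightarrow> 'n weighted_complex \<Rightarrow> 'n weighted_complex \<Rightarrow> bool" where
  "has_divisor_product [] C D \<longleftrightarrow> cycle_eq D C"
| "has_divisor_product (\<phi> # \<phi>s) C D \<longleftrightarrow>
     (\<exists>D'. has_divisor_product \<phi>s C D' \<and> has_divisor \<phi> D' D)"

section \<open>Products and diagonals\<close>

text \<open>$\mathbb R^{E} \times \mathbb R^{F}$ is identified with $\mathbb R^{E \sqcup F}$.\<close>

definition join_vec :: "real ^ 'm::finite \<Rightarrow> real ^ 'n::finite \<Rightarrow> real ^ ('m + 'n)" where
  "join_vec x y = (\<chi> i. case i of Inl a \<Rightarrow> x $ a | Inr b \<Rightarrow> y $ b)"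

definition left_vec :: "real ^ ('m::finite + 'n::finite) \<Rightarrow> real ^ 'm" where
  "left_vec z = (\<chi> a. z $ Inl a)"

definition right_vec :: "real ^ ('m::finite + 'n::finite) \<Rightarrow> real ^ 'n" where
  "right_vec z = (\<chi> b. z $ Inr b)"

text \<open>The factors of a product cell are recovered as its projections, since cells are nonempty.\<close>

definition product_complex ::
    "'m::finite weighted_complex \<Rightarrow> 'n::finite weighted_complex \<Rightarrow> ('m + 'n) weighted_complex" where
  "product_complex X Y =
     \<lparr>cells = {{join_vec x y |x y. x \<in> \<sigma> \<and> y \<in> \<tau>} |\<sigma> \<tau>. \<sigma> \<in> cells X \<and> \<tau> \<in> cells Y},
      weight = (\<lambda>\<rho>. weight X (left_vec ` \<rho>) * weight Y (right_vec ` \<rho>))\<rparr>"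

text \<open>The push-forward along \<open>x \<mapsto> (x, x)\<close>: as this map is injective and its image meets the
  lattice in the image of the lattice, cells are mapped to cells and weights are kept.\<close>

definition diagonal_complex :: "'n::finite weighted_complex \<Rightarrow> ('n + 'n) weighted_complex" where
  "diagonal_complex X =
     \<lparr>cells = (\<lambda>\<sigma>. (\<lambda>x. join_vec x x) ` \<sigma>) ` cells X,
      weight = (\<lambda>\<rho>. weight X (left_vec ` \<rho>))\<rparr>"

section \<open>Matroid varieties\<close>

definition flat_vec :: "'n::finite set \<Rightarrow> real ^ 'n" where
  "flat_vec F = - (\<Sum>i \<in> F. axis i 1)"

definition flat_chain :: "'n::finite matroid \<Rightarrow> 'n set list \<Rightarrow> bool" where
  "flat_chain M Fs \<longleftrightarrow> Fs \<noteq> [] \<and> (\<forall>F \<in> set Fs. flat M F) \<and> {} \<notin> set Fs \<and>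
     sorted_wrt (\<subset>) Fs \<and> last Fs = ground M"

text \<open>The coefficient of the last vector may be negative.\<close>

definition chain_cone :: "'n::finite set list \<Rightarrow> (real ^ 'n) set" where
  "chain_cone Fs =
     {\<Sum>j < length Fs. c j *\<^sub>R flat_vec (Fs ! j) |c. \<forall>j < length Fs - 1. 0 \<le> c j}"

text \<open>$B(M)$ with its fine subdivision, for a matroid whose ground set is the whole index type.\<close>

definition matroid_variety :: "'n::finite matroid \<Rightarrow> 'n weighted_complex" where
  "matroid_variety M = \<lparr>cells = chain_cone ` {Fs. flat_chain M Fs}, weight = (\<lambda>_. 1)\<rparr>"

text \<open>\<open>\<phi>\<close> is (on the support of $B(M \oplus M)$) the function $\varphi_i$: linear on the
  cones of the fine subdivision, with the prescribed values on the vectors $V_F$.\<close>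

definition is_diagonal_function ::
    "'n::finite matroid \<Rightarrow> nat \<Rightarrow> (real ^ ('n + 'n) \<Rightarrow> real) \<Rightarrow> bool" where
  "is_diagonal_function M i \<phi> \<longleftrightarrow>
     (\<forall>\<sigma> \<in> cells (matroid_variety (direct_sum M M)).
        \<exists>f. linear f \<and> (\<forall>x \<in> \<sigma>. \<phi> x = f x)) \<and>
     (\<forall>A B. flat (direct_sum M M) (A <+> B) \<longrightarrow>
        \<phi> (flat_vec (A <+> B)) =
          (if int (rk M A) + int (rk M B) - int (rk M (A \<union> B)) \<ge> int i then -1 else 0))"

end

theory Submission
  imports Defs
begin

text \<open>The matroids \<open>N\<^sub>i\<close> on \<open>E \<squnion> E\<close> with rank function
  \<open>min (r (A \<union> B) + i) (r A + r B)\<close> interpolate between \<open>\<Delta>\<^sub>M\<close> and \<open>M \<oplus> M\<close>, and each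
  \<open>N\<^sub>i\<close> is an elementary quotient of \<open>N\<^sub>i\<^sub>+\<^sub>1\<close>: flats of \<open>N\<^sub>i\<close> are flats of \<open>N\<^sub>i\<^sub>+\<^sub>1\<close>, so all fine
  subdivisions are subfans of the one of \<open>B(M \<oplus> M)\<close>. On flats \<open>\<phi>\<^sub>i\<close> is the rank of \<open>N\<^sub>i\<^sub>-\<^sub>1\<close> minus the
  rank of \<open>N\<^sub>i\<close>. A codimension one cone of \<open>B(N\<^sub>i)\<close> has a single gap \<open>G \<subset> H\<close> of rank \<open>2\<close>; the
  flats \<open>F\<close> in the gap satisfy \<open>\<Sum> V\<^sub>F = V\<^sub>H + (k - 1) V\<^sub>G\<close>, \<open>k\<close> being their number. Hence the
  weight of \<open>\<phi>\<^sub>i \<cdot> B(N\<^sub>i)\<close> there is \<open>1 - #{F. \<phi>\<^sub>i(V\<^sub>F) = -1}\<close> if \<open>\<phi>\<^sub>i\<close> drops between \<open>G\<close> and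
  \<open>H\<close>, and \<open>0\<close> otherwise. A flat \<open>F\<close> counted here must be the closure of \<open>G\<close> in \<open>N\<^sub>i\<^sub>-\<^sub>1\<close>, so the
  weight is \<open>1\<close> on the cones of \<open>B(N\<^sub>i\<^sub>-\<^sub>1)\<close> and \<open>0\<close> elsewhere.

  The polyhedral geometry is that of fans whose cones have, modulo lineality, generators forming
  part of a lattice basis. A point \<open>x\<close> lies in the cone of a chain of flats iff the chain contains
  all sublevel sets \<open>{e. x\<^sub>e \<le> t}\<close>, which settles intersections of cones and the comparison of the
  fine subdivision of \<open>B(M \<oplus> M)\<close> with the product subdivision.\<close>

section \<open>Unimodular fans\<close>

lemma lattice_vec_inner_Ints: "lattice_vec v \<Longrightarrow> lattice_vec w \<Longrightarrow> v \<bullet> w \<in> \<int>"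
  unfolding lattice_vec_def inner_vec_def by (auto intro!: Ints_sum Ints_mult)

lemma lattice_vec_0 [simp]: "lattice_vec 0"
  by (simp add: lattice_vec_def)

lemma lattice_vec_minus: "lattice_vec v \<Longrightarrow> lattice_vec (- v)"
  by (simp add: lattice_vec_def)

lemma lattice_vec_add: "lattice_vec v \<Longrightarrow> lattice_vec w \<Longrightarrow> lattice_vec (v + w)"
  by (simp add: lattice_vec_def)

lemma lattice_vec_diff: "lattice_vec v \<Longrightarrow> lattice_vec w \<Longrightarrow> lattice_vec (v - w)"
  by (simp add: lattice_vec_def)

lemma lattice_vec_scale: "c \<in> \<int> \<Longrightarrow> lattice_vec v \<Longrightarrow> lattice_vec (c *\<^sub>R v)"
  by (simp add: lattice_vec_def)

lemma lattice_vec_sum: "(\<And>i. i \<in> I \<Longrightarrow> lattice_vec (f i)) \<Longrightarrow> lattice_vec (\<Sum>i\<in>I. f i)"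
  by (induction I rule: infinite_finite_induct) (auto intro: lattice_vec_add)

lemma lattice_vec_axis [simp]: "lattice_vec (axis i 1)"
  by (simp add: lattice_vec_def axis_def)

text \<open>Generators are indexed, so that cones can be handled through their finite index sets and
  products of fans through sum types. The set \<open>L\<close> is the lineality part, where
  coefficients may have any sign.\<close>

definition gcone :: "('i \<Rightarrow> real ^ 'n::finite) \<Rightarrow> 'i set \<Rightarrow> 'i set \<Rightarrow> (real ^ 'n) set" where
  "gcone g L I = {\<Sum>i\<in>I. c i *\<^sub>R g i |c. \<forall>i\<in>I - L. 0 \<le> c i}"

lemma gconeI: "(\<And>i. i \<in> I - L \<Longrightarrow> 0 \<le> c i) \<Longrightarrow> (\<Sum>i\<in>I. c i *\<^sub>R g i) \<in> gcone g L I"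
  unfolding gcone_def by blast

text \<open>\<open>K\<close> acts as a simplicial complex all of whose members contain
  \<open>L\<close>. Integral dual vectors encode that the generators of a cone are part of a lattice
  basis: they yield linear independence and integrality of coordinates at once. For
  \<open>gcone_inter\<close> one inclusion is enough, the other being monotonicity. The number
  \<open>k\<close> of generators of a maximal cone is also its dimension, lineality
  included.\<close>

locale unimodular_fan =
  fixes g :: "'i \<Rightarrow> real ^ 'n::finite" and L :: "'i set" and K :: "'i set set" and k :: nat
  assumes finite_fan: "finite K"
    and finite_gens: "I \<in> K \<Longrightarrow> finite I"
    and lineality_subset: "I \<in> K \<Longrightarrow> L \<subseteq> I"
    and down_closed: "I \<in> K \<Longrightarrow> L \<subseteq> J \<Longrightarrow> J \<subseteq> I \<Longrightarrow> J \<in> K"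
    and lattice_gen: "I \<in> K \<Longrightarrow> i \<in> I \<Longrightarrow> lattice_vec (g i)"
    and dual_exists: "I \<in> K \<Longrightarrow> i \<in> I \<Longrightarrow>
      \<exists>d. lattice_vec d \<and> (\<forall>j\<in>I. d \<bullet> g j = (if j = i then 1 else 0))"
    and gcone_inter: "I \<in> K \<Longrightarrow> J \<in> K \<Longrightarrow> gcone g L I \<inter> gcone g L J \<subseteq> gcone g L (I \<inter> J)"
    and pure: "I \<in> K \<Longrightarrow> \<exists>J\<in>K. I \<subseteq> J \<and> card J = k"
    and card_le: "I \<in> K \<Longrightarrow> card I \<le> k"
begin

abbreviation cone :: "'i set \<Rightarrow> (real ^ 'n) set" where
  "cone I \<equiv> gcone g L I"

section \<open>Coordinates with respect to the generators of a cone\<close>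

definition dual :: "'i set \<Rightarrow> 'i \<Rightarrow> real ^ 'n" where
  "dual I i = (SOME d. lattice_vec d \<and> (\<forall>j\<in>I. d \<bullet> g j = (if j = i then 1 else 0)))"

lemma
  assumes "I \<in> K" "i \<in> I"
  shows lattice_dual: "lattice_vec (dual I i)"
    and dual_gen: "j \<in> I \<Longrightarrow> dual I i \<bullet> g j = (if j = i then 1 else 0)"
  using someI_ex[OF dual_exists[OF assms]] unfolding dual_def by auto

lemma dual_sum:
  assumes "I \<in> K" "i \<in> I"
  shows "dual I i \<bullet> (\<Sum>j\<in>I. c j *\<^sub>R g j) = c i"
proof -
  have "dual I i \<bullet> (\<Sum>j\<in>I. c j *\<^sub>R g j) = (\<Sum>j\<in>I. if i = j then c j else 0)"
    unfolding inner_sum_right using assms by (intro sum.cong) (auto simp: dual_gen)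
  also have "\<dots> = c i"
    using assms finite_gens by simp
  finally show ?thesis .
qed

text \<open>Both sides are linear in \<open>x\<close>, so the identity is checked on the
  generators.\<close>

lemma span_gens:
  assumes "I \<in> K" "x \<in> span (g ` I)"
  shows "x = (\<Sum>i\<in>I. (dual I i \<bullet> x) *\<^sub>R g i)"
  using assms(2)
proof (induction rule: span_induct)
  case base
  then show ?case
    by (auto simp: subspace_def inner_add_right scaleR_add_left sum.distrib
        simp flip: scaleR_sum_right scaleR_scaleR)
next
  case (step x)
  then obtain j where j: "j \<in> I" "x = g j" by auto
  have "(\<Sum>i\<in>I. (dual I i \<bullet> x) *\<^sub>R g i) = (\<Sum>i\<in>I. if i = j then g i else 0)"
    using j assms(1) by (intro sum.cong) (auto simp: dual_gen)
  then show ?case using j assms(1) finite_gens by simp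
qed

lemma cone_subset_span: "cone I \<subseteq> span (g ` I)"
  unfolding gcone_def by (auto intro!: span_sum intro: span_scale span_base)

text \<open>Coefficients are unique, since the dual vectors recover them. Convexity, closedness and
  the analysis of faces all rest on this description by inequalities.\<close>

lemma mem_cone_iff:
  assumes "I \<in> K"
  shows "x \<in> cone I \<longleftrightarrow> x \<in> span (g ` I) \<and> (\<forall>i\<in>I - L. 0 \<le> dual I i \<bullet> x)"
proof
  assume x: "x \<in> cone I"
  then obtain c where c: "x = (\<Sum>i\<in>I. c i *\<^sub>R g i)" "\<forall>i\<in>I - L. 0 \<le> c i"
    unfolding gcone_def by auto
  have "dual I i \<bullet> x = c i" if "i \<in> I" for i
    unfolding c(1) by (rule dual_sum[OF assms that])
  with c x cone_subset_span show "x \<in> span (g ` I) \<and> (\<forall>i\<in>I - L. 0 \<le> dual I i \<bullet> x)" by auto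
next
  assume x: "x \<in> span (g ` I) \<and> (\<forall>i\<in>I - L. 0 \<le> dual I i \<bullet> x)"
  have "(\<Sum>i\<in>I. (dual I i \<bullet> x) *\<^sub>R g i) \<in> cone I"
    using x by (intro gconeI) auto
  then show "x \<in> cone I" using span_gens[OF assms] x by metis
qed

lemma gen_in_cone: "I \<in> K \<Longrightarrow> i \<in> I \<Longrightarrow> g i \<in> cone I"
  by (auto simp: mem_cone_iff span_base dual_gen)

lemma zero_in_cone: "I \<in> K \<Longrightarrow> 0 \<in> cone I"
  by (auto simp: mem_cone_iff span_zero)

lemma cone_mono:
  assumes "I \<in> K" "J \<subseteq> I"
  shows "cone J \<subseteq> cone I"
proof
  fix x assume "x \<in> cone J"
  then obtain c where c: "x = (\<Sum>i\<in>J. c i *\<^sub>R g i)" "\<forall>i\<in>J - L. 0 \<le> c i"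
    unfolding gcone_def by auto
  have "x = (\<Sum>i\<in>I. (if i \<in> J then c i else 0) *\<^sub>R g i)"
    unfolding c(1) using assms finite_gens[OF assms(1)]
    by (intro sum.mono_neutral_cong_left) auto
  also have "\<dots> \<in> cone I"
    using c(2) by (intro gconeI) auto
  finally show "x \<in> cone I" .
qed

text \<open>The dual vector of \<open>i\<close> vanishes on the span but not at
  \<open>g i\<close>.\<close>

lemma gen_notin_cone: "insert i I \<in> K \<Longrightarrow> i \<notin> I \<Longrightarrow> g i \<notin> span (g ` I)"
proof
  assume I: "insert i I \<in> K" "i \<notin> I" and "g i \<in> span (g ` I)"
  have "\<forall>j\<in>I. dual (insert i I) i \<bullet> g j = 0" using I by (auto simp: dual_gen)
  then have "span (g ` I) \<subseteq> {x. dual (insert i I) i \<bullet> x = 0}"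
    by (intro span_minimal) (auto simp: subspace_def inner_add_right)
  with \<open>g i \<in> span (g ` I)\<close> I dual_gen[OF I(1), of i i] show False by auto
qed

lemma cone_inter: "I \<in> K \<Longrightarrow> J \<in> K \<Longrightarrow> cone I \<inter> cone J = cone (I \<inter> J)"
  using gcone_inter cone_mono by blast

lemma inter_fan: "I \<in> K \<Longrightarrow> J \<in> K \<Longrightarrow> I \<inter> J \<in> K"
  using down_closed lineality_subset by (meson inf_le1 le_inf_iff)

text \<open>A generator \<open>g i\<close> of the smaller cone lies in both cones, hence in the cone
  over \<open>I \<inter> J\<close>. By independence this forces \<open>i\<close> into
  \<open>J\<close>.\<close>

lemma cone_subset_iff:
  assumes "I \<in> K" "J \<in> K"
  shows "cone I \<subseteq> cone J \<longleftrightarrow> I \<subseteq> J"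
proof
  assume *: "cone I \<subseteq> cone J"
  show "I \<subseteq> J"
  proof
    fix i assume i: "i \<in> I"
    show "i \<in> J"
    proof (rule ccontr)
      assume "i \<notin> J"
      have "g i \<in> cone (I \<inter> J)" using gen_in_cone i * cone_inter assms by blast
      then have "g i \<in> span (g ` (I \<inter> J))" using cone_subset_span by blast
      moreover have "insert i (I \<inter> J) \<in> K"
        using lineality_subset[OF assms(1)] lineality_subset[OF assms(2)] i
        by (intro down_closed[OF assms(1)]) auto
      ultimately show False using gen_notin_cone \<open>i \<notin> J\<close> by blast
    qed
  qed
qed (use cone_mono assms in blast)

lemma cone_eq_iff: "I \<in> K \<Longrightarrow> J \<in> K \<Longrightarrow> cone I = cone J \<longleftrightarrow> I = J"
  by (metis cone_subset_iff subset_antisym subset_refl)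

lemma cone_psubset_iff: "I \<in> K \<Longrightarrow> J \<in> K \<Longrightarrow> cone I \<subset> cone J \<longleftrightarrow> I \<subset> J"
  by (simp add: cone_subset_iff cone_eq_iff psubset_eq)

section \<open>Spans and dimensions of cones\<close>

lemma span_cone:
  assumes "I \<in> K"
  shows "span (cone I) = span (g ` I)"
proof
  show "span (cone I) \<subseteq> span (g ` I)"
    using cone_subset_span span_minimal by blast
  show "span (g ` I) \<subseteq> span (cone I)"
    using gen_in_cone[OF assms] by (intro span_mono) auto
qed

lemma direction_space_cone:
  assumes "I \<in> K"
  shows "direction_space (cone I) = span (g ` I)"
proof
  show "direction_space (cone I) \<subseteq> span (g ` I)"
    unfolding direction_space_def
    using cone_subset_span by (intro span_minimal) (auto intro!: span_diff)
  have "g ` I \<subseteq> {x - y |x y. x \<in> cone I \<and> y \<in> cone I}"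
    using gen_in_cone[OF assms] zero_in_cone[OF assms] by force
  then show "span (g ` I) \<subseteq> direction_space (cone I)"
    unfolding direction_space_def by (rule span_mono)
qed

lemma inj_on_gens: "I \<in> K \<Longrightarrow> inj_on g I"
  by (rule inj_onI) (metis dual_gen zero_neq_one)

lemma independent_gens:
  assumes "I \<in> K"
  shows "independent (g ` I)"
  unfolding dependent_def
proof clarify
  fix i assume i: "i \<in> I" "g i \<in> span (g ` I - {g i})"
  have "g ` I - {g i} \<subseteq> {x. dual I i \<bullet> x = 0}"
    using i(1) assms by (auto simp: dual_gen)
  then have "span (g ` I - {g i}) \<subseteq> {x. dual I i \<bullet> x = 0}"
    by (intro span_minimal) (auto simp: subspace_def inner_add_right)
  with i show False using dual_gen[OF assms i(1) i(1)] by auto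
qed

lemma aff_dim_cone:
  assumes "I \<in> K"
  shows "aff_dim (cone I) = int (card I)"
proof -
  have "dim (cone I) = dim (span (g ` I))"
    using span_cone[OF assms] by (metis dim_span)
  also have "\<dots> = card I"
    using independent_gens[OF assms] inj_on_gens[OF assms]
    by (simp add: dim_eq_card_independent card_image)
  finally show ?thesis
    using zero_in_cone[OF assms] by (simp add: aff_dim_zero hull_inc)
qed

text \<open>A point of the span satisfies \<open>x = (\<Sum>i\<in>I. (dual I i \<bullet> x) *\<^sub>R g i)\<close>, which is a
  system of linear equations with integer coefficients.\<close>

lemma rational_polyhedron_cone:
  assumes "I \<in> K"
  shows "rational_polyhedron (cone I)"
proof -
  define q :: "'n \<Rightarrow> real ^ 'n" where "q m = axis m 1 - (\<Sum>i\<in>I. (g i $ m) *\<^sub>R dual I i)" for m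
  have q: "q m \<bullet> x = (x - (\<Sum>i\<in>I. (dual I i \<bullet> x) *\<^sub>R g i)) $ m" for m x
    by (simp add: q_def inner_diff_left inner_sum_left inner_axis' mult.commute)
  \<comment> \<open>Each equation \<open>q m \<bullet> x = 0\<close> enters as two opposite
    inequalities.\<close>
  define H where "H = (\<lambda>i. (- dual I i, 0 :: real)) ` (I - L) \<union> range (\<lambda>m. (q m, 0))
    \<union> range (\<lambda>m. (- q m, 0))"
  have "lattice_vec (q m)" for m
    unfolding q_def using lattice_gen[OF assms] lattice_dual[OF assms]
    by (intro lattice_vec_diff lattice_vec_sum lattice_vec_scale lattice_vec_axis)
      (auto simp: lattice_vec_def)
  then have "\<forall>(a, b)\<in>H. lattice_vec a"
    using lattice_dual[OF assms] by (auto simp: H_def lattice_vec_minus)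
  moreover have "finite H" using finite_gens[OF assms] by (auto simp: H_def)
  moreover have "cone I = {x. \<forall>(a, b)\<in>H. a \<bullet> x \<le> b}"
  proof -
    have "(\<forall>(a, b)\<in>H. a \<bullet> x \<le> b) \<longleftrightarrow> (\<forall>i\<in>I - L. 0 \<le> dual I i \<bullet> x) \<and> (\<forall>m. q m \<bullet> x = 0)" for x
    proof -
      have "(\<forall>m. q m \<bullet> x = 0) \<longleftrightarrow> (\<forall>m. q m \<bullet> x \<le> 0) \<and> (\<forall>m. 0 \<le> q m \<bullet> x)"
        by (metis order.refl order.antisym)
      then show ?thesis by (simp add: H_def ball_Un)
    qed
    moreover have "(\<forall>m. q m \<bullet> x = 0) \<longleftrightarrow> x \<in> span (g ` I)" for x
    proof -
      have "(\<forall>m. q m \<bullet> x = 0) \<longleftrightarrow> x = (\<Sum>i\<in>I. (dual I i \<bullet> x) *\<^sub>R g i)"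
        unfolding q by (simp add: vec_eq_iff)
      moreover have "(\<Sum>i\<in>I. (dual I i \<bullet> x) *\<^sub>R g i) \<in> span (g ` I)"
        by (intro span_sum span_scale span_base) auto
      ultimately show ?thesis using span_gens[OF assms] by metis
    qed
    ultimately show ?thesis using mem_cone_iff[OF assms] by auto
  qed
  ultimately show ?thesis unfolding rational_polyhedron_def by blast
qed

section \<open>Convexity and faces\<close>

lemma convex_cone:
  assumes "I \<in> K"
  shows "convex (cone I)"
proof (rule convexI)
  fix x y and u v :: real
  assume "x \<in> cone I" "y \<in> cone I" "0 \<le> u" "0 \<le> v" "u + v = 1"
  then show "u *\<^sub>R x + v *\<^sub>R y \<in> cone I"
    using assms by (auto simp: mem_cone_iff inner_add_right intro!: span_add span_scale)
qed

lemma closed_cone: "I \<in> K \<Longrightarrow> closed (cone I)"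
proof -
  assume I: "I \<in> K"
  have "cone I = span (g ` I) \<inter> (\<Inter>i\<in>I - L. {x. 0 \<le> dual I i \<bullet> x})"
    using mem_cone_iff[OF I] by auto
  then show "closed (cone I)"
    by (auto intro!: closed_Int closed_INT closed_halfspace_ge)
qed

lemma mem_subcone:
  assumes "I \<in> K" "J \<in> K" "J \<subseteq> I" "x \<in> cone I" "\<forall>i\<in>I - J. dual I i \<bullet> x = 0"
  shows "x \<in> cone J"
proof -
  have "x = (\<Sum>i\<in>I. (dual I i \<bullet> x) *\<^sub>R g i)"
    using assms mem_cone_iff by (intro span_gens) auto
  also have "\<dots> = (\<Sum>i\<in>J. (dual I i \<bullet> x) *\<^sub>R g i)"
    using assms finite_gens by (intro sum.mono_neutral_right) auto
  also have "\<dots> \<in> cone J"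
    using assms mem_cone_iff[OF assms(1)] by (intro gconeI) auto
  finally show ?thesis .
qed

lemma dual_subcone:
  assumes "I \<in> K" "J \<subseteq> I" "x \<in> span (g ` J)" "i \<in> I - J"
  shows "dual I i \<bullet> x = 0"
proof -
  have "g ` J \<subseteq> {x. dual I i \<bullet> x = 0}"
    using assms by (auto simp: dual_gen)
  then have "span (g ` J) \<subseteq> {x. dual I i \<bullet> x = 0}"
    by (intro span_minimal) (auto simp: subspace_def inner_add_right)
  with assms show ?thesis by auto
qed

text \<open>An index outside \<open>J\<close> is outside \<open>L\<close>, so its coefficient is
  nonnegative on the cone. If it vanishes at an interior point of a segment, it vanishes at both
  ends.\<close>

lemma cone_face_of:
  assumes "I \<in> K" "J \<in> K" "J \<subseteq> I"
  shows "cone J face_of cone I"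
  unfolding face_of_def
proof (intro conjI ballI impI)
  show "cone J \<subseteq> cone I" using cone_mono assms by blast
  show "convex (cone J)" using convex_cone assms by blast
  fix a b x assume *: "a \<in> cone I" "b \<in> cone I" "x \<in> cone J" "x \<in> open_segment a b"
  obtain u where u: "0 < u" "u < 1" "x = (1 - u) *\<^sub>R a + u *\<^sub>R b"
    using *(4) by (auto simp: in_segment)
  have "dual I i \<bullet> a = 0 \<and> dual I i \<bullet> b = 0" if i: "i \<in> I - J" for i
  proof -
    have "i \<in> I - L" using i lineality_subset assms by blast
    then have ge: "0 \<le> dual I i \<bullet> a" "0 \<le> dual I i \<bullet> b"
      using * mem_cone_iff[OF assms(1)] by auto
    have "dual I i \<bullet> x = 0"
      using dual_subcone[OF assms(1,3) _ i] *(3) cone_subset_span by blast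
    then have "(1 - u) * (dual I i \<bullet> a) + u * (dual I i \<bullet> b) = 0"
      unfolding u(3) by (simp add: inner_add_right)
    then show ?thesis using u ge by (simp add: add_nonneg_eq_0_iff)
  qed
  then show "a \<in> cone J" "b \<in> cone J"
    using mem_subcone[OF assms] * by auto
qed

text \<open>A face is spanned by the generators which occur with a positive coefficient in some
  point of it; a point with maximal support lies in its relative interior.\<close>

lemma face_of_cone:
  assumes "I \<in> K" "T face_of cone I" "T \<noteq> {}"
  shows "\<exists>J\<in>K. T = cone J"
proof -
  define supp where "supp x = {i \<in> I - L. 0 < dual I i \<bullet> x}" for x
  have fin: "finite (supp x)" for x using finite_gens[OF assms(1)] by (auto simp: supp_def)
  have TI: "T \<subseteq> cone I" using assms(2) face_of_imp_subset by blast
  have bound: "card (supp x) \<le> card I" for x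
    using finite_gens[OF assms(1)] by (intro card_mono) (auto simp: supp_def)
  obtain x0 where x0: "x0 \<in> T" "\<forall>x\<in>T. card (supp x) \<le> card (supp x0)"
  proof -
    obtain x1 where "x1 \<in> T" using assms(3) by blast
    then have "\<exists>x0. x0 \<in> T \<and> (\<forall>x. x \<in> T \<longrightarrow> card (supp x) \<le> card (supp x0))"
      using bound by (intro ex_has_greatest_nat[where b = "Suc (card I)" and k = x1]) (auto simp: less_Suc_eq_le)
    then show ?thesis using that by blast
  qed
  have supp_le: "supp x \<subseteq> supp x0" if x: "x \<in> T" for x
  proof -
    \<comment> \<open>The support of the midpoint contains both supports, so maximality of
      \<open>supp x0\<close> forces the inclusion.\<close>
    define y where "y = (1/2) *\<^sub>R x + (1/2) *\<^sub>R x0"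
    have "y \<in> T"
      unfolding y_def using face_of_imp_convex[OF assms(2)] x x0(1)
      by (intro convexD) auto
    have "0 \<le> dual I i \<bullet> x \<and> 0 \<le> dual I i \<bullet> x0" if "i \<in> I - L" for i
      using that x x0(1) TI mem_cone_iff[OF assms(1)] by auto
    then have "supp x \<union> supp x0 \<subseteq> supp y"
      by (auto simp: supp_def y_def inner_add_right add_pos_nonneg add_nonneg_pos)
    then have "card (supp x \<union> supp x0) \<le> card (supp x0)"
      using x0(2) \<open>y \<in> T\<close> card_mono[OF fin] order_trans by blast
    then show ?thesis
      using card_seteq[of "supp x \<union> supp x0" "supp x0"] fin by blast
  qed
  define J where "J = L \<union> supp x0"
  have JI: "J \<subseteq> I" using lineality_subset[OF assms(1)] by (auto simp: J_def supp_def)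
  have JK: "J \<in> K" using down_closed[OF assms(1) _ JI] by (auto simp: J_def)
  have sub: "T \<subseteq> cone J"
  proof
    fix x assume x: "x \<in> T"
    have "dual I i \<bullet> x = 0" if i: "i \<in> I - J" for i
    proof -
      have "0 \<le> dual I i \<bullet> x" using TI x i mem_cone_iff[OF assms(1)] by (auto simp: J_def)
      moreover have "i \<notin> supp x" using supp_le[OF x] i by (auto simp: J_def)
      ultimately show ?thesis using i by (auto simp: supp_def J_def)
    qed
    then show "x \<in> cone J" using mem_subcone[OF assms(1) JK JI] x TI by blast
  qed
  have "cone J \<subseteq> T"
  proof
    fix y assume y: "y \<in> cone J"
    show "y \<in> T"
    proof (cases "y = x0")
      case False
      \<comment> \<open>\<open>z e\<close> lies beyond \<open>x0\<close> on the ray from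
        \<open>y\<close>. For small \<open>e\<close> it stays in the cone, and then the face
        property applied to the segment from \<open>y\<close> to \<open>z e\<close> puts
        \<open>y\<close> into \<open>T\<close>.\<close>
      define z where "z e = x0 + e *\<^sub>R (x0 - y)" for e :: real
      have "\<forall>\<^sub>F e in at_right 0. \<forall>i\<in>supp x0. 0 < dual I i \<bullet> z e"
      proof (intro eventually_ball_finite ballI fin)
        fix i assume "i \<in> supp x0"
        then have "0 < dual I i \<bullet> z 0" by (simp add: supp_def z_def)
        moreover have "((\<lambda>e. dual I i \<bullet> z e) \<longlongrightarrow> dual I i \<bullet> z 0) (at_right 0)"
          unfolding z_def by (auto intro!: tendsto_eq_intros)
        ultimately show "\<forall>\<^sub>F e in at_right 0. 0 < dual I i \<bullet> z e"
          by (rule order_tendstoD(1)[rotated])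
      qed
      then have "\<forall>\<^sub>F e in at_right (0::real). e > 0 \<and> (\<forall>i\<in>supp x0. 0 < dual I i \<bullet> z e)"
        using eventually_at_right_less by (intro eventually_conj)
      then obtain e where e: "e > 0" "\<forall>i\<in>supp x0. 0 < dual I i \<bullet> z e"
        using eventually_happens'[OF trivial_limit_at_right_real] by blast
      have span: "x0 \<in> span (g ` J)" "y \<in> span (g ` J)"
        using sub x0(1) y cone_subset_span by blast+
      then have zspan: "z e \<in> span (g ` J)"
        unfolding z_def by (intro span_add span_scale span_diff)
      have "z e \<in> cone I"
        unfolding mem_cone_iff[OF assms(1)]
      proof (intro conjI ballI)
        show "z e \<in> span (g ` I)" using zspan span_mono[of "g ` J" "g ` I"] JI by blast
        fix i assume i: "i \<in> I - L"
        show "0 \<le> dual I i \<bullet> z e"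
        proof (cases "i \<in> J")
          case True
          then show ?thesis using e(2) i by (auto simp: J_def less_imp_le)
        next
          case False
          then show ?thesis using dual_subcone[OF assms(1) JI zspan] i by auto
        qed
      qed
      moreover have "y \<in> cone I" using y cone_mono[OF assms(1) JI] by blast
      moreover have "x0 \<in> open_segment y (z e)"
      proof -
        have "x0 = (1 / (1 + e)) *\<^sub>R ((1 + e) *\<^sub>R x0)" using e(1) by simp
        also have "(1 + e) *\<^sub>R x0 = e *\<^sub>R y + z e" by (simp add: z_def algebra_simps)
        also have "(1 / (1 + e)) *\<^sub>R (e *\<^sub>R y + z e) = (1 - 1 / (1 + e)) *\<^sub>R y + (1 / (1 + e)) *\<^sub>R z e"
          using e(1) by (simp add: scaleR_add_right field_simps)
        finally have "x0 = (1 - 1 / (1 + e)) *\<^sub>R y + (1 / (1 + e)) *\<^sub>R z e" .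
        moreover have "0 < 1 / (1 + e)" "1 / (1 + e) < 1" using e(1) by auto
        moreover have "y \<noteq> z e"
        proof
          assume "y = z e"
          then have "(1 + e) *\<^sub>R (x0 - y) = 0" by (simp add: z_def algebra_simps)
          then show False using e(1) False by simp
        qed
        ultimately show ?thesis unfolding in_segment by blast
      qed
      ultimately show ?thesis using assms(2) x0(1) by (auto simp: face_of_def)
    qed (use x0 in simp)
  qed
  with sub JK show ?thesis by blast
qed

lemma polyhedral_complex_fan: "polyhedral_complex (cone ` K)"
  unfolding polyhedral_complex_def
proof (intro conjI ballI allI impI)
  show "finite (cone ` K)" using finite_fan by simp
next
  fix \<sigma> assume "\<sigma> \<in> cone ` K"
  then show "\<sigma> \<noteq> {}" "rational_polyhedron \<sigma>"
    using zero_in_cone rational_polyhedron_cone by auto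
next
  fix \<sigma> \<tau> assume "\<sigma> \<in> cone ` K" "\<tau> face_of \<sigma> \<and> \<tau> \<noteq> {}"
  then show "\<tau> \<in> cone ` K" using face_of_cone by blast
next
  fix \<sigma> \<tau> assume "\<sigma> \<in> cone ` K" "\<tau> \<in> cone ` K"
  then show "(\<sigma> \<inter> \<tau>) face_of \<sigma>" "(\<sigma> \<inter> \<tau>) face_of \<tau>"
    by (auto simp: cone_inter inter_fan intro!: cone_face_of)
qed

section \<open>Facets and cells of codimension one\<close>

lemma fan_extend:
  assumes "I \<in> K" "J \<in> K" "I \<subseteq> J" "card J = Suc (card I)"
  shows "\<exists>i. i \<notin> I \<and> J = insert i I"
proof -
  have "card (J - I) = 1"
    using assms finite_gens by (simp add: card_Diff_subset)
  then obtain i where "J - I = {i}" using card_1_singletonE by blast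
  then show ?thesis using assms(3) by (intro exI[of _ i]) auto
qed

text \<open>Inclusion of cones is inclusion of index sets, and by purity every index set extends to
  one with \<open>k\<close> elements.\<close>

lemma facets_fan:
  assumes "cells X = cone ` K"
  shows "facets X = cone ` {I \<in> K. card I = k}"
proof (intro equalityI subsetI)
  fix \<sigma> assume \<sigma>: "\<sigma> \<in> facets X"
  then obtain I where I: "I \<in> K" "\<sigma> = cone I" by (auto simp: facets_def assms)
  obtain J where J: "J \<in> K" "I \<subseteq> J" "card J = k" using pure[OF I(1)] by blast
  have "cone J = cone I"
    using \<sigma> I J cone_mono by (auto simp: facets_def assms)
  with I J show "\<sigma> \<in> cone ` {I \<in> K. card I = k}" by auto
next
  fix \<sigma> assume "\<sigma> \<in> cone ` {I \<in> K. card I = k}"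
  then obtain I where I: "I \<in> K" "card I = k" "\<sigma> = cone I" by auto
  have "J = I" if J: "J \<in> K" "I \<subseteq> J" for J
    using I card_le[OF J(1)] card_subset_eq[OF finite_gens[OF J(1)] J(2)]
      card_mono[OF finite_gens[OF J(1)] J(2)] by simp
  then show "\<sigma> \<in> facets X"
    using I by (auto simp: facets_def assms cone_subset_iff)
qed

lemma codim1_cells_fan:
  assumes "cells X = cone ` K" "\<tau> \<in> codim1_cells X"
  shows "\<exists>I\<in>K. \<tau> = cone I \<and> Suc (card I) = k"
proof -
  obtain \<sigma> where \<sigma>: "\<tau> \<in> cells X" "\<sigma> \<in> facets X" "\<tau> \<subseteq> \<sigma>" "aff_dim \<tau> = aff_dim \<sigma> - 1"
    using assms(2) by (auto simp: codim1_cells_def)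
  then obtain I J where "I \<in> K" "J \<in> K" "\<tau> = cone I" "\<sigma> = cone J" "card J = k"
    using facets_fan[OF assms(1)] assms(1) by auto
  with \<sigma>(4) show ?thesis by (auto simp: aff_dim_cone)
qed

lemma pure_fan:
  assumes "cells X = cone ` K" "\<And>I. I \<in> K \<Longrightarrow> card I = k \<Longrightarrow> weight X (cone I) \<in> \<int>"
  shows "pure_weighted_complex X"
proof -
  have "\<forall>\<sigma>\<in>facets X. aff_dim \<sigma> = int k" "\<forall>\<sigma>\<in>facets X. weight X \<sigma> \<in> \<int>"
    using aff_dim_cone assms(2) by (auto simp: facets_fan[OF assms(1)])
  then show ?thesis
    unfolding pure_weighted_complex_def assms(1) using polyhedral_complex_fan by blast
qed

text \<open>The vertices of the link of \<open>I\<close> in the simplicial complex \<open>K\<close>.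
  In codimension one they correspond to the facets around the cone.\<close>

definition link :: "'i set \<Rightarrow> 'i set" where
  "link I = {i. i \<notin> I \<and> insert i I \<in> K}"

lemma facets_above:
  assumes "cells X = cone ` K" "I \<in> K" "Suc (card I) = k"
  shows "bij_betw (\<lambda>i. cone (insert i I)) (link I) {\<sigma> \<in> facets X. cone I \<subset> \<sigma>}"
  unfolding bij_betw_def
proof
  show "inj_on (\<lambda>i. cone (insert i I)) (link I)"
    by (rule inj_onI) (auto simp: link_def cone_eq_iff)
  show "(\<lambda>i. cone (insert i I)) ` link I = {\<sigma> \<in> facets X. cone I \<subset> \<sigma>}"
  proof (intro equalityI subsetI)
    fix \<sigma> assume "\<sigma> \<in> (\<lambda>i. cone (insert i I)) ` link I"
    then obtain i where i: "i \<notin> I" "insert i I \<in> K" "\<sigma> = cone (insert i I)" by (auto simp: link_def)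
    then have "card (insert i I) = k" using assms finite_gens by simp
    with i assms show "\<sigma> \<in> {\<sigma> \<in> facets X. cone I \<subset> \<sigma>}"
      by (auto simp: facets_fan[OF assms(1)] cone_psubset_iff)
  next
    fix \<sigma> assume "\<sigma> \<in> {\<sigma> \<in> facets X. cone I \<subset> \<sigma>}"
    then obtain J where J: "J \<in> K" "card J = k" "\<sigma> = cone J" "cone I \<subset> cone J"
      by (auto simp: facets_fan[OF assms(1)])
    then have "I \<subset> J" using cone_psubset_iff assms by blast
    then obtain i where "i \<notin> I" "J = insert i I"
      using fan_extend[of I J] assms J by auto
    then show "\<sigma> \<in> (\<lambda>i. cone (insert i I)) ` link I" using J by (auto simp: link_def)
  qed
qed

section \<open>Primitive normals and balancing\<close>

lemma primitive_normal_gen: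
  assumes "insert i I \<in> K" "I \<in> K" "i \<notin> I"
  shows "is_primitive_normal (cone (insert i I)) (cone I) (g i)"
proof -
  let ?d = "dual (insert i I) i"
  have split: "w - (?d \<bullet> w) *\<^sub>R g i \<in> span (g ` I)" if "w \<in> span (g ` insert i I)" for w
  proof -
    have "w = (?d \<bullet> w) *\<^sub>R g i + (\<Sum>j\<in>I. (dual (insert i I) j \<bullet> w) *\<^sub>R g j)"
      using span_gens[OF assms(1) that] assms finite_gens[OF assms(2)] by simp
    moreover have "(\<Sum>j\<in>I. (dual (insert i I) j \<bullet> w) *\<^sub>R g j) \<in> span (g ` I)"
      by (intro span_sum span_scale span_base) auto
    moreover have "w - a \<in> span (g ` I)" if "w = a + s" "s \<in> span (g ` I)" for a s
      using that by simp
    ultimately show ?thesis by blast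
  qed
  show ?thesis
    unfolding is_primitive_normal_def direction_space_cone[OF assms(1)]
      direction_space_cone[OF assms(2)]
  proof (intro conjI ballI impI)
    show "lattice_vec (g i)" using lattice_gen assms by blast
    show "g i \<in> span (g ` insert i I)" by (intro span_base) auto
    show "\<exists>x\<in>cone I. \<exists>t>0. x + t *\<^sub>R g i \<in> cone (insert i I)"
      using zero_in_cone[OF assms(2)] gen_in_cone[OF assms(1), of i]
      by (intro bexI[of _ 0] exI[of _ 1]) auto
    fix w assume w: "w \<in> span (g ` insert i I)" "lattice_vec w"
    \<comment> \<open>The dual vector is integral on lattice vectors, and subtracting this multiple
      of \<open>g i\<close> from \<open>w\<close> leaves a vector in the span of the smaller
      cone.\<close>
    have "?d \<bullet> w \<in> \<int>"
      using lattice_vec_inner_Ints lattice_dual assms w by blast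
    then obtain n where "?d \<bullet> w = of_int n" by (auto elim: Ints_cases)
    then show "\<exists>n. w - real_of_int n *\<^sub>R g i \<in> span (g ` I)"
      using split[OF w(1)] by (intro exI[of _ n]) auto
  qed
qed

text \<open>The chosen normal is only known up to the span of the smaller cone. The dual vector of
  \<open>i\<close> takes an integral value \<open>m\<close> on it. Since the normal generates the
  lattice modulo that span, \<open>m\<close> is a unit, and since it points into the larger cone,
  \<open>m\<close> is nonnegative; hence \<open>m = 1\<close>.\<close>

lemma primitive_normal_cong:
  assumes "insert i I \<in> K" "I \<in> K" "i \<notin> I"
  shows "primitive_normal (cone (insert i I)) (cone I) - g i \<in> span (g ` I)"
proof -
  define v where "v = primitive_normal (cone (insert i I)) (cone I)"
  let ?d = "dual (insert i I) i"
  have dI: "?d \<bullet> x = 0" if "x \<in> span (g ` I)" for x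
    using dual_subcone[OF assms(1) _ that, of i] assms by auto
  have "is_primitive_normal (cone (insert i I)) (cone I) v"
    unfolding v_def primitive_normal_def using primitive_normal_gen[OF assms] by (rule someI)
  \<comment> \<open>The generation property of \<open>v\<close> is applied to the lattice vector
    \<open>g i\<close> itself.\<close>
  then obtain n :: int and x t where v: "lattice_vec v" "v \<in> span (g ` insert i I)"
      "g i - of_int n *\<^sub>R v \<in> span (g ` I)" "x \<in> cone I" "t > 0" "x + t *\<^sub>R v \<in> cone (insert i I)"
    unfolding is_primitive_normal_def direction_space_cone[OF assms(1)]
      direction_space_cone[OF assms(2)]
    using lattice_gen[OF assms(1)] span_base[of "g i" "g ` insert i I"] by blast
  have one: "?d \<bullet> g i = 1" using dual_gen[OF assms(1), of i i] by simp
  have "?d \<bullet> v \<in> \<int>" using lattice_vec_inner_Ints lattice_dual assms v(1) by blast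
  then obtain m where m: "?d \<bullet> v = of_int m" by (auto elim: Ints_cases)
  have "1 - of_int n * (?d \<bullet> v) = 0"
    using dI[OF v(3)] by (simp add: inner_diff_right one)
  then have "of_int (n * m) = (1 :: real)" by (simp add: m)
  then have nm: "n * m = 1" by linarith
  have "i \<notin> L" using lineality_subset assms by blast
  then have "0 \<le> ?d \<bullet> (x + t *\<^sub>R v)" using v(6) mem_cone_iff[OF assms(1)] by blast
  then have "0 \<le> t * of_int m"
    using dI[of x] v(4) cone_subset_span[of I] by (auto simp: inner_add_right m)
  then have "0 \<le> m" using v(5) by (simp add: zero_le_mult_iff)
  then have "m = 1" using nm by (simp add: zmult_eq_1_iff)
  then have n: "n = 1" using nm by simp
  have "- (g i - of_int n *\<^sub>R v) \<in> span (g ` I)" using v(3) by (rule span_neg)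
  then show ?thesis by (simp add: n v_def)
qed

lemma normal_sum_fan:
  assumes "cells X = cone ` K" "I \<in> K" "Suc (card I) = k"
  shows "normal_sum X (cone I) =
    (\<Sum>i\<in>link I. weight X (cone (insert i I)) *\<^sub>R primitive_normal (cone (insert i I)) (cone I))"
  unfolding normal_sum_def by (rule sum.reindex_bij_betw[OF facets_above[OF assms], symmetric])

text \<open>Balancing may be tested with the generators in place of the chosen primitive normals,
  because the differences lie in the span.\<close>

lemma tropical_fan:
  assumes "cells X = cone ` K" "\<And>I. I \<in> K \<Longrightarrow> card I = k \<Longrightarrow> weight X (cone I) \<in> \<int>"
    and "\<And>I. I \<in> K \<Longrightarrow> Suc (card I) = k \<Longrightarrow>
      (\<Sum>i\<in>link I. weight X (cone (insert i I)) *\<^sub>R g i) \<in> span (g ` I)"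
  shows "tropical_complex X"
  unfolding tropical_complex_def
proof (intro conjI ballI)
  show "pure_weighted_complex X" using pure_fan assms by blast
  fix \<tau> assume "\<tau> \<in> codim1_cells X"
  then obtain I where I: "I \<in> K" "Suc (card I) = k" "\<tau> = cone I"
    using codim1_cells_fan[OF assms(1)] by blast
  let ?w = "\<lambda>i. weight X (cone (insert i I))"
  let ?p = "\<lambda>i. primitive_normal (cone (insert i I)) (cone I)"
  have "normal_sum X \<tau> = (\<Sum>i\<in>link I. ?w i *\<^sub>R g i) + (\<Sum>i\<in>link I. ?w i *\<^sub>R (?p i - g i))"
    unfolding I(3) normal_sum_fan[OF assms(1) I(1,2)] by (simp add: scaleR_diff_right flip: sum.distrib)
  also have "\<dots> \<in> span (g ` I)"
    using I by (intro span_add assms(3) span_sum span_scale primitive_normal_cong) (auto simp: link_def)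
  finally show "normal_sum X \<tau> \<in> direction_space \<tau>"
    using I direction_space_cone by simp
qed

section \<open>Linear parts and weights of divisors\<close>

lemma linear_part_cone:
  assumes "I \<in> K" "integer_affine_on (cone I) \<phi>" "linear f" "\<forall>x\<in>cone I. \<phi> x = f x"
    and "v \<in> span (g ` I)"
  shows "linear_part \<phi> (cone I) v = f v"
proof -
  define a where "a = (SOME a. lattice_vec a \<and> (\<exists>b. \<forall>x\<in>cone I. \<phi> x = a \<bullet> x + b))"
  have "\<exists>a. lattice_vec a \<and> (\<exists>b. \<forall>x\<in>cone I. \<phi> x = a \<bullet> x + b)"
    using assms(2) by (auto simp: integer_affine_on_def)
  from someI_ex[OF this] have "lattice_vec a \<and> (\<exists>b. \<forall>x\<in>cone I. \<phi> x = a \<bullet> x + b)"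
    by (simp add: a_def)
  then obtain b where b: "\<forall>x\<in>cone I. \<phi> x = a \<bullet> x + b" by blast
  \<comment> \<open>\<open>linear_part\<close> picks some affine representation. Comparison at
    \<open>0\<close>, a point of the cone, removes its constant term.\<close>
  have "b = 0"
    using b assms(4) zero_in_cone[OF assms(1)] linear_0[OF assms(3)] by force
  then have "\<forall>x\<in>g ` I. a \<bullet> x = f x"
    using b assms(4) gen_in_cone[OF assms(1)] by auto
  then have "a \<bullet> v = f v"
    by (intro linear_eq_on[OF _ assms(3) assms(5)])
      (auto simp: linear_iff inner_add_right)
  then show ?thesis by (simp add: linear_part_def a_def)
qed

text \<open>Each chosen normal is \<open>g i\<close> plus a vector \<open>u i\<close> of the span of
  the small cone. The contributions of the \<open>u i\<close> to the sum over the facets and to the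
  normal sum agree and cancel, since the linear forms of the facets restrict to \<open>f I\<close>
  there.\<close>

lemma divisor_weight_fan:
  assumes X: "cells X = cone ` K" and I: "I \<in> K" "Suc (card I) = k"
    and aff: "\<And>J. J \<in> K \<Longrightarrow> integer_affine_on (cone J) \<phi>"
    and lin: "\<And>J. J \<in> K \<Longrightarrow> linear (f J)" "\<And>J x. J \<in> K \<Longrightarrow> x \<in> cone J \<Longrightarrow> \<phi> x = f J x"
    and bal: "(\<Sum>i\<in>link I. weight X (cone (insert i I)) *\<^sub>R g i) \<in> span (g ` I)"
  shows "weight (divisor_complex \<phi> X) (cone I) =
    (\<Sum>i\<in>link I. weight X (cone (insert i I)) * \<phi> (g i))
      - f I (\<Sum>i\<in>link I. weight X (cone (insert i I)) *\<^sub>R g i)"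
proof -
  let ?J = "\<lambda>i. insert i I"
  let ?w = "\<lambda>i. weight X (cone (?J i))"
  define u where "u i = primitive_normal (cone (?J i)) (cone I) - g i" for i
  have u: "u i \<in> span (g ` I)" if "i \<in> link I" for i
    using primitive_normal_cong that I by (auto simp: link_def u_def)
  have p: "primitive_normal (cone (?J i)) (cone I) = g i + u i" for i by (simp add: u_def)
  have fI: "f (?J i) x = f I x" if "i \<in> link I" "x \<in> span (g ` I)" for i x
  proof (rule linear_eq_on[OF _ _ that(2)])
    show "linear (f (?J i))" "linear (f I)" using lin(1) I that(1) by (auto simp: link_def)
    fix y assume "y \<in> g ` I"
    then have "y \<in> cone (?J i)" "y \<in> cone I" using gen_in_cone that(1) I by (auto simp: link_def)
    then show "f (?J i) y = f I y" using lin(2) that(1) I by (metis (mono_tags) link_def mem_Collect_eq)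
  qed
  have *: "linear_part \<phi> (cone (?J i)) (?w i *\<^sub>R (g i + u i)) = ?w i * \<phi> (g i) + f I (?w i *\<^sub>R u i)"
    if i: "i \<in> link I" for i
  proof -
    have J: "?J i \<in> K" using i by (simp add: link_def)
    have "u i \<in> span (g ` ?J i)" using u[OF i] span_mono[of "g ` I" "g ` ?J i"] by blast
    then have "linear_part \<phi> (cone (?J i)) (?w i *\<^sub>R (g i + u i)) = f (?J i) (?w i *\<^sub>R (g i + u i))"
      using J lin aff by (intro linear_part_cone span_scale span_add) (auto intro: span_base)
    also have "\<dots> = ?w i * f (?J i) (g i) + ?w i * f (?J i) (u i)"
      using linear_add[OF lin(1)[OF J]] linear_scale[OF lin(1)[OF J]] by (simp add: distrib_left)
    also have "f (?J i) (g i) = \<phi> (g i)"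
      using lin(2)[OF J] gen_in_cone[OF J] by simp
    also have "?w i * f (?J i) (u i) = f I (?w i *\<^sub>R u i)"
      using fI[OF i u[OF i]] linear_scale[OF lin(1)[OF I(1)]] by simp
    finally show ?thesis .
  qed
  have ns: "normal_sum X (cone I) = (\<Sum>i\<in>link I. ?w i *\<^sub>R g i) + (\<Sum>i\<in>link I. ?w i *\<^sub>R u i)"
    unfolding normal_sum_fan[OF X I] p by (simp add: scaleR_add_right sum.distrib)
  have "linear_part \<phi> (cone I) (normal_sum X (cone I)) = f I (normal_sum X (cone I))"
    unfolding ns by (intro linear_part_cone I aff lin span_add[OF bal] span_sum span_scale u ballI)
  also have "\<dots> = f I (\<Sum>i\<in>link I. ?w i *\<^sub>R g i) + (\<Sum>i\<in>link I. f I (?w i *\<^sub>R u i))"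
    unfolding ns using linear_add[OF lin(1)[OF I(1)]] linear_sum[OF lin(1)[OF I(1)]] by simp
  finally have 2: "linear_part \<phi> (cone I) (normal_sum X (cone I)) =
    f I (\<Sum>i\<in>link I. ?w i *\<^sub>R g i) + (\<Sum>i\<in>link I. f I (?w i *\<^sub>R u i))" .
  have "(\<Sum>\<sigma> \<in> {\<sigma> \<in> facets X. cone I \<subset> \<sigma>}. linear_part \<phi> \<sigma> (weight X \<sigma> *\<^sub>R primitive_normal \<sigma> (cone I)))
    = (\<Sum>i\<in>link I. linear_part \<phi> (cone (?J i)) (?w i *\<^sub>R (g i + u i)))"
    unfolding p[symmetric] by (rule sum.reindex_bij_betw[OF facets_above[OF X I], symmetric])
  also have "\<dots> = (\<Sum>i\<in>link I. ?w i * \<phi> (g i)) + (\<Sum>i\<in>link I. f I (?w i *\<^sub>R u i))"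
    by (simp add: * sum.distrib)
  finally show ?thesis by (simp add: divisor_complex_def 2)
qed

text \<open>Removing the facets, as a divisor does, leaves a fan of one dimension less. For purity,
  a maximal index set above \<open>I\<close> is shrunk by one index outside
  \<open>I\<close>.\<close>

lemma unimodular_fan_skeleton:
  assumes "finite L" "card L < k"
  shows "unimodular_fan g L {I \<in> K. card I < k} (k - 1)"
proof unfold_locales
  fix I assume I: "I \<in> {I \<in> K. card I < k}"
  then obtain J where J: "J \<in> K" "I \<subseteq> J" "card J = k" using pure by blast
  have "I \<noteq> J" using I J by auto
  then obtain j where j: "j \<in> J - I" using J by blast
  have "j \<notin> L" using j lineality_subset I by blast
  then have "J - {j} \<in> K"
    using lineality_subset[OF J(1)] by (intro down_closed[OF J(1)]) auto
  moreover have "card (J - {j}) = k - 1" using J j finite_gens by simp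
  moreover have "I \<subseteq> J - {j}" using J j by auto
  ultimately show "\<exists>J\<in>{I \<in> K. card I < k}. I \<subseteq> J \<and> card J = k - 1"
    using assms by (intro bexI[of _ "J - {j}"]) auto
next
  fix I J assume "I \<in> {I \<in> K. card I < k}" "L \<subseteq> J" "J \<subseteq> I"
  then show "J \<in> {I \<in> K. card I < k}"
    using down_closed card_mono[OF finite_gens, of I J] by auto
qed (use finite_fan finite_gens lineality_subset lattice_gen dual_exists gcone_inter in auto)

section \<open>Functions that are linear on the cones\<close>

lemma integer_affine_on_cone:
  assumes "I \<in> K" "linear f" "\<And>x. x \<in> cone I \<Longrightarrow> \<phi> x = f x" "\<And>i. i \<in> I \<Longrightarrow> \<phi> (g i) \<in> \<int>"
  shows "integer_affine_on (cone I) \<phi>"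
  unfolding integer_affine_on_def
proof (intro exI conjI ballI)
  \<comment> \<open>Weighting the dual vectors by the integral values at the generators gives an
    integral form with these values.\<close>
  let ?a = "\<Sum>i\<in>I. \<phi> (g i) *\<^sub>R dual I i"
  show "lattice_vec ?a"
    using assms lattice_dual by (intro lattice_vec_sum lattice_vec_scale) auto
  fix x assume x: "x \<in> cone I"
  have "linear (\<lambda>x. ?a \<bullet> x)" by (auto simp: linear_iff inner_add_right)
  moreover have "?a \<bullet> g i = f (g i)" if "i \<in> I" for i
  proof -
    have "?a \<bullet> g i = (\<Sum>j\<in>I. if i = j then \<phi> (g j) else 0)"
      unfolding inner_sum_left using that assms(1) by (intro sum.cong) (auto simp: dual_gen)
    then show ?thesis using that assms gen_in_cone finite_gens by simp
  qed
  ultimately have "?a \<bullet> x = f x"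
    using assms(2) x cone_subset_span[of I] by (intro linear_eq_on[of _ f x "g ` I"]) auto
  then show "\<phi> x = ?a \<bullet> x + 0" using assms(3) x by simp
qed

lemma continuous_on_fan:
  fixes \<phi> :: "real ^ 'n \<Rightarrow> real"
  assumes "\<And>I. I \<in> K \<Longrightarrow> \<exists>f. linear f \<and> (\<forall>x\<in>cone I. \<phi> x = f x)"
  shows "continuous_on (\<Union>(cone ` K)) \<phi>"
proof (rule continuous_on_closed_Union)
  show "finite K" by (rule finite_fan)
  fix I assume I: "I \<in> K"
  show "closed (cone I)" by (rule closed_cone[OF I])
  obtain f where f: "linear f" "\<forall>x\<in>cone I. \<phi> x = f x" using assms[OF I] by blast
  show "continuous_on (cone I) \<phi>"
    using linear_continuous_on[OF linear_conv_bounded_linear[THEN iffD1, OF f(1)], of "cone I"] f(2)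
    by (simp cong: continuous_on_cong)
qed

text \<open>Different cones share the generators of their intersection, on which all the linear forms agree.\<close>

lemma piecewise_linear_exists:
  fixes val :: "'i \<Rightarrow> real"
  shows "\<exists>\<phi>. (\<forall>I\<in>K. \<exists>f. linear f \<and> (\<forall>x\<in>cone I. \<phi> x = f x)) \<and> (\<forall>I\<in>K. \<forall>i\<in>I. \<phi> (g i) = val i)"
proof -
  define f where "f I x = (\<Sum>i\<in>I. val i * (dual I i \<bullet> x))" for I x
  \<comment> \<open>Some cone containing \<open>x\<close> is selected, and \<open>agree\<close>
    shows that the value is the same for all of them. Off the fan the value is arbitrary.\<close>
  define \<phi> where "\<phi> x = f (SOME I. I \<in> K \<and> x \<in> cone I) x" for x
  have lin: "linear (f I)" for I
    unfolding f_def by (auto simp: linear_iff inner_add_right algebra_simps sum.distrib sum_distrib_left)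
  have gen: "f I (g i) = val i" if "I \<in> K" "i \<in> I" for I i
  proof -
    have "f I (g i) = (\<Sum>j\<in>I. if i = j then val j else 0)"
      unfolding f_def using that by (intro sum.cong) (auto simp: dual_gen)
    then show ?thesis using that finite_gens by simp
  qed
  have agree: "f I x = f J x" if "I \<in> K" "J \<in> K" "x \<in> cone I" "x \<in> cone J" for I J x
  proof -
    have "x \<in> cone (I \<inter> J)" using that gcone_inter by blast
    then have "x \<in> span (g ` (I \<inter> J))" using cone_subset_span by blast
    moreover have "f I y = f J y" if "y \<in> g ` (I \<inter> J)" for y
      using that gen \<open>I \<in> K\<close> \<open>J \<in> K\<close> by auto
    ultimately show ?thesis using linear_eq_on[OF lin[of I] lin[of J]] by blast
  qed
  have \<phi>: "\<phi> x = f I x" if "I \<in> K" "x \<in> cone I" for I x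
    unfolding \<phi>_def using someI[of "\<lambda>I. I \<in> K \<and> x \<in> cone I", OF conjI[OF that]] that
    by (intro agree) auto
  show ?thesis
  proof (rule exI[of _ \<phi>], rule conjI; intro ballI)
    fix I assume I: "I \<in> K"
    show "\<exists>f. linear f \<and> (\<forall>x\<in>cone I. \<phi> x = f x)"
      using \<phi>[OF I] lin by (intro exI[of _ "f I"]) auto
  next
    fix I i assume I: "I \<in> K" and that: "i \<in> I"
    show "\<phi> (g i) = val i"
      using \<phi>[OF I gen_in_cone[OF I that]] gen[OF I that] by simp
  qed
qed

end

section \<open>Cones over chains of sets\<close>

lemma flat_vec_nth [simp]: "flat_vec F $ e = (if e \<in> F then - 1 else 0)"
  by (simp add: flat_vec_def axis_def)

lemma flat_vec_empty [simp]: "flat_vec {} = 0"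
  by (simp add: flat_vec_def)

lemma lattice_flat_vec: "lattice_vec (flat_vec F)"
  by (simp add: lattice_vec_def)

lemma axis_inner_flat_vec: "axis e 1 \<bullet> flat_vec F = (if e \<in> F then - 1 else 0)"
  by (simp add: inner_axis')

abbreviation flat_cone :: "'n::finite set set \<Rightarrow> (real ^ 'n) set" where
  "flat_cone \<equiv> gcone flat_vec {UNIV}"

text \<open>These are the nonempty sets \<open>{e. x $ e \<le> t}\<close>, described without the
  threshold \<open>t\<close>. The full index set qualifies vacuously.\<close>

definition sublevels :: "real ^ 'n::finite \<Rightarrow> 'n set set" where
  "sublevels x = {F. F \<noteq> {} \<and> (\<forall>e\<in>F. \<forall>f. f \<notin> F \<longrightarrow> x $ e < x $ f)}"

lemma UNIV_sublevels: "UNIV \<in> sublevels x"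
  by (simp add: sublevels_def)

lemma empty_sublevels: "{} \<notin> sublevels x"
  by (simp add: sublevels_def)

text \<open>Elements witnessing incomparability of two such sets would each have the strictly
  smaller coordinate.\<close>

lemma chain_sublevels: "chain_subset (sublevels x)"
  unfolding chain_subset_def sublevels_def by (auto dest: less_asym) (meson less_asym)

lemma gcone_add:
  assumes "x \<in> gcone g L I" "i \<in> I" "finite I" "0 \<le> t"
  shows "x + t *\<^sub>R g i \<in> gcone g L I"
proof -
  obtain c where c: "x = (\<Sum>i\<in>I. c i *\<^sub>R g i)" "\<forall>i\<in>I - L. 0 \<le> c i"
    using assms(1) unfolding gcone_def by auto
  have "t *\<^sub>R g i = (\<Sum>j\<in>I. (if j = i then t else 0) *\<^sub>R g j)"
    using assms(2,3) by (simp add: if_distrib[of "\<lambda>a. a *\<^sub>R _"] cong: if_cong)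
  then have "x + t *\<^sub>R g i = (\<Sum>j\<in>I. (c j + (if j = i then t else 0)) *\<^sub>R g j)"
    by (simp add: c(1) scaleR_add_left sum.distrib)
  also have "\<dots> \<in> gcone g L I"
    using c(2) assms(4) by (intro gconeI) auto
  finally show ?thesis .
qed

text \<open>The set where the minimum is attained is a sublevel set, hence everything.\<close>

lemma sublevels_constant:
  assumes "sublevels x = {UNIV}"
  shows "\<exists>a. x = a *\<^sub>R flat_vec UNIV"
proof -
  define m where "m = Min (range (($) x))"
  have m: "m \<le> x $ e" for e by (simp add: m_def)
  have "m \<in> range (($) x)" unfolding m_def by (intro Min_in) auto
  then have "{e. x $ e = m} \<in> sublevels x"
    using m by (force simp: sublevels_def less_le)
  then have "{e. x $ e = m} = UNIV" using assms by auto
  then have "x $ e = m" for e by auto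
  then have "x = (- m) *\<^sub>R flat_vec UNIV" by (simp add: vec_eq_iff)
  then show ?thesis by blast
qed

text \<open>Induction on the number of sublevel sets: raising \<open>x\<close> on a proper sublevel set \<open>F\<close>
  by the height of the step at \<open>F\<close> removes \<open>F\<close> from the sublevel sets.\<close>

lemma flat_coneI:
  fixes x :: "real ^ 'n::finite"
  assumes "sublevels x \<subseteq> C" "UNIV \<in> C"
  shows "x \<in> flat_cone C"
  using assms(1)
proof (induction "card (sublevels x)" arbitrary: x rule: less_induct)
  case less
  show ?case
  proof (cases "sublevels x = {UNIV}")
    case True
    then obtain a where a: "x = a *\<^sub>R flat_vec UNIV" using sublevels_constant by blast
    have "x = (\<Sum>F\<in>C. (if F = UNIV then a else 0) *\<^sub>R flat_vec F)"
      using assms(2) by (simp add: a if_distrib[of "\<lambda>a. a *\<^sub>R _"] cong: if_cong)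
    also have "\<dots> \<in> flat_cone C" by (intro gconeI) auto
    finally show ?thesis .
  next
    case False
    then obtain F where F: "F \<in> sublevels x" "F \<noteq> UNIV" using UNIV_sublevels by blast
    define a where "a = Max ((\<lambda>e. x $ e) ` F)"
    define b where "b = Min ((\<lambda>e. x $ e) ` (- F))"
    have ne: "F \<noteq> {}" "- F \<noteq> {}" using F by (auto simp: sublevels_def)
    have a: "x $ e \<le> a" if "e \<in> F" for e using that by (simp add: a_def)
    have b: "b \<le> x $ e" if "e \<notin> F" for e using that by (simp add: b_def)
    have "a \<in> (\<lambda>e. x $ e) ` F" unfolding a_def using ne by (intro Max_in) auto
    then obtain e0 where e0: "e0 \<in> F" "x $ e0 = a" by auto
    have "b \<in> (\<lambda>e. x $ e) ` (- F)" unfolding b_def using ne by (intro Min_in) auto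
    then obtain f0 where f0: "f0 \<notin> F" "x $ f0 = b" by auto
    have ab: "a < b" using F e0 f0 by (auto simp: sublevels_def)
    \<comment> \<open>\<open>flat_vec F\<close> is \<open>- 1\<close> on \<open>F\<close>, so
      subtracting it raises the coordinates there. Afterwards the maximum over \<open>F\<close>
      equals the minimum over the complement, which destroys \<open>F\<close> as a sublevel
      set.\<close>
    define y where "y = x - (b - a) *\<^sub>R flat_vec F"
    have y: "y $ e = (if e \<in> F then x $ e + (b - a) else x $ e)" for e by (simp add: y_def)
    have yF: "y $ e \<le> y $ f" if "e \<in> F" "f \<notin> F" for e f
      using a[OF that(1)] b[OF that(2)] that by (simp add: y)
    have sub: "sublevels y \<subseteq> sublevels x - {F}"
    proof
      fix G assume G: "G \<in> sublevels y"
      have "G \<noteq> F"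
      proof
        assume "G = F"
        then have "y $ e0 < y $ f0" using G e0 f0 by (auto simp: sublevels_def)
        then show False using e0 f0 by (simp add: y)
      qed
      moreover have "G \<in> sublevels x"
        unfolding sublevels_def
      proof (intro CollectI conjI ballI allI impI)
        show "G \<noteq> {}" using G by (simp add: sublevels_def)
        fix e f assume ef: "e \<in> G" "f \<notin> G"
        then have lt: "y $ e < y $ f" using G by (simp add: sublevels_def)
        show "x $ e < x $ f"
        proof (cases "e \<in> F \<and> f \<notin> F")
          case True
          then show ?thesis using F by (auto simp: sublevels_def)
        next
          case False
          then consider "e \<in> F" "f \<in> F" | "e \<notin> F" "f \<notin> F" | "e \<notin> F" "f \<in> F" by blast
          then show ?thesis
          proof cases
            case 3
            then show ?thesis using yF[of f e] lt by simp
          qed (use lt in \<open>auto simp: y\<close>)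
        qed
      qed
      ultimately show "G \<in> sublevels x - {F}" by blast
    qed
    then have "card (sublevels y) < card (sublevels x)"
      using F(1) by (intro psubset_card_mono) auto
    moreover have "sublevels y \<subseteq> C" using sub less.prems by blast
    ultimately have "y \<in> flat_cone C" using less.hyps by blast
    moreover have "F \<in> C" using F less.prems by blast
    ultimately have "y + (b - a) *\<^sub>R flat_vec F \<in> flat_cone C"
      using ab by (intro gcone_add) auto
    then show ?thesis by (simp add: y_def)
  qed
qed

text \<open>If \<open>G\<close> were missing from \<open>C\<close>, the union \<open>A\<close> of
  the members inside \<open>G\<close> would be proper in \<open>G\<close>, and the smallest member
  \<open>B\<close> not inside \<open>G\<close> would stick out. For \<open>e\<close> in
  \<open>G - A\<close> and \<open>f\<close> in \<open>B - G\<close>, every member containing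
  \<open>e\<close> contains \<open>f\<close>, so the coordinate at \<open>f\<close> is at most that
  at \<open>e\<close>, against the choice of \<open>G\<close>.\<close>

lemma sublevels_flat_cone:
  fixes x :: "real ^ 'n::finite"
  assumes "x \<in> flat_cone C" "chain_subset C" "UNIV \<in> C"
  shows "sublevels x \<subseteq> C"
proof
  fix G assume G: "G \<in> sublevels x"
  obtain c where c: "x = (\<Sum>F\<in>C. c F *\<^sub>R flat_vec F)" "\<forall>F\<in>C - {UNIV}. 0 \<le> c F"
    using assms(1) unfolding gcone_def by auto
  have xe: "x $ e = - (\<Sum>F\<in>C. if e \<in> F then c F else 0)" for e
    by (auto simp: c(1) sum_negf[symmetric] intro!: sum.cong)
  show "G \<in> C"
  proof (rule ccontr)
    assume "G \<notin> C"
    define A where "A = \<Union> {F \<in> C. F \<subseteq> G}"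
    define B where "B = \<Inter> {F \<in> C. \<not> F \<subseteq> G}"
    have "A \<noteq> G"
    proof
      assume "A = G"
      then have "{F \<in> C. F \<subseteq> G} \<noteq> {}" using G by (auto simp: A_def sublevels_def)
      then have "A \<in> {F \<in> C. F \<subseteq> G}"
        unfolding A_def using assms(2)
        by (intro Union_in_chain[of _ UNIV]) (auto simp: subset.chain_def chain_subset_def psubset_eq)
      with \<open>A = G\<close> \<open>G \<notin> C\<close> show False by auto
    qed
    then obtain e where e: "e \<in> G" "e \<notin> A" by (auto simp: A_def)
    have "\<not> B \<subseteq> G"
    proof -
      have "UNIV \<in> {F \<in> C. \<not> F \<subseteq> G}"
        using assms(3) \<open>G \<notin> C\<close> by (auto simp: top.extremum_unique)
      then have "{F \<in> C. \<not> F \<subseteq> G} \<noteq> {}" by blast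
      then have "B \<in> {F \<in> C. \<not> F \<subseteq> G}"
        unfolding B_def using assms(2)
        by (intro Inter_in_chain[of _ UNIV]) (auto simp: subset.chain_def chain_subset_def psubset_eq)
      then show ?thesis by blast
    qed
    then obtain f where f: "f \<in> B" "f \<notin> G" by blast
    have *: "e \<in> F \<Longrightarrow> f \<in> F" "f \<in> F \<and> e \<notin> F \<Longrightarrow> F \<noteq> UNIV" if "F \<in> C" for F
      using e f that by (auto simp: A_def B_def)
    \<comment> \<open>A member containing \<open>f\<close> but not \<open>e\<close> differs from
      \<open>UNIV\<close>, so its coefficient is nonnegative.\<close>
    have "(\<Sum>F\<in>C. if e \<in> F then c F else 0) \<le> (\<Sum>F\<in>C. if f \<in> F then c F else 0)"
      using * c(2) by (intro sum_mono) auto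
    then have "x $ f \<le> x $ e" by (simp add: xe)
    moreover have "x $ e < x $ f" using G e f by (simp add: sublevels_def)
    ultimately show False by simp
  qed
qed

text \<open>Take \<open>e\<close> in \<open>F\<close> outside all smaller members and
  \<open>f\<close> outside \<open>F\<close> in all larger ones. The coordinate at \<open>f\<close>
  minus that at \<open>e\<close> is \<open>1\<close> on the vector of \<open>F\<close> and cancels
  on all others. Without larger members, minus the coordinate at \<open>e\<close> serves.\<close>

lemma chain_dual:
  fixes C :: "'n::finite set set"
  assumes "chain_subset C" "{} \<notin> C" "F \<in> C"
  shows "\<exists>d. lattice_vec d \<and> (\<forall>G\<in>C. d \<bullet> flat_vec G = (if G = F then 1 else 0))"
proof -
  have cmp: "G \<subset> F \<or> G = F \<or> F \<subset> G" if "G \<in> C" for G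
    using assms that by (auto simp: chain_subset_def)
  have "\<exists>e\<in>F. \<forall>G\<in>C. G \<subset> F \<longrightarrow> e \<notin> G"
  proof (cases "{G \<in> C. G \<subset> F} = {}")
    case False
    then have "\<Union> {G \<in> C. G \<subset> F} \<in> {G \<in> C. G \<subset> F}"
      using assms(1)
      by (intro Union_in_chain[of _ UNIV]) (auto simp: subset.chain_def chain_subset_def psubset_eq)
    then show ?thesis by blast
  qed (use assms in force)
  then obtain e where e: "e \<in> F" "\<forall>G\<in>C. G \<subset> F \<longrightarrow> e \<notin> G" by blast
  show ?thesis
  proof (cases "{G \<in> C. F \<subset> G} = {}")
    case True
    have "- axis e 1 \<bullet> flat_vec G = (if G = F then 1 else 0 :: real)" if "G \<in> C" for G
      using cmp[OF that] True e that by (auto simp: axis_inner_flat_vec)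
    then show ?thesis by (intro exI[of _ "- axis e 1"]) (auto intro: lattice_vec_minus)
  next
    case False
    then have "\<Inter> {G \<in> C. F \<subset> G} \<in> {G \<in> C. F \<subset> G}"
      using assms(1)
      by (intro Inter_in_chain[of _ UNIV]) (auto simp: subset.chain_def chain_subset_def psubset_eq)
    then have "F \<subset> \<Inter> {G \<in> C. F \<subset> G}" by simp
    then obtain f where "f \<notin> F" "f \<in> \<Inter> {G \<in> C. F \<subset> G}" by blast
    then have f: "f \<notin> F" "\<forall>G\<in>C. F \<subset> G \<longrightarrow> f \<in> G" by auto
    have "(axis f 1 - axis e 1) \<bullet> flat_vec G = (if G = F then 1 else 0 :: real)" if "G \<in> C" for G
      using cmp[OF that] e f that by (auto simp: axis_inner_flat_vec inner_diff_left)
    then show ?thesis by (intro exI[of _ "axis f 1 - axis e 1"]) (auto intro: lattice_vec_diff)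
  qed
qed

section \<open>From lists of flats to sets of flats\<close>

lemma chain_cone_set:
  fixes Fs :: "'n::finite set list"
  assumes "sorted_wrt (\<subset>) Fs" "Fs \<noteq> []" "last Fs = UNIV"
  shows "chain_cone Fs = flat_cone (set Fs)"
proof -
  have nth_neq: "Fs ! i \<noteq> Fs ! j" if "i < j" "j < length Fs" for i j
    using sorted_wrt_nth_less[OF assms(1) that] by auto
  then have dist: "distinct Fs" by (metis distinct_conv_nth linorder_neqE_nat)
  have bij: "bij_betw ((!) Fs) {..<length Fs} (set Fs)"
    using dist by (simp add: bij_betw_nth)
  \<comment> \<open>The position with unrestricted coefficient is exactly the one holding
    \<open>UNIV\<close>.\<close>
  have last: "Fs ! j = UNIV \<longleftrightarrow> j = length Fs - 1" if "j < length Fs" for j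
  proof (cases "j < length Fs - 1")
    case True
    then show ?thesis using assms(2,3) nth_neq[of j "length Fs - 1"] by (auto simp: last_conv_nth)
  next
    case False
    then have "j = length Fs - 1" using that by linarith
    then show ?thesis using assms(2,3) by (auto simp: last_conv_nth)
  qed
  show ?thesis
  proof (intro equalityI subsetI)
    fix x assume "x \<in> chain_cone Fs"
    then obtain c where c: "x = (\<Sum>j<length Fs. c j *\<^sub>R flat_vec (Fs ! j))" "\<forall>j<length Fs - 1. 0 \<le> c j"
      by (auto simp: chain_cone_def)
    define h where "h = inv_into {..<length Fs} ((!) Fs)"
    have h: "h (Fs ! j) = j" if "j < length Fs" for j
      using bij_betw_inv_into_left[OF bij] that by (auto simp: h_def)
    have "x = (\<Sum>j<length Fs. c (h (Fs ! j)) *\<^sub>R flat_vec (Fs ! j))"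
      unfolding c(1) by (intro sum.cong) (auto simp: h)
    also have "\<dots> = (\<Sum>F\<in>set Fs. c (h F) *\<^sub>R flat_vec F)"
      using sum.reindex_bij_betw[OF bij, of "\<lambda>F. c (h F) *\<^sub>R flat_vec F"] by simp
    also have "\<dots> \<in> flat_cone (set Fs)"
    proof (rule gconeI)
      fix F assume F: "F \<in> set Fs - {UNIV}"
      then obtain j where j: "j < length Fs" "F = Fs ! j" by (auto simp: in_set_conv_nth)
      then have "j < length Fs - 1" using last F by fastforce
      then show "0 \<le> c (h F)" using c(2) j h by simp
    qed
    finally show "x \<in> flat_cone (set Fs)" .
  next
    fix x assume "x \<in> flat_cone (set Fs)"
    then obtain c where c: "x = (\<Sum>F\<in>set Fs. c F *\<^sub>R flat_vec F)" "\<forall>F\<in>set Fs - {UNIV}. 0 \<le> c F"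
      by (auto simp: gcone_def)
    have "x = (\<Sum>j<length Fs. c (Fs ! j) *\<^sub>R flat_vec (Fs ! j))"
      using sum.reindex_bij_betw[OF bij, of "\<lambda>F. c F *\<^sub>R flat_vec F"] c(1) by simp
    moreover have "\<forall>j<length Fs - 1. 0 \<le> c (Fs ! j)"
      using c(2) last by auto
    ultimately show "x \<in> chain_cone Fs"
      unfolding chain_cone_def by (intro CollectI exI[of _ "\<lambda>j. c (Fs ! j)"]) auto
  qed
qed

lemma chain_subset_sorted:
  assumes "finite C" "chain_subset C"
  shows "\<exists>Fs. sorted_wrt (\<subset>) Fs \<and> set Fs = C"
  using assms
proof (induction C rule: finite_psubset_induct)
  case (psubset C)
  show ?case
  proof (cases "C = {}")
    case False
    then obtain m where m: "m \<in> C" "\<forall>F\<in>C. m \<subseteq> F \<longrightarrow> m = F"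
      using finite_has_maximal[OF psubset.hyps(1)] by blast
    then obtain Fs where Fs: "sorted_wrt (\<subset>) Fs" "set Fs = C - {m}"
      using psubset.IH[of "C - {m}"] psubset.prems by (auto simp: chain_subset_def)
    have "\<forall>F\<in>C - {m}. F \<subset> m" using m psubset.prems by (auto simp: chain_subset_def)
    then show ?thesis
      using Fs m by (intro exI[of _ "Fs @ [m]"]) (auto simp: sorted_wrt_append)
  qed (auto intro: exI[of _ "[]"])
qed

text \<open>Sets in place of the lists of \<open>flat_chain\<close>, so that faces and intersections
  of cones become subsets and intersections.\<close>

definition flat_chains :: "'n::finite matroid \<Rightarrow> 'n set set set" where
  "flat_chains N = {C. chain_subset C \<and> UNIV \<in> C \<and> {} \<notin> C \<and> (\<forall>F\<in>C. flat N F)}"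

lemma cells_matroid_variety:
  assumes "ground N = UNIV"
  shows "cells (matroid_variety N) = flat_cone ` flat_chains N"
proof -
  have 1: "chain_cone Fs = flat_cone (set Fs) \<and> set Fs \<in> flat_chains N" if Fs: "flat_chain N Fs" for Fs
  proof
    show "chain_cone Fs = flat_cone (set Fs)"
      using Fs assms by (intro chain_cone_set) (auto simp: flat_chain_def)
    have "chain_subset (set Fs)"
      unfolding chain_subset_def
    proof (intro ballI)
      fix A B assume "A \<in> set Fs" "B \<in> set Fs"
      then obtain i j where "i < length Fs" "j < length Fs" "A = Fs ! i" "B = Fs ! j"
        by (auto simp: in_set_conv_nth)
      moreover have "sorted_wrt (\<subset>) Fs" using Fs by (simp add: flat_chain_def)
      ultimately show "A \<subseteq> B \<or> B \<subseteq> A"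
        using sorted_wrt_nth_less[of "(\<subset>)" Fs] by (metis linorder_neqE_nat order.refl psubset_imp_subset)
    qed
    moreover have "UNIV \<in> set Fs" using Fs assms last_in_set[of Fs] by (auto simp: flat_chain_def)
    ultimately show "set Fs \<in> flat_chains N" using Fs by (auto simp: flat_chain_def flat_chains_def)
  qed
  have 2: "\<exists>Fs. flat_chain N Fs \<and> set Fs = C" if C: "C \<in> flat_chains N" for C
  proof -
    obtain Fs where Fs: "sorted_wrt (\<subset>) Fs" "set Fs = C"
      using chain_subset_sorted[of C] C by (auto simp: flat_chains_def)
    have ne: "Fs \<noteq> []" using Fs C by (auto simp: flat_chains_def)
    have "last Fs = UNIV"
    proof (rule ccontr)
      assume n: "last Fs \<noteq> UNIV"
      obtain As l where As: "Fs = As @ [l]" using ne by (metis rev_exhaust)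
      then have "UNIV \<in> set As" using Fs C n by (auto simp: flat_chains_def)
      moreover have "\<forall>F\<in>set As. F \<subset> l" using Fs(1) As by (simp add: sorted_wrt_append)
      ultimately show False using top.extremum_strict by blast
    qed
    then show ?thesis
      using Fs ne C assms by (intro exI[of _ Fs]) (auto simp: flat_chain_def flat_chains_def)
  qed
  show ?thesis
  proof (intro equalityI subsetI)
    fix \<sigma> assume "\<sigma> \<in> cells (matroid_variety N)"
    then show "\<sigma> \<in> flat_cone ` flat_chains N" using 1 by (auto simp: matroid_variety_def)
  next
    fix \<sigma> assume "\<sigma> \<in> flat_cone ` flat_chains N"
    then obtain C where "C \<in> flat_chains N" "\<sigma> = flat_cone C" by blast
    with 2 obtain Fs where "flat_chain N Fs" "\<sigma> = flat_cone (set Fs)" by blast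
    with 1 show "\<sigma> \<in> cells (matroid_variety N)" by (auto simp: matroid_variety_def)
  qed
qed

section \<open>The fine subdivision of a matroid variety\<close>

locale loopfree_matroid =
  fixes N :: "'n::finite matroid"
  assumes matroid: "is_matroid N" and loopfree: "loopfree N" and ground: "ground N = UNIV"
begin

abbreviation r :: "'n set \<Rightarrow> nat" where "r \<equiv> rk N"

lemma rk_mono: "A \<subseteq> B \<Longrightarrow> r A \<le> r B"
  using matroid by (simp add: is_matroid_def ground)

lemma rk_submod: "r (A \<union> B) + r (A \<inter> B) \<le> r A + r B"
  using matroid by (simp add: is_matroid_def ground)

lemma rk_empty [simp]: "r {} = 0"
proof -
  have "r {} \<le> card ({} :: 'n set)"
    using matroid unfolding is_matroid_def ground by blast
  then show ?thesis by simp
qed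

lemma rk_singleton: "r {e} = 1"
  using loopfree by (simp add: loopfree_def ground)

lemma rk_insert_le: "r (insert e A) \<le> Suc (r A)"
  using rk_submod[of A "{e}"] rk_singleton[of e] by simp

lemma rk_pos: "A \<noteq> {} \<Longrightarrow> 0 < r A"
proof -
  assume "A \<noteq> {}"
  then obtain e where "e \<in> A" by blast
  then show "0 < r A" using rk_mono[of "{e}" A] rk_singleton[of e] by simp
qed

lemma flat_iff: "flat N F \<longleftrightarrow> (\<forall>e. e \<notin> F \<longrightarrow> r F < r (insert e F))"
  by (auto simp: flat_def ground)

lemma flat_UNIV: "flat N UNIV"
  by (simp add: flat_iff)

lemma flat_empty: "flat N {}"
  by (simp add: flat_iff rk_singleton)

lemma rk_less_flat: "flat N F \<Longrightarrow> F \<subset> G \<Longrightarrow> r F < r G"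
proof -
  assume F: "flat N F" "F \<subset> G"
  then obtain e where e: "e \<in> G" "e \<notin> F" by blast
  then have "r F < r (insert e F)" using F by (simp add: flat_iff)
  also have "\<dots> \<le> r G" using F e by (intro rk_mono) auto
  finally show "r F < r G" .
qed

lemma flat_eq: "flat N F \<Longrightarrow> F \<subseteq> G \<Longrightarrow> r G \<le> r F \<Longrightarrow> F = G"
  using rk_less_flat[of F G] by auto

section \<open>Closure in a matroid\<close>

definition cl :: "'n set \<Rightarrow> 'n set" where
  "cl A = {e. r (insert e A) = r A}"

lemma subset_cl: "A \<subseteq> cl A"
  by (auto simp: cl_def insert_absorb)

text \<open>Elements are added one at a time. Submodularity for \<open>A \<union> B\<close> and
  \<open>insert e A\<close>, both of rank \<open>r A\<close> with \<open>A\<close> in the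
  intersection, bounds the rank of the union.\<close>

lemma rk_union_cl: "finite B \<Longrightarrow> B \<subseteq> cl A \<Longrightarrow> r (A \<union> B) = r A"
proof (induction B rule: finite_induct)
  case (insert e B)
  then have "r (A \<union> B) = r A" "r (insert e A) = r A" by (auto simp: cl_def)
  moreover have "(A \<union> B) \<union> insert e A = A \<union> insert e B" by blast
  ultimately have "r (A \<union> insert e B) + r ((A \<union> B) \<inter> insert e A) \<le> r A + r A"
    using rk_submod[of "A \<union> B" "insert e A"] by simp
  moreover have "r A \<le> r ((A \<union> B) \<inter> insert e A)" by (intro rk_mono) auto
  moreover have "r A \<le> r (A \<union> insert e B)" by (intro rk_mono) auto
  ultimately show ?case by simp
qed simp

lemma rk_cl [simp]: "r (cl A) = r A"
  using rk_union_cl[of "cl A" A] subset_cl[of A] by (simp add: Un_absorb1)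

lemma flat_cl: "flat N (cl A)"
  unfolding flat_iff
proof (intro allI impI)
  fix e assume "e \<notin> cl A"
  then have "r A < r (insert e A)" using rk_mono[of A "insert e A"] by (auto simp: cl_def less_le)
  also have "\<dots> \<le> r (insert e (cl A))" using subset_cl[of A] by (intro rk_mono) auto
  finally show "r (cl A) < r (insert e (cl A))" by simp
qed

text \<open>By submodularity for \<open>F\<close> and \<open>insert e A\<close>, an element that
  does not raise the rank of \<open>A\<close> does not raise that of \<open>F\<close>.\<close>

lemma cl_least:
  assumes "flat N F" "A \<subseteq> F"
  shows "cl A \<subseteq> F"
proof
  fix e assume e: "e \<in> cl A"
  show "e \<in> F"
  proof (rule ccontr)
    assume "e \<notin> F"
    then have "r F < r (insert e F)" using assms by (simp add: flat_iff)
    moreover have "r (insert e F) + r (F \<inter> insert e A) \<le> r F + r (insert e A)"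
      using rk_submod[of F "insert e A"] assms(2) by (simp add: Un_absorb2 insert_absorb)
    moreover have "r A \<le> r (F \<inter> insert e A)" using assms(2) by (intro rk_mono) auto
    ultimately show False using e by (simp add: cl_def)
  qed
qed

text \<open>The rank grows because \<open>G\<close> is flat, and by at most the rank of a single
  element.\<close>

lemma rk_cl_insert:
  assumes "flat N G" "e \<notin> G"
  shows "r (cl (insert e G)) = Suc (r G)"
  using assms rk_insert_le[of e G] by (auto simp: flat_iff Suc_le_eq intro: le_antisym)

section \<open>Ranks along chains of flats\<close>

lemma rk_inj_chain:
  assumes "C \<in> flat_chains N"
  shows "inj_on r C"
proof (rule inj_onI)
  fix F G assume "F \<in> C" "G \<in> C" "r F = r G"
  then show "F = G"
    using assms flat_eq[of F G] flat_eq[of G F] by (auto simp: flat_chains_def chain_subset_def)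
qed

lemma rk_chain_range:
  assumes "C \<in> flat_chains N"
  shows "r ` C \<subseteq> {1..r UNIV}"
proof
  fix j assume "j \<in> r ` C"
  then obtain F where "F \<in> C" "j = r F" by blast
  moreover from this have "F \<noteq> {}" using assms by (auto simp: flat_chains_def)
  ultimately show "j \<in> {1..r UNIV}" using rk_pos[of F] rk_mono[of F UNIV] by simp
qed

lemma card_chain_le:
  assumes "C \<in> flat_chains N"
  shows "card C \<le> r UNIV"
  using card_inj_on_le[OF rk_inj_chain[OF assms] rk_chain_range[OF assms]] by simp

text \<open>\<open>G\<close> is the largest member of rank below the missing value \<open>k\<close>,
  with the empty set as fallback. \<open>H\<close> is the smallest member of rank above
  \<open>k\<close>, which exists because \<open>UNIV\<close> belongs to the chain.\<close>

lemma chain_gap: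
  assumes C: "C \<in> flat_chains N" and k: "k \<in> {1..r UNIV}" "k \<notin> r ` C"
  obtains G H where "G \<in> insert {} C" "H \<in> C" "r G < k" "k < r H" "G \<subset> H"
    "\<And>F. F \<in> C \<Longrightarrow> F \<subseteq> G \<or> H \<subseteq> F"
proof -
  have ch: "F \<subseteq> F' \<or> F' \<subseteq> F" if "F \<in> insert {} C" "F' \<in> insert {} C" for F F'
    using C that by (auto simp: flat_chains_def chain_subset_def)
  have fl: "flat N F" if "F \<in> insert {} C" for F
    using C that flat_empty by (auto simp: flat_chains_def)
  define A where "A = {F \<in> insert {} C. r F < k}"
  define B where "B = {F \<in> C. k < r F}"
  have "{} \<in> A" using k by (simp add: A_def)
  then obtain G where G: "G \<in> A" "\<forall>F\<in>A. G \<subseteq> F \<longrightarrow> G = F"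
    using finite_has_maximal[of A] by (metis finite empty_iff)
  have "UNIV \<in> C" using C by (simp add: flat_chains_def)
  then have "k \<noteq> r UNIV" using k(2) by blast
  then have "UNIV \<in> B" using k \<open>UNIV \<in> C\<close> by (simp add: B_def)
  then obtain H where H: "H \<in> B" "\<forall>F\<in>B. F \<subseteq> H \<longrightarrow> H = F"
    using finite_has_minimal[of B] by (metis finite empty_iff)
  have GH: "r G < k" "k < r H" "G \<in> insert {} C" "H \<in> C" using G H by (auto simp: A_def B_def)
  have "\<not> H \<subseteq> G" using rk_mono[of H G] GH by auto
  then have "G \<subset> H" using ch[of G H] GH by blast
  moreover have "F \<subseteq> G \<or> H \<subseteq> F" if F: "F \<in> C" for F
  proof -
    have "r F \<noteq> k" using k F by blast
    then consider "F \<in> A" | "F \<in> B" using F by (auto simp: A_def B_def linorder_neq_iff)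
    then show ?thesis
    proof cases
      case 1
      then show ?thesis using ch[of F G] G F GH by blast
    next
      case 2
      then show ?thesis using ch[of F H] H F GH by blast
    qed
  qed
  ultimately show ?thesis using that GH by blast
qed

lemma insert_chain:
  assumes C: "C \<in> flat_chains N" and GH: "\<And>F'. F' \<in> C \<Longrightarrow> F' \<subseteq> G \<or> H \<subseteq> F'"
    and F: "flat N F" "F \<noteq> {}" "G \<subseteq> F" "F \<subseteq> H"
  shows "insert F C \<in> flat_chains N"
proof -
  have "F' \<subseteq> F \<or> F \<subseteq> F'" if "F' \<in> C" for F' using GH[OF that] F by blast
  then show ?thesis using C F by (auto simp: flat_chains_def chain_subset_def)
qed

text \<open>Some rank \<open>k\<close> is missing from a short chain. In the gap around it, the
  closure of \<open>G\<close> with one element of \<open>H\<close> has rank at most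
  \<open>k\<close>, hence below that of \<open>H\<close>, and is therefore new.\<close>

lemma chain_extend:
  assumes C: "C \<in> flat_chains N" and less: "card C < r UNIV"
  shows "\<exists>F. F \<notin> C \<and> insert F C \<in> flat_chains N"
proof -
  have "card (r ` C) < card {1..r UNIV}" using card_image[OF rk_inj_chain[OF C]] less by simp
  then have "r ` C \<noteq> {1..r UNIV}" by (metis less_irrefl)
  then obtain k where k: "k \<in> {1..r UNIV}" "k \<notin> r ` C" using rk_chain_range[OF C] by blast
  obtain G H where GH: "G \<in> insert {} C" "H \<in> C" "r G < k" "k < r H" "G \<subset> H"
    "\<And>F. F \<in> C \<Longrightarrow> F \<subseteq> G \<or> H \<subseteq> F" using chain_gap[OF C k] by blast
  obtain e where e: "e \<in> H" "e \<notin> G" using GH by blast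
  define F where "F = cl (insert e G)"
  have fl: "flat N G" "flat N H" using C GH flat_empty by (auto simp: flat_chains_def)
  have rF: "r F = Suc (r G)" unfolding F_def using fl e by (intro rk_cl_insert) auto
  have eF: "e \<in> F" "G \<subseteq> F" using subset_cl[of "insert e G"] by (auto simp: F_def)
  have FH: "F \<subseteq> H" unfolding F_def using e GH by (intro cl_least[OF fl(2)]) auto
  have "F \<notin> C"
  proof
    assume "F \<in> C"
    then have "H \<subseteq> F" using GH(6) e eF by blast
    then have "r H \<le> r F" by (rule rk_mono)
    then show False using rF GH by simp
  qed
  moreover have "insert F C \<in> flat_chains N"
    using eF FH flat_cl GH(6) by (intro insert_chain[OF C, of G H]) (auto simp: F_def)
  ultimately show ?thesis by blast
qed

lemma chain_pure:
  assumes "C \<in> flat_chains N"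
  shows "\<exists>D\<in>flat_chains N. C \<subseteq> D \<and> card D = r UNIV"
  using assms
proof (induction "r UNIV - card C" arbitrary: C rule: less_induct)
  case less
  show ?case
  proof (cases "card C = r UNIV")
    case False
    then have lt: "card C < r UNIV" using card_chain_le[OF less.prems] by simp
    then obtain F where F: "F \<notin> C" "insert F C \<in> flat_chains N"
      using chain_extend less.prems by blast
    then have "r UNIV - card (insert F C) < r UNIV - card C" using lt by simp
    then obtain D where "D \<in> flat_chains N" "insert F C \<subseteq> D" "card D = r UNIV"
      using less.hyps[OF _ F(2)] by blast
    then show ?thesis by blast
  qed (use less.prems in blast)
qed

section \<open>The fan of chains of flats and its balancing\<close>

sublocale fan: unimodular_fan flat_vec "{UNIV}" "flat_chains N" "r UNIV"
proof unfold_locales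
  fix C D :: "'n set set" and F
  show "finite (flat_chains N)" "finite C" by simp_all
  assume C: "C \<in> flat_chains N"
  show "{UNIV} \<subseteq> C" using C by (simp add: flat_chains_def)
  show "\<exists>D\<in>flat_chains N. C \<subseteq> D \<and> card D = r UNIV" by (rule chain_pure[OF C])
  show "card C \<le> r UNIV" by (rule card_chain_le[OF C])
  show "D \<in> flat_chains N" if "{UNIV} \<subseteq> D" "D \<subseteq> C"
    using C that by (auto simp: flat_chains_def chain_subset_def)
  show "\<exists>d. lattice_vec d \<and> (\<forall>G\<in>C. d \<bullet> flat_vec G = (if G = F then 1 else 0))" if "F \<in> C"
    using C that by (intro chain_dual) (auto simp: flat_chains_def)
  show "flat_cone C \<inter> flat_cone D \<subseteq> flat_cone (C \<inter> D)" if D: "D \<in> flat_chains N"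
  proof
    fix x assume x: "x \<in> flat_cone C \<inter> flat_cone D"
    \<comment> \<open>Membership in a cone depends only on whether the chain contains the sublevel
      sets, a condition compatible with intersections.\<close>
    have "sublevels x \<subseteq> C" "sublevels x \<subseteq> D"
      using x C D by (auto simp: flat_chains_def dest!: sublevels_flat_cone)
    then show "x \<in> flat_cone (C \<inter> D)"
      using C D by (intro flat_coneI) (auto simp: flat_chains_def)
  qed
qed (rule lattice_flat_vec)

lemma cells_mv: "cells (matroid_variety N) = flat_cone ` flat_chains N"
  by (rule cells_matroid_variety[OF ground])

text \<open>One flat short of a maximal chain, exactly one rank \<open>k\<close> is missing. The
  neighbours then have ranks \<open>k - 1\<close> and \<open>k + 1\<close>, and a flat that can be
  inserted must have rank \<open>k\<close>. The lower neighbour may be the empty set.\<close>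

lemma link_gap:
  assumes C: "C \<in> flat_chains N" and card: "Suc (card C) = r UNIV"
  obtains G H where "G \<in> insert {} C" "H \<in> C" "flat N G" "flat N H" "G \<subset> H" "r H = r G + 2"
    "\<forall>F\<in>C. F \<subseteq> G \<or> H \<subseteq> F" "fan.link C = {F. flat N F \<and> G \<subset> F \<and> F \<subset> H}"
proof -
  have "card ({1..r UNIV} - r ` C) = 1"
    using card card_image[OF rk_inj_chain[OF C]] rk_chain_range[OF C] by (simp add: card_Diff_subset)
  then obtain k where k: "{1..r UNIV} - r ` C = {k}" using card_1_singletonE by blast
  then have kC: "k \<in> {1..r UNIV}" "k \<notin> r ` C" by auto
  obtain G H where GH: "G \<in> insert {} C" "H \<in> C" "r G < k" "k < r H" "G \<subset> H"
    "\<And>F. F \<in> C \<Longrightarrow> F \<subseteq> G \<or> H \<subseteq> F" using chain_gap[OF C kC] by blast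
  have fl: "flat N G" "flat N H" using C GH flat_empty by (auto simp: flat_chains_def)
  have all: "j \<in> r ` C" if "j \<in> {1..r UNIV}" "j \<noteq> k" for j using k that by blast
  have rG: "r G = k - 1"
  proof (rule ccontr)
    assume n: "r G \<noteq> k - 1"
    then have "k - 1 \<in> r ` C" using GH(3) kC(1) by (intro all) auto
    then obtain F where F: "F \<in> C" "r F = k - 1" by auto
    then show False
      using GH(6)[OF F(1)] rk_mono[of F G] rk_mono[of H F] n GH(3,4) by auto
  qed
  have rH: "r H = k + 1"
  proof (rule ccontr)
    assume n: "r H \<noteq> k + 1"
    then have "k + 1 \<in> r ` C" using GH(4) rk_mono[of H UNIV] by (intro all) auto
    then obtain F where F: "F \<in> C" "r F = k + 1" by auto
    then show False
      using GH(6)[OF F(1)] rk_mono[of F G] rk_mono[of H F] n GH(3,4) by auto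
  qed
  have "fan.link C = {F. flat N F \<and> G \<subset> F \<and> F \<subset> H}"
  proof (intro equalityI subsetI)
    fix F assume "F \<in> fan.link C"
    then have F: "F \<notin> C" "insert F C \<in> flat_chains N" by (auto simp: fan.link_def)
    have flF: "flat N F" "F \<noteq> {}" using F by (auto simp: flat_chains_def)
    have "r F \<in> {1..r UNIV}" using rk_chain_range[OF F(2)] by auto
    moreover have "r F \<notin> r ` C"
      using rk_inj_chain[OF F(2)] F(1) by (auto simp: inj_on_def)
    ultimately have rF: "r F = k" using all by blast
    have "G \<subseteq> F \<or> F \<subseteq> G" "H \<subseteq> F \<or> F \<subseteq> H"
      using F(2) GH(1,2) by (auto simp: flat_chains_def chain_subset_def)
    then have "G \<subset> F" "F \<subset> H"
      using rk_mono[of F G] rk_mono[of H F] rF GH(3,4) by auto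
    then show "F \<in> {F. flat N F \<and> G \<subset> F \<and> F \<subset> H}" using flF by blast
  next
    fix F assume "F \<in> {F. flat N F \<and> G \<subset> F \<and> F \<subset> H}"
    then have F: "flat N F" "G \<subset> F" "F \<subset> H" by auto
    then have "F \<notin> C" using GH(6) by blast
    moreover have "insert F C \<in> flat_chains N"
      using F GH(6) by (intro insert_chain[OF C, of G H]) auto
    ultimately show "F \<in> fan.link C" by (simp add: fan.link_def)
  qed
  moreover have "r H = r G + 2" using rG rH kC by simp
  ultimately show ?thesis using that[OF GH(1,2) fl GH(5)] GH(6) by blast
qed

text \<open>The sets \<open>F - G\<close> partition \<open>H - G\<close>.\<close>

lemma sum_flats_between:
  assumes G: "flat N G" and H: "flat N H" and GH: "G \<subset> H" "r H = r G + 2"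
  defines "S \<equiv> {F. flat N F \<and> G \<subset> F \<and> F \<subset> H}"
  shows "(\<Sum>F\<in>S. flat_vec F) = flat_vec H + (real (card S) - 1) *\<^sub>R flat_vec G"
proof -
  have rS: "r F = Suc (r G)" if "F \<in> S" for F
  proof -
    have "flat N F" "G \<subset> F" "F \<subset> H" using that by (auto simp: S_def)
    then have "r G < r F" "r F < r H" using rk_less_flat[OF G] rk_less_flat[of F H] by blast+
    then show ?thesis using GH(2) by simp
  qed
  have fib: "{F \<in> S. e \<in> F} = {cl (insert e G)}" if e: "e \<in> H" "e \<notin> G" for e
  proof (intro equalityI subsetI)
    fix F assume "F \<in> {F \<in> S. e \<in> F}"
    then have F: "F \<in> S" "e \<in> F" by auto
    then have "cl (insert e G) \<subseteq> F" by (intro cl_least) (auto simp: S_def)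
    then have "cl (insert e G) = F"
      using rS[OF F(1)] rk_cl_insert[OF G e(2)] by (intro flat_eq flat_cl) auto
    then show "F \<in> {cl (insert e G)}" by simp
  next
    fix F assume "F \<in> {cl (insert e G)}"
    then have F: "F = cl (insert e G)" by simp
    have sub: "insert e G \<subseteq> F" unfolding F by (rule subset_cl)
    moreover have "F \<subseteq> H" unfolding F using H e GH by (intro cl_least) auto
    moreover have "F \<noteq> H" using rk_cl_insert[OF G e(2)] GH(2) by (auto simp: F)
    ultimately show "F \<in> {F \<in> S. e \<in> F}" using flat_cl e by (auto simp: S_def F)
  qed
  have "S \<noteq> {}"
  proof -
    obtain e where "e \<in> H" "e \<notin> G" using GH(1) by blast
    then show ?thesis using fib by blast
  qed
  \<comment> \<open>A coordinate of the sum counts, up to sign, the flats of \<open>S\<close>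
    containing \<open>e\<close>: all of them for \<open>e\<close> in \<open>G\<close>, one on
    \<open>H - G\<close>, none outside \<open>H\<close>.\<close>
  have "(\<Sum>F\<in>S. flat_vec F) $ e = (flat_vec H + (real (card S) - 1) *\<^sub>R flat_vec G) $ e" for e
  proof -
    have "(\<Sum>F\<in>S. flat_vec F) $ e = - real (card {F \<in> S. e \<in> F})"
      by (simp add: sum.If_cases Int_def)
    moreover have "{F \<in> S. e \<in> F} = S" if "e \<in> G" using that by (auto simp: S_def)
    moreover have "{F \<in> S. e \<in> F} = {}" if "e \<notin> H" using that by (auto simp: S_def)
    ultimately show ?thesis using fib[of e] GH(1) by (cases "e \<in> G"; cases "e \<in> H") auto
  qed
  then show ?thesis by (simp add: vec_eq_iff)
qed

lemma link_sum_span: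
  assumes "C \<in> flat_chains N" "Suc (card C) = r UNIV"
  shows "(\<Sum>F\<in>fan.link C. flat_vec F) \<in> span (flat_vec ` C)"
proof -
  obtain G H where GH: "G \<in> insert {} C" "H \<in> C" "flat N G" "flat N H" "G \<subset> H" "r H = r G + 2"
    "\<forall>F\<in>C. F \<subseteq> G \<or> H \<subseteq> F" "fan.link C = {F. flat N F \<and> G \<subset> F \<and> F \<subset> H}"
    by (rule link_gap[OF assms])
  \<comment> \<open>If \<open>G\<close> is empty, its vector is \<open>0\<close>.\<close>
  have "flat_vec G \<in> span (flat_vec ` C)" "flat_vec H \<in> span (flat_vec ` C)"
    using GH(1,2) by (auto intro: span_base span_zero)
  then show ?thesis
    unfolding GH(8) sum_flats_between[OF GH(3-6)] by (intro span_add span_scale)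
qed

lemma tropical_mv: "tropical_complex (matroid_variety N)"
  by (rule fan.tropical_fan[OF cells_mv]) (auto simp: matroid_variety_def link_sum_span)

lemma rk_UNIV_pos: "0 < r UNIV"
  by (rule rk_pos) simp

end

section \<open>Divisors and elementary quotients\<close>

lemma facets_cong: "cells X = cells Y \<Longrightarrow> facets X = facets Y"
  by (simp add: facets_def)

text \<open>A facet contained in a facet of the same complex equals it, so weights are compared
  facet by facet.\<close>

lemma refines_same_cells:
  assumes "pure_weighted_complex Z" "cells X = cells Z"
    and "\<And>\<sigma>. \<sigma> \<in> facets Z \<Longrightarrow> weight X \<sigma> = weight Z \<sigma>"
  shows "refines Z X"
proof -
  have fac: "facets X = facets Z" using assms(2) by (rule facets_cong)
  have "pure_weighted_complex X"
    using assms by (simp add: pure_weighted_complex_def fac)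
  moreover have "weight Z \<rho> = weight X \<sigma>" if "\<rho> \<in> facets Z" "\<sigma> \<in> facets X" "\<rho> \<subseteq> \<sigma>" for \<rho> \<sigma>
  proof -
    have "\<sigma> = \<rho>" using that unfolding fac unfolding facets_def by blast
    then show ?thesis using that(1) assms(3) by simp
  qed
  ultimately show ?thesis
    using assms(1) unfolding refines_def assms(2) by blast
qed

lemma weight_nonzero_part [simp]: "weight (nonzero_part X) = weight X"
  by (simp add: nonzero_part_def)

lemma (in unimodular_fan) cells_nonzero_part:
  assumes "cells X = cone ` K" "\<And>I. I \<in> K \<Longrightarrow> card I = k \<Longrightarrow> weight X (cone I) \<noteq> 0"
  shows "cells (nonzero_part X) = cells X"
proof -
  have "\<exists>\<sigma>\<in>facets X. weight X \<sigma> \<noteq> 0 \<and> \<tau> \<subseteq> \<sigma>" if "\<tau> \<in> cells X" for \<tau>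
  proof -
    obtain I where I: "I \<in> K" "\<tau> = cone I" using \<open>\<tau> \<in> cells X\<close> assms(1) by blast
    obtain J where J: "J \<in> K" "I \<subseteq> J" "card J = k" using pure[OF I(1)] by blast
    then have "cone J \<in> facets X" "weight X (cone J) \<noteq> 0" "\<tau> \<subseteq> cone J"
      using assms(2) cone_mono[of J I] I(2) by (auto simp: facets_fan[OF assms(1)])
    then show ?thesis by blast
  qed
  then show ?thesis by (auto simp: nonzero_part_def)
qed

context loopfree_matroid
begin

lemma pure_mv: "pure_weighted_complex (matroid_variety N)"
  using tropical_mv by (simp add: tropical_complex_def)

lemma cells_nonzero_part_mv: "cells (nonzero_part (matroid_variety N)) = cells (matroid_variety N)"
  by (rule fan.cells_nonzero_part[OF cells_mv]) (simp add: matroid_variety_def)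

lemma refines_mv: "refines (matroid_variety N) (nonzero_part (matroid_variety N))"
  by (intro refines_same_cells pure_mv cells_nonzero_part_mv) simp

lemma cycle_eq_mv: "cycle_eq (matroid_variety N) (matroid_variety N)"
  unfolding cycle_eq_def using tropical_mv refines_mv by blast

end

text \<open>The difference of the two ranks is monotone in the set, at most one everywhere, and one
  on the whole ground set. The conditions are written additively to avoid truncated
  subtraction.\<close>

locale elementary_quotient = N: loopfree_matroid N + N': loopfree_matroid N'
  for N N' :: "'n::finite matroid" +
  assumes drop_mono: "A \<subseteq> B \<Longrightarrow> rk N A + rk N' B \<le> rk N B + rk N' A"
    and rk_le_Suc: "rk N A \<le> Suc (rk N' A)"
    and rk_top: "rk N UNIV = Suc (rk N' UNIV)"
begin

lemma rk_le: "rk N' A \<le> rk N A"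
  using drop_mono[of "{}" A] by simp

text \<open>Rank increments in the quotient are bounded by those in \<open>N\<close>.\<close>

lemma flat_of_quotient:
  assumes "flat N' F"
  shows "flat N F"
  unfolding N.flat_iff
proof (intro allI impI)
  fix e assume "e \<notin> F"
  then have "rk N' F < rk N' (insert e F)" using assms by (simp add: N'.flat_iff)
  then show "rk N F < rk N (insert e F)" using drop_mono[OF subset_insertI, of F e] by simp
qed

text \<open>At \<open>F\<close> the rank difference has reached its maximum one, so a growth of the
  rank of \<open>N\<close> must come with a growth in the quotient.\<close>

lemma quotient_flat_dropped:
  assumes "flat N F" "rk N F = Suc (rk N' F)"
  shows "flat N' F"
  unfolding N'.flat_iff
proof (intro allI impI)
  fix e assume "e \<notin> F"
  then have "rk N F < rk N (insert e F)" using assms by (simp add: N.flat_iff)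
  then show "rk N' F < rk N' (insert e F)" using rk_le_Suc[of "insert e F"] assms(2) by simp
qed

text \<open>Inside \<open>G\<close> the two ranks coincide by monotonicity of their difference, so
  increments transfer from \<open>N\<close>. For an element outside \<open>G\<close>, submodularity
  compares with the increment of the flat \<open>G\<close> of \<open>N'\<close>.\<close>

lemma quotient_flat_below:
  assumes "flat N F" "flat N' G" "F \<subseteq> G" "rk N G = rk N' G"
  shows "flat N' F"
  unfolding N'.flat_iff
proof (intro allI impI)
  fix e assume e: "e \<notin> F"
  show "rk N' F < rk N' (insert e F)"
  proof (cases "e \<in> G")
    case True
    have "rk N F < rk N (insert e F)" using assms e by (simp add: N.flat_iff)
    moreover have "rk N (insert e F) + rk N' G \<le> rk N G + rk N' (insert e F)"
      using True assms(3) by (intro drop_mono) auto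
    ultimately show ?thesis using rk_le[of F] assms(4) by simp
  next
    case False
    then have "rk N' G < rk N' (insert e G)" using assms by (simp add: N'.flat_iff)
    moreover have "G \<union> insert e F = insert e G" "G \<inter> insert e F = F" using False assms(3) by auto
    ultimately show ?thesis using N'.rk_submod[of G "insert e F"] by simp
  qed
qed

lemma flat_chains_quotient:
  "C \<in> flat_chains N' \<longleftrightarrow> C \<in> flat_chains N \<and> (\<forall>F\<in>C. flat N' F)"
  using flat_of_quotient by (auto simp: flat_chains_def)

text \<open>\<open>C\<close> has as many flats as a maximal chain of \<open>N'\<close>. A larger
  rank jump would leave room for the closure of \<open>G\<close> and one more element.\<close>

lemma quotient_chain_facet:
  assumes C: "C \<in> flat_chains N'" "Suc (card C) = rk N UNIV"
    and GH: "G \<in> insert {} C" "H \<in> C" "G \<subset> H" "\<forall>F\<in>C. F \<subseteq> G \<or> H \<subseteq> F"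
  shows "rk N' H = Suc (rk N' G)"
proof (rule ccontr)
  assume n: "rk N' H \<noteq> Suc (rk N' G)"
  have fl: "flat N' G" "flat N' H" using C GH N'.flat_empty by (auto simp: flat_chains_def)
  obtain e where e: "e \<in> H" "e \<notin> G" using GH(3) by blast
  define F where "F = N'.cl (insert e G)"
  have rF: "rk N' F = Suc (rk N' G)" unfolding F_def using fl e by (intro N'.rk_cl_insert)
  have sub: "insert e G \<subseteq> F" unfolding F_def by (rule N'.subset_cl)
  have FH: "F \<subseteq> H" unfolding F_def using e GH(3) by (intro N'.cl_least[OF fl(2)]) auto
  have "F \<notin> C" using GH(4) sub e FH rF n by auto
  moreover have "insert F C \<in> flat_chains N'"
    using sub FH N'.flat_cl GH(4) by (intro N'.insert_chain[OF C(1), of G H]) (auto simp: F_def)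
  ultimately show False
    using N'.card_chain_le[of "insert F C"] C(2) rk_top by simp
qed

text \<open>This will be minus the value of the rational function at \<open>flat_vec F\<close>,
  hence real valued.\<close>

definition drop :: "'n set \<Rightarrow> real" where
  "drop F = real (rk N F) - real (rk N' F)"

lemma drop_cases: "drop F = 0 \<and> rk N F = rk N' F \<or> drop F = 1 \<and> rk N F = Suc (rk N' F)"
  using rk_le[of F] rk_le_Suc[of F] by (auto simp: drop_def)

lemma drop_le: "A \<subseteq> B \<Longrightarrow> drop A \<le> drop B"
  using drop_mono[of A B] by (simp add: drop_def)

text \<open>The left-hand side is the weight of the divisor at \<open>flat_cone C\<close>, the
  normal sum having been rewritten by \<open>sum_flats_between\<close>.\<close>

lemma drop_weight:
  assumes C: "C \<in> flat_chains N" "Suc (card C) = rk N UNIV"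
    and GH: "G \<in> insert {} C" "H \<in> C" "flat N G" "flat N H" "G \<subset> H" "rk N H = rk N G + 2"
      "\<forall>F\<in>C. F \<subseteq> G \<or> H \<subseteq> F"
  defines "S \<equiv> {F. flat N F \<and> G \<subset> F \<and> F \<subset> H}"
  shows "drop H + (real (card S) - 1) * drop G - (\<Sum>F\<in>S. drop F) =
    (if C \<in> flat_chains N' then 1 else 0)"
proof (cases "drop G = drop H")
  case True
  \<comment> \<open>Drops in the gap are squeezed between equal values, so all terms cancel.\<close>
  have "drop F = drop H" if "F \<in> S" for F
    using that drop_le[of G F] drop_le[of F H] True by (auto simp: S_def)
  then have "(\<Sum>F\<in>S. drop F) = real (card S) * drop H" by simp
  moreover have "C \<notin> flat_chains N'"
  proof
    assume "C \<in> flat_chains N'"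
    then have "rk N' H = Suc (rk N' G)" using quotient_chain_facet C(2) GH by blast
    then show False using True GH(6) by (simp add: drop_def)
  qed
  ultimately show ?thesis using True by (simp add: algebra_simps)
next
  case False
  then have dG: "drop G = 0" "rk N G = rk N' G" and dH: "drop H = 1" "rk N H = Suc (rk N' H)"
    using drop_cases[of G] drop_cases[of H] drop_le[of G H] GH(5) by auto
  define T where "T = {F \<in> S. drop F = 1}"
  have rS: "rk N F = Suc (rk N G)" if "F \<in> S" for F
  proof -
    have "flat N F" "G \<subset> F" "F \<subset> H" using that by (auto simp: S_def)
    then have "rk N G < rk N F" "rk N F < rk N H"
      using N.rk_less_flat[OF GH(3)] N.rk_less_flat[of F H] by blast+
    then show ?thesis using GH(6) by simp
  qed
  \<comment> \<open>The rank of such a flat exceeds that of \<open>G\<close> by one in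
    \<open>N\<close>, and the drop takes this back in \<open>N'\<close>.\<close>
  have rT: "rk N' F = rk N' G" if "F \<in> T" for F
    using that rS[of F] dG(2) by (auto simp: T_def drop_def)
  have "(\<Sum>F\<in>S. drop F) = (\<Sum>F\<in>S. if drop F = 1 then 1 else 0)"
    using drop_cases by (intro sum.cong) auto
  also have "\<dots> = real (card T)"
    by (simp add: T_def sum.If_cases Int_def)
  finally have eq: "drop H + (real (card S) - 1) * drop G - (\<Sum>F\<in>S. drop F) = 1 - real (card T)"
    using dG dH by simp
  have flH: "flat N' H" using quotient_flat_dropped[OF GH(4) dH(2)] .
  show ?thesis
  proof (cases "flat N' G")
    case True
    have "T = {}"
    proof (rule ccontr)
      assume "T \<noteq> {}"
      then obtain F where F: "F \<in> T" by blast
      then have "rk N' G < rk N' F" using N'.rk_less_flat[OF True] by (auto simp: T_def S_def)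
      then show False using rT[OF F] by simp
    qed
    moreover have "flat N' F" if F: "F \<in> C" for F
    proof -
      have flF: "flat N F" using C F by (auto simp: flat_chains_def)
      show ?thesis
      proof (cases "drop F = 1")
        case True
        then show ?thesis using quotient_flat_dropped flF drop_cases[of F] by auto
      next
        case False
        then have "F \<subseteq> G" using GH(7) F drop_le[of H F] dH drop_cases[of F] by auto
        then show ?thesis using quotient_flat_below[OF flF \<open>flat N' G\<close>] dG by simp
      qed
    qed
    ultimately show ?thesis using eq C flat_chains_quotient by auto
  next
    case False
    \<comment> \<open>The closure of \<open>G\<close> in \<open>N'\<close> is the only candidate for
      a member of \<open>T\<close>: by \<open>rT\<close> such a flat does not raise the rank of
      \<open>G\<close> in \<open>N'\<close>.\<close>
    define F1 where "F1 = N'.cl G"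
    have sub: "G \<subseteq> F1" unfolding F1_def by (rule N'.subset_cl)
    have flF1: "flat N' F1" unfolding F1_def by (rule N'.flat_cl)
    have r1: "rk N' F1 = rk N' G" by (simp add: F1_def)
    have neG: "F1 \<noteq> G" using flF1 False by blast
    have "rk N G < rk N F1" using N.rk_less_flat[OF GH(3)] sub neG by blast
    then have d1: "rk N F1 = Suc (rk N G)" "drop F1 = 1"
      using rk_le_Suc[of F1] r1 dG by (auto simp: drop_def)
    have "F1 \<subseteq> H" unfolding F1_def using GH(5) by (intro N'.cl_least[OF flH]) auto
    moreover have "F1 \<noteq> H" using d1 GH(6) by auto
    ultimately have "F1 \<in> T" using d1 sub neG flat_of_quotient[OF flF1] by (auto simp: T_def S_def)
    moreover have "F = F1" if F: "F \<in> T" for F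
    proof -
      have fl: "flat N F" "drop F = 1" "G \<subseteq> F" "F \<in> S" using F by (auto simp: T_def S_def)
      then have "flat N' F" using quotient_flat_dropped drop_cases[of F] by auto
      then have "F1 \<subseteq> F" unfolding F1_def using fl by (intro N'.cl_least) auto
      then show ?thesis
        using N'.flat_eq[OF flF1, of F] rT[OF F] r1 by simp
    qed
    ultimately have "T = {F1}" by blast
    moreover have "C \<notin> flat_chains N'"
      using False GH(1) N'.flat_empty by (auto simp: flat_chains_quotient)
    ultimately show ?thesis using eq by simp
  qed
qed

section \<open>The divisor of the drop function\<close>

context
  fixes \<phi> :: "real ^ 'n \<Rightarrow> real"
  assumes lin: "\<And>C. C \<in> flat_chains N \<Longrightarrow> \<exists>f. linear f \<and> (\<forall>x\<in>flat_cone C. \<phi> x = f x)"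
    and val: "\<And>F. flat N F \<Longrightarrow> F \<noteq> {} \<Longrightarrow> \<phi> (flat_vec F) = - drop F"
begin

lemma integer_affine_quotient:
  assumes "C \<in> flat_chains N"
  shows "integer_affine_on (flat_cone C) \<phi>"
proof -
  obtain f where f: "linear f" "\<forall>x\<in>flat_cone C. \<phi> x = f x" using lin[OF assms] by blast
  have "\<phi> (flat_vec F) \<in> \<int>" if "F \<in> C" for F
  proof -
    have "flat N F" "F \<noteq> {}" using assms that by (auto simp: flat_chains_def)
    then show ?thesis by (simp add: val drop_def)
  qed
  then show ?thesis using N.fan.integer_affine_on_cone[OF assms f(1)] f(2) by blast
qed

lemma divisor_weight_quotient:
  assumes C: "C \<in> flat_chains N" "Suc (card C) = rk N UNIV"
  shows "weight (divisor_complex \<phi> (matroid_variety N)) (flat_cone C) =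
    (if C \<in> flat_chains N' then 1 else 0)"
proof -
  obtain f where f: "\<And>D. D \<in> flat_chains N \<Longrightarrow> linear (f D)"
    "\<And>D x. D \<in> flat_chains N \<Longrightarrow> x \<in> flat_cone D \<Longrightarrow> \<phi> x = f D x"
    using lin by metis
  obtain G H where GH: "G \<in> insert {} C" "H \<in> C" "flat N G" "flat N H" "G \<subset> H"
    "rk N H = rk N G + 2" "\<forall>F\<in>C. F \<subseteq> G \<or> H \<subseteq> F"
    "N.fan.link C = {F. flat N F \<and> G \<subset> F \<and> F \<subset> H}"
    by (rule N.link_gap[OF C])
  let ?S = "{F. flat N F \<and> G \<subset> F \<and> F \<subset> H}"
  \<comment> \<open>For empty \<open>G\<close> both sides vanish, the vector and the drop being
    \<open>0\<close>.\<close>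
  have fG: "f C (flat_vec G) = - drop G"
  proof (cases "G = {}")
    case True
    then show ?thesis using linear_0[OF f(1)[OF C(1)]] by (simp add: drop_def)
  next
    case False
    then have "G \<in> C" using GH(1) by blast
    then show ?thesis
      using f(2)[OF C(1) N.fan.gen_in_cone[OF C(1)]] val[OF GH(3) False] by simp
  qed
  have "H \<noteq> {}" using GH(5) by blast
  then have fH: "f C (flat_vec H) = - drop H"
    using f(2)[OF C(1) N.fan.gen_in_cone[OF C(1) GH(2)]] val[OF GH(4)] by simp
  have "weight (divisor_complex \<phi> (matroid_variety N)) (flat_cone C) =
    (\<Sum>F\<in>?S. weight (matroid_variety N) (flat_cone (insert F C)) * \<phi> (flat_vec F))
    - f C (\<Sum>F\<in>?S. weight (matroid_variety N) (flat_cone (insert F C)) *\<^sub>R flat_vec F)"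
    unfolding GH(8)[symmetric]
    by (rule N.fan.divisor_weight_fan[OF N.cells_mv C integer_affine_quotient f])
      (simp_all add: matroid_variety_def N.link_sum_span[OF C])
  also have "\<dots> = (\<Sum>F\<in>?S. \<phi> (flat_vec F)) - f C (flat_vec H + (real (card ?S) - 1) *\<^sub>R flat_vec G)"
    using N.sum_flats_between[OF GH(3-6)] by (simp add: matroid_variety_def)
  also have "(\<Sum>F\<in>?S. \<phi> (flat_vec F)) = - (\<Sum>F\<in>?S. drop F)"
    unfolding sum_negf[symmetric] by (intro sum.cong val) auto
  also have "f C (flat_vec H + (real (card ?S) - 1) *\<^sub>R flat_vec G) =
      - drop H - (real (card ?S) - 1) * drop G"
    using linear_add[OF f(1)[OF C(1)]] linear_scale[OF f(1)[OF C(1)]] fG fH by simp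
  finally show ?thesis using drop_weight[OF C GH(1-7)] by simp
qed

text \<open>The divisor is computed on the fine subdivision for \<open>N\<close>. It lives on the
  skeleton of codimension one, and its weights are the indicator of the chains of \<open>N'\<close>.
  Discarding weight zero leaves exactly the fine subdivision for \<open>N'\<close>.\<close>

lemma has_divisor_quotient: "has_divisor \<phi> (matroid_variety N) (matroid_variety N')"
proof -
  let ?X = "matroid_variety N"
  let ?Y = "matroid_variety N'"
  let ?D = "divisor_complex \<phi> ?X"
  define K where "K = {C \<in> flat_chains N. card C < rk N UNIV}"
  interpret sk: unimodular_fan flat_vec "{UNIV}" K "rk N UNIV - 1"
    unfolding K_def using rk_top N'.rk_UNIV_pos by (intro N.fan.unimodular_fan_skeleton) auto
  have K'K: "C \<in> K" if "C \<in> flat_chains N'" for C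
    using that N'.card_chain_le[OF that] rk_top by (simp add: K_def flat_chains_quotient)
  have cellsD: "cells ?D = flat_cone ` K"
  proof -
    have "cells ?D = flat_cone ` flat_chains N - flat_cone ` {C \<in> flat_chains N. card C = rk N UNIV}"
      by (simp add: divisor_complex_def N.cells_mv N.fan.facets_fan[OF N.cells_mv])
    also have "\<dots> = flat_cone ` K"
    proof (intro equalityI subsetI)
      fix \<sigma> assume "\<sigma> \<in> flat_cone ` flat_chains N - flat_cone ` {C \<in> flat_chains N. card C = rk N UNIV}"
      then obtain C where "C \<in> flat_chains N" "\<sigma> = flat_cone C" "card C \<noteq> rk N UNIV" by blast
      then show "\<sigma> \<in> flat_cone ` K" using N.card_chain_le[of C] by (auto simp: K_def)
    next
      fix \<sigma> assume "\<sigma> \<in> flat_cone ` K"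
      then obtain C where C: "C \<in> flat_chains N" "\<sigma> = flat_cone C" "card C < rk N UNIV"
        by (auto simp: K_def)
      moreover have "\<sigma> \<noteq> flat_cone C'" if "C' \<in> flat_chains N" "card C' = rk N UNIV" for C'
        using C that N.fan.cone_eq_iff[of C C'] by auto
      ultimately show "\<sigma> \<in> flat_cone ` flat_chains N - flat_cone ` {C \<in> flat_chains N. card C = rk N UNIV}"
        by blast
    qed
    finally show ?thesis .
  qed
  have wD: "weight ?D (flat_cone C) = (if C \<in> flat_chains N' then 1 else 0)"
    if "C \<in> K" "card C = rk N UNIV - 1" for C
    using that divisor_weight_quotient[of C] rk_top by (simp add: K_def)
  have "tropical_complex ?D"
  proof (rule sk.tropical_fan[OF cellsD])
    fix C assume "C \<in> K" "card C = rk N UNIV - 1"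
    then show "weight ?D (flat_cone C) \<in> \<int>" by (simp add: wD)
  next
    fix C assume C: "C \<in> K" "Suc (card C) = rk N UNIV - 1"
    \<comment> \<open>Only the extensions of \<open>C\<close> to chains of \<open>N'\<close> keep a
      nonzero weight, which reduces balancing to that for \<open>N'\<close>.\<close>
    have "(\<Sum>F\<in>sk.link C. weight ?D (flat_cone (insert F C)) *\<^sub>R flat_vec F) =
      (\<Sum>F\<in>sk.link C. (if insert F C \<in> flat_chains N' then 1 else 0) *\<^sub>R flat_vec F)"
    proof (intro sum.cong refl)
      fix F assume "F \<in> sk.link C"
      then have "F \<notin> C" "insert F C \<in> K" by (simp_all add: sk.link_def)
      moreover from \<open>F \<notin> C\<close> have "card (insert F C) = rk N UNIV - 1" using C(2) by simp
      ultimately show "weight ?D (flat_cone (insert F C)) *\<^sub>R flat_vec F =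
          (if insert F C \<in> flat_chains N' then 1 else 0) *\<^sub>R flat_vec F"
        by (simp only: wD)
    qed
    also have "\<dots> = (\<Sum>F\<in>N'.fan.link C. flat_vec F)"
      using K'K by (intro sum.mono_neutral_cong_right) (auto simp: sk.link_def N'.fan.link_def)
    also have "\<dots> \<in> span (flat_vec ` C)"
    proof (cases "C \<in> flat_chains N'")
      case True
      then show ?thesis using C rk_top by (intro N'.link_sum_span) auto
    next
      case False
      \<comment> \<open>Chains of \<open>N'\<close> are closed under passing to smaller chains
        containing \<open>UNIV\<close>, so \<open>C\<close> has no extension among them.\<close>
      then have "N'.fan.link C = {}"
        using C(1) N'.fan.down_closed[of "insert _ C" C] sk.lineality_subset[OF C(1)]
        by (auto simp: N'.fan.link_def)
      then show ?thesis by (simp add: span_zero)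
    qed
    finally show "(\<Sum>F\<in>sk.link C. weight ?D (flat_cone (insert F C)) *\<^sub>R flat_vec F)
      \<in> span (flat_vec ` C)" .
  qed
  moreover have "refines ?Y (nonzero_part ?D)"
  proof (rule refines_same_cells[OF N'.pure_mv])
    have fac: "facets ?D = flat_cone ` {C \<in> K. card C = rk N UNIV - 1}"
      by (rule sk.facets_fan[OF cellsD])
    show "cells (nonzero_part ?D) = cells ?Y"
      unfolding N'.cells_mv
    proof (intro equalityI subsetI)
      fix \<tau> assume "\<tau> \<in> cells (nonzero_part ?D)"
      then obtain C D where C: "C \<in> K" "\<tau> = flat_cone C"
        and D: "D \<in> K" "card D = rk N UNIV - 1" "weight ?D (flat_cone D) \<noteq> 0" "flat_cone C \<subseteq> flat_cone D"
        by (auto simp: nonzero_part_def cellsD fac)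
      then have "D \<in> flat_chains N'" "C \<subseteq> D" using wD[of D] sk.cone_subset_iff by (auto split: if_splits)
      then have "C \<in> flat_chains N'"
        using C N'.fan.down_closed sk.lineality_subset by blast
      then show "\<tau> \<in> flat_cone ` flat_chains N'" using C by blast
    next
      fix \<tau> assume "\<tau> \<in> flat_cone ` flat_chains N'"
      then obtain C where C: "C \<in> flat_chains N'" "\<tau> = flat_cone C" by blast
      obtain D where D: "D \<in> flat_chains N'" "C \<subseteq> D" "card D = rk N' UNIV"
        using N'.chain_pure[OF C(1)] by blast
      then have "flat_cone D \<in> facets ?D" "weight ?D (flat_cone D) \<noteq> 0" "\<tau> \<subseteq> flat_cone D"
        using K'K[OF D(1)] wD[of D] rk_top N'.fan.cone_mono[OF D(1,2)] C(2) by (auto simp: fac)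
      then show "\<tau> \<in> cells (nonzero_part ?D)"
        using K'K[OF C(1)] C(2) by (auto simp: nonzero_part_def cellsD)
    qed
    fix \<sigma> assume "\<sigma> \<in> facets ?Y"
    then obtain C where "C \<in> flat_chains N'" "card C = rk N' UNIV" "\<sigma> = flat_cone C"
      by (auto simp: N'.fan.facets_fan[OF N'.cells_mv])
    then show "weight (nonzero_part ?D) \<sigma> = weight ?Y \<sigma>"
      using K'K[of C] wD[of C] rk_top by (simp add: matroid_variety_def)
  qed
  ultimately have "cycle_eq ?Y ?D"
    unfolding cycle_eq_def using N'.tropical_mv N'.refines_mv by blast
  then show ?thesis
    unfolding has_divisor_def
    using N.cycle_eq_mv integer_affine_quotient by (intro exI[of _ ?X]) (auto simp: N.cells_mv)
qed

end

end

section \<open>Products of matroid varieties\<close>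

lemma weight_matroid_variety [simp]: "weight (matroid_variety N) \<sigma> = 1"
  by (simp add: matroid_variety_def)

text \<open>Threshold sets of the pulled back vector are the preimages of threshold sets; only the
  empty preimages have to be discarded.\<close>

lemma sublevels_comp:
  fixes z :: "real ^ 'k::finite" and h :: "'n::finite \<Rightarrow> 'k"
  shows "sublevels (\<chi> a. z $ h a) = vimage h ` sublevels z - {{}}"
proof (intro equalityI subsetI)
  fix G assume G: "G \<in> sublevels (\<chi> a. z $ h a)"
  then have ne: "G \<noteq> {}" by (simp add: sublevels_def)
  \<comment> \<open>With \<open>t\<close> the largest value on \<open>G\<close>, the set
    \<open>F\<close> below is the threshold set of \<open>z\<close> that pulls back to
    \<open>G\<close>.\<close>
  define t where "t = Max ((\<lambda>a. z $ h a) ` G)"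
  have t: "z $ h a \<le> t" if "a \<in> G" for a using that by (simp add: t_def)
  have "t \<in> (\<lambda>a. z $ h a) ` G" unfolding t_def using ne by (intro Max_in) auto
  then obtain b where b: "b \<in> G" "t = z $ h b" by auto
  define F where "F = {i. z $ i \<le> t}"
  have "h -` F = G"
  proof (intro equalityI subsetI)
    fix a assume a: "a \<in> h -` F"
    show "a \<in> G"
    proof (rule ccontr)
      assume "a \<notin> G"
      then have "z $ h b < z $ h a" using G b(1) by (simp add: sublevels_def)
      then show False using a b(2) by (simp add: F_def)
    qed
  next
    fix a assume "a \<in> G"
    then show "a \<in> h -` F" using t by (simp add: F_def)
  qed
  moreover have "F \<in> sublevels z"
  proof -
    have "h b \<in> F" by (simp add: F_def b(2))
    then show ?thesis by (auto simp: sublevels_def F_def)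
  qed
  ultimately show "G \<in> vimage h ` sublevels z - {{}}" using ne by blast
next
  fix G assume "G \<in> vimage h ` sublevels z - {{}}"
  then show "G \<in> sublevels (\<chi> a. z $ h a)" by (auto simp: sublevels_def)
qed

lemma sum_Plus_vimage: "S = (Inl -` S) <+> (Inr -` S)"
proof (rule set_eqI)
  fix x show "x \<in> S \<longleftrightarrow> x \<in> (Inl -` S) <+> (Inr -` S)" by (cases x) auto
qed

lemma mem_Plus_iff [simp]: "Inl a \<in> A <+> B \<longleftrightarrow> a \<in> A" "Inr b \<in> A <+> B \<longleftrightarrow> b \<in> B"
  by auto

lemma vimage_Plus [simp]: "Inl -` (A <+> B) = A" "Inr -` (A <+> B) = B"
  by auto

lemma vimage_insert_sum [simp]:
  "Inl -` insert (Inl a) S = insert a (Inl -` S)" "Inr -` insert (Inl a) S = Inr -` S"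
  "Inl -` insert (Inr b) S = Inl -` S" "Inr -` insert (Inr b) S = insert b (Inr -` S)"
  by auto

lemma join_vec_nth [simp]: "join_vec x y $ Inl a = x $ a" "join_vec x y $ Inr b = y $ b"
  by (simp_all add: join_vec_def)

lemma vec_sum_eqI:
  fixes x y :: "real ^ ('m::finite + 'n::finite)"
  assumes "\<And>a. x $ Inl a = y $ Inl a" "\<And>b. x $ Inr b = y $ Inr b"
  shows "x = y"
  unfolding vec_eq_iff
proof
  fix i show "x $ i = y $ i" using assms by (cases i) auto
qed

lemma join_vec_proj: "join_vec (left_vec z) (right_vec z) = z"
  by (rule vec_sum_eqI) (simp_all add: left_vec_def right_vec_def)

lemma join_vec_eq_iff: "join_vec x y = join_vec x' y' \<longleftrightarrow> x = x' \<and> y = y'"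
  by (metis join_vec_nth vec_eq_iff)

lemma lattice_join_vec: "lattice_vec x \<Longrightarrow> lattice_vec y \<Longrightarrow> lattice_vec (join_vec x y)"
  unfolding lattice_vec_def
proof
  fix i assume "\<forall>i. x $ i \<in> \<int>" "\<forall>i. y $ i \<in> \<int>"
  then show "join_vec x y $ i \<in> \<int>" by (cases i) auto
qed

lemma inner_join_vec: "join_vec a b \<bullet> join_vec x y = a \<bullet> x + b \<bullet> y"
  by (simp add: inner_vec_def sum.Plus flip: UNIV_Plus_UNIV)

lemma linear_join_vec: "linear (\<lambda>x. join_vec x 0)" "linear (join_vec 0)"
  by (auto simp: linear_iff intro!: vec_sum_eqI)

lemma flat_vec_Plus: "flat_vec (A <+> B) = join_vec (flat_vec A) (flat_vec B)"
  by (rule vec_sum_eqI) auto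

text \<open>A product of two fans is generated by the disjoint union of the generators, so a sum
  type indexes them. Both copies of \<open>UNIV\<close> are lineality directions.\<close>

definition pair_gen :: "'m::finite set + 'n::finite set \<Rightarrow> real ^ ('m + 'n)" where
  "pair_gen = case_sum (\<lambda>F. join_vec (flat_vec F) 0) (\<lambda>F. join_vec 0 (flat_vec F))"

lemma pair_gen_simps [simp]:
  "pair_gen (Inl F) = join_vec (flat_vec F) 0" "pair_gen (Inr G) = join_vec 0 (flat_vec G)"
  by (simp_all add: pair_gen_def)

abbreviation pair_cone :: "('m::finite set + 'n::finite set) set \<Rightarrow> (real ^ ('m + 'n)) set" where
  "pair_cone \<equiv> gcone pair_gen {Inl UNIV, Inr UNIV}"

lemma sum_pair_gen:
  "(\<Sum>i\<in>C <+> D. c i *\<^sub>R pair_gen i) =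
    join_vec (\<Sum>F\<in>C. c (Inl F) *\<^sub>R flat_vec F) (\<Sum>F\<in>D. c (Inr F) *\<^sub>R flat_vec F)"
  by (rule vec_sum_eqI) (simp_all add: sum.Plus)

lemma pair_cone_Plus:
  "pair_cone (C <+> D) = {join_vec x y |x y. x \<in> flat_cone C \<and> y \<in> flat_cone D}"
proof (intro equalityI subsetI)
  fix z assume "z \<in> pair_cone (C <+> D)"
  then obtain c where c: "z = (\<Sum>i\<in>C <+> D. c i *\<^sub>R pair_gen i)"
    "\<forall>i\<in>C <+> D - {Inl UNIV, Inr UNIV}. 0 \<le> c i"
    unfolding gcone_def by auto
  have "(\<Sum>F\<in>C. c (Inl F) *\<^sub>R flat_vec F) \<in> flat_cone C"
    "(\<Sum>F\<in>D. c (Inr F) *\<^sub>R flat_vec F) \<in> flat_cone D"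
    using c(2) by (auto intro!: gconeI)
  then show "z \<in> {join_vec x y |x y. x \<in> flat_cone C \<and> y \<in> flat_cone D}"
    unfolding c(1) sum_pair_gen by blast
next
  fix z assume "z \<in> {join_vec x y |x y. x \<in> flat_cone C \<and> y \<in> flat_cone D}"
  then obtain c d where c: "\<forall>F\<in>C - {UNIV}. 0 \<le> c F" and d: "\<forall>F\<in>D - {UNIV}. 0 \<le> d F"
    and z: "z = join_vec (\<Sum>F\<in>C. c F *\<^sub>R flat_vec F) (\<Sum>F\<in>D. d F *\<^sub>R flat_vec F)"
    unfolding gcone_def by blast
  have "z = (\<Sum>i\<in>C <+> D. case_sum c d i *\<^sub>R pair_gen i)"
    by (simp add: z sum_pair_gen)
  also have "\<dots> \<in> pair_cone (C <+> D)"
    using c d by (intro gconeI) auto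
  finally show "z \<in> pair_cone (C <+> D)" .
qed

lemma flat_chains_nonempty:
  "\<forall>A\<in>X. \<forall>B\<in>X. A \<subseteq> B \<or> B \<subseteq> A \<Longrightarrow> UNIV \<in> X \<Longrightarrow> \<forall>F\<in>X. flat N F \<Longrightarrow> X - {{}} \<in> flat_chains N"
  by (auto simp: flat_chains_def chain_subset_def)

section \<open>The product fan\<close>

locale matroid_pair = M: loopfree_matroid M + N: loopfree_matroid N
  for M :: "'m::finite matroid" and N :: "'n::finite matroid"
begin

definition pair_chains :: "('m set + 'n set) set set" where
  "pair_chains = {C <+> D |C D. C \<in> flat_chains M \<and> D \<in> flat_chains N}"

lemma pair_chains_iff: "I \<in> pair_chains \<longleftrightarrow> Inl -` I \<in> flat_chains M \<and> Inr -` I \<in> flat_chains N"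
  unfolding pair_chains_def using sum_Plus_vimage[of I] by auto

lemma pair_chainsE:
  assumes "I \<in> pair_chains"
  obtains C D where "I = C <+> D" "C \<in> flat_chains M" "D \<in> flat_chains N"
  using assms by (auto simp: pair_chains_def)

sublocale pair: unimodular_fan pair_gen "{Inl UNIV, Inr UNIV}" pair_chains
  "rk M UNIV + rk N UNIV"
proof unfold_locales
  fix I J :: "('m set + 'n set) set" and i :: "'m set + 'n set"
  show "finite pair_chains" "finite I" by simp_all
  assume "I \<in> pair_chains"
  then obtain C D where I: "I = C <+> D" "C \<in> flat_chains M" "D \<in> flat_chains N"
    by (rule pair_chainsE)
  show L: "{Inl UNIV, Inr UNIV} \<subseteq> I" using I by (auto simp: flat_chains_def)
  show "J \<in> pair_chains" if J: "{Inl UNIV, Inr UNIV} \<subseteq> J" "J \<subseteq> I"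
  proof -
    have "Inl -` J \<subseteq> C" "Inr -` J \<subseteq> D" using J(2) I(1) by auto
    moreover have "{UNIV} \<subseteq> Inl -` J" "{UNIV} \<subseteq> Inr -` J" using J(1) by auto
    ultimately show ?thesis
      using M.fan.down_closed[OF I(2)] N.fan.down_closed[OF I(3)] by (simp add: pair_chains_iff)
  qed
  show "lattice_vec (pair_gen i)"
    by (cases i) (auto intro: lattice_join_vec lattice_flat_vec)
  \<comment> \<open>A dual vector of one factor is extended by zero.\<close>
  show "\<exists>d. lattice_vec d \<and> (\<forall>j\<in>I. d \<bullet> pair_gen j = (if j = i then 1 else 0))" if i: "i \<in> I"
  proof (cases i)
    case (Inl F)
    then obtain d where "lattice_vec d" "\<forall>G\<in>C. d \<bullet> flat_vec G = (if G = F then 1 else 0)"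
      using M.fan.dual_exists[OF I(2), of F] i I(1) by auto
    then have "join_vec d 0 \<bullet> pair_gen j = (if j = i then 1 else 0)" if "j \<in> I" for j
      using that Inl I(1) by (cases j) (simp_all add: inner_join_vec)
    then show ?thesis
      using \<open>lattice_vec d\<close> lattice_join_vec[of d 0] by (intro exI[of _ "join_vec d 0"]) simp
  next
    case (Inr F)
    then obtain d where "lattice_vec d" "\<forall>G\<in>D. d \<bullet> flat_vec G = (if G = F then 1 else 0)"
      using N.fan.dual_exists[OF I(3), of F] i I(1) by auto
    then have "join_vec 0 d \<bullet> pair_gen j = (if j = i then 1 else 0)" if "j \<in> I" for j
      using that Inr I(1) by (cases j) (simp_all add: inner_join_vec)
    then show ?thesis
      using \<open>lattice_vec d\<close> lattice_join_vec[of 0 d] by (intro exI[of _ "join_vec 0 d"]) simp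
  qed
  show "pair_cone I \<inter> pair_cone J \<subseteq> pair_cone (I \<inter> J)" if chJ: "J \<in> pair_chains"
  proof -
    obtain C' D' where J: "J = C' <+> D'" "C' \<in> flat_chains M" "D' \<in> flat_chains N"
      using chJ by (rule pair_chainsE)
    have IJ: "I \<inter> J = (C \<inter> C') <+> (D \<inter> D')" using I J by auto
    show ?thesis
      unfolding IJ unfolding I(1) J(1) pair_cone_Plus
      using M.fan.gcone_inter[OF I(2) J(2)] N.fan.gcone_inter[OF I(3) J(3)]
      by (auto simp: join_vec_eq_iff)
  qed
  show "\<exists>J\<in>pair_chains. I \<subseteq> J \<and> card J = rk M UNIV + rk N UNIV"
  proof -
    obtain C' D' where "C' \<in> flat_chains M" "C \<subseteq> C'" "card C' = rk M UNIV"
      "D' \<in> flat_chains N" "D \<subseteq> D'" "card D' = rk N UNIV"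
      using M.chain_pure[OF I(2)] N.chain_pure[OF I(3)] by blast
    then show ?thesis
      using I(1) by (intro bexI[of _ "C' <+> D'"]) (auto simp: card_Plus pair_chains_iff)
  qed
  show "card I \<le> rk M UNIV + rk N UNIV"
    using M.card_chain_le[OF I(2)] N.card_chain_le[OF I(3)] by (simp add: I(1) card_Plus)
qed

abbreviation product :: "('m + 'n) weighted_complex" where
  "product \<equiv> product_complex (matroid_variety M) (matroid_variety N)"

lemma cells_product: "cells product = pair_cone ` pair_chains"
proof -
  have "cells product = (\<lambda>(C, D). {join_vec x y |x y. x \<in> flat_cone C \<and> y \<in> flat_cone D}) `
      (flat_chains M \<times> flat_chains N)"
    by (auto simp: product_complex_def M.cells_mv N.cells_mv image_iff Bex_def)
  also have "\<dots> = pair_cone ` pair_chains"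
    by (auto simp: pair_chains_def pair_cone_Plus[symmetric] image_iff Bex_def)
  finally show ?thesis .
qed

lemma weight_product [simp]: "weight product \<sigma> = 1"
  by (simp add: product_complex_def)

lemma join_span:
  assumes "x \<in> span (flat_vec ` C)" "y \<in> span (flat_vec ` D)"
  shows "join_vec x y \<in> span (pair_gen ` (C <+> D))"
proof -
  have "join_vec x 0 \<in> span ((\<lambda>x. join_vec x 0) ` flat_vec ` C)"
    using assms(1) linear_span_image[OF linear_join_vec(1)] by blast
  then have "join_vec x 0 \<in> span (pair_gen ` (C <+> D))"
    by (rule subsetD[OF span_mono, rotated]) (force simp: image_iff)
  moreover have "join_vec 0 y \<in> span (join_vec 0 ` flat_vec ` D)"
    using assms(2) linear_span_image[OF linear_join_vec(2)] by blast
  then have "join_vec 0 y \<in> span (pair_gen ` (C <+> D))"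
    by (rule subsetD[OF span_mono, rotated]) (force simp: image_iff)
  moreover have "join_vec x y = join_vec x 0 + join_vec 0 y" by (rule vec_sum_eqI) auto
  ultimately show ?thesis by (simp add: span_add)
qed

text \<open>In codimension one, exactly one factor has a chain of full length, and its link is
  empty. The other factor is itself in codimension one, where its own balancing applies.\<close>

lemma tropical_product: "tropical_complex product"
proof (rule pair.tropical_fan[OF cells_product])
  fix I assume I: "I \<in> pair_chains" "Suc (card I) = rk M UNIV + rk N UNIV"
  from I(1) obtain C D where CD: "I = C <+> D" "C \<in> flat_chains M" "D \<in> flat_chains N"
    by (rule pair_chainsE)
  have link: "pair.link I = M.fan.link C <+> N.fan.link D"
  proof (rule set_eqI)
    fix i show "i \<in> pair.link I \<longleftrightarrow> i \<in> M.fan.link C <+> N.fan.link D"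
      using CD by (cases i) (auto simp: pair.link_def M.fan.link_def N.fan.link_def pair_chains_iff)
  qed
  have cards: "card C \<le> rk M UNIV" "card D \<le> rk N UNIV"
    using M.card_chain_le[OF CD(2)] N.card_chain_le[OF CD(3)] by auto
  have sum: "Suc (card C + card D) = rk M UNIV + rk N UNIV" using I(2) CD(1) by (simp add: card_Plus)
  have "(\<Sum>F\<in>M.fan.link C. flat_vec F) \<in> span (flat_vec ` C)"
  proof (cases "card C = rk M UNIV")
    case True
    have "M.fan.link C = {}"
    proof (rule ccontr)
      assume "M.fan.link C \<noteq> {}"
      then obtain F where "F \<notin> C" "insert F C \<in> flat_chains M" by (auto simp: M.fan.link_def)
      then show False using M.card_chain_le[of "insert F C"] True by simp
    qed
    then show ?thesis by (simp add: span_zero)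
  qed (use sum cards in \<open>intro M.link_sum_span CD; simp\<close>)
  moreover have "(\<Sum>F\<in>N.fan.link D. flat_vec F) \<in> span (flat_vec ` D)"
  proof (cases "card D = rk N UNIV")
    case True
    have "N.fan.link D = {}"
    proof (rule ccontr)
      assume "N.fan.link D \<noteq> {}"
      then obtain F where "F \<notin> D" "insert F D \<in> flat_chains N" by (auto simp: N.fan.link_def)
      then show False using N.card_chain_le[of "insert F D"] True by simp
    qed
    then show ?thesis by (simp add: span_zero)
  qed (use sum cards in \<open>intro N.link_sum_span CD; simp\<close>)
  ultimately have "join_vec (\<Sum>F\<in>M.fan.link C. flat_vec F) (\<Sum>F\<in>N.fan.link D. flat_vec F)
      \<in> span (pair_gen ` I)"
    unfolding CD(1) by (rule join_span)
  then show "(\<Sum>i\<in>pair.link I. weight product (pair_cone (insert i I)) *\<^sub>R pair_gen i) \<in> span (pair_gen ` I)"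
    using sum_pair_gen[of "\<lambda>_. 1" "M.fan.link C" "N.fan.link D"] by (simp add: link)
qed simp

section \<open>The direct sum as a refinement of the product\<close>

lemma rk_direct_sum [simp]: "rk (direct_sum M N) S = rk M (Inl -` S) + rk N (Inr -` S)"
  by (simp add: direct_sum_def)

lemma ground_direct_sum [simp]: "ground (direct_sum M N) = UNIV"
  by (simp add: direct_sum_def M.ground N.ground)

sublocale sum: loopfree_matroid "direct_sum M N"
proof
  show "is_matroid (direct_sum M N)"
    unfolding is_matroid_def
  proof (intro conjI allI impI)
    fix A :: "('m + 'n) set"
    show "rk (direct_sum M N) A \<le> card A"
    proof -
      have "rk M (Inl -` A) \<le> card (Inl -` A)" "rk N (Inr -` A) \<le> card (Inr -` A)"
        using M.matroid N.matroid by (simp_all add: is_matroid_def M.ground N.ground)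
      moreover have "card A = card (Inl -` A) + card (Inr -` A)"
        by (subst sum_Plus_vimage[of A]) (simp add: card_Plus)
      ultimately show ?thesis by simp
    qed
  next
    fix A B :: "('m + 'n) set"
    assume "A \<subseteq> B \<and> B \<subseteq> ground (direct_sum M N)"
    then show "rk (direct_sum M N) A \<le> rk (direct_sum M N) B"
      by (auto intro!: add_mono M.rk_mono N.rk_mono)
  next
    fix A B :: "('m + 'n) set"
    show "rk (direct_sum M N) (A \<union> B) + rk (direct_sum M N) (A \<inter> B)
        \<le> rk (direct_sum M N) A + rk (direct_sum M N) B"
      using M.rk_submod[of "Inl -` A" "Inl -` B"] N.rk_submod[of "Inr -` A" "Inr -` B"] by simp
  qed simp
  show "loopfree (direct_sum M N)"
    unfolding loopfree_def
  proof
    fix e show "rk (direct_sum M N) {e} = 1"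
      by (cases e) (simp_all add: M.rk_singleton N.rk_singleton)
  qed
qed simp

lemma flat_direct_sum: "flat (direct_sum M N) F \<longleftrightarrow> flat M (Inl -` F) \<and> flat N (Inr -` F)"
  unfolding sum.flat_iff M.flat_iff N.flat_iff by (simp add: split_sum_all)

lemma flat_chains_proj:
  assumes "C \<in> flat_chains (direct_sum M N)"
  shows "vimage Inl ` C - {{}} \<in> flat_chains M" "vimage Inr ` C - {{}} \<in> flat_chains N"
proof -
  have ch: "A \<subseteq> B \<or> B \<subseteq> A" if "A \<in> C" "B \<in> C" for A B
    using assms that by (simp add: flat_chains_def chain_subset_def)
  have "\<forall>A\<in>vimage Inl ` C. \<forall>B\<in>vimage Inl ` C. A \<subseteq> B \<or> B \<subseteq> A"
    "\<forall>A\<in>vimage Inr ` C. \<forall>B\<in>vimage Inr ` C. A \<subseteq> B \<or> B \<subseteq> A"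
    using ch by (simp_all, (meson vimage_mono)+)
  moreover have "UNIV \<in> vimage Inl ` C" "UNIV \<in> vimage Inr ` C"
    using assms by (auto simp: flat_chains_def intro!: image_eqI[of _ _ UNIV])
  moreover have "\<forall>F\<in>vimage Inl ` C. flat M F" "\<forall>F\<in>vimage Inr ` C. flat N F"
    using assms by (auto simp: flat_chains_def flat_direct_sum)
  ultimately show "vimage Inl ` C - {{}} \<in> flat_chains M" "vimage Inr ` C - {{}} \<in> flat_chains N"
    by (simp_all add: flat_chains_nonempty)
qed

text \<open>Sublevel sets of the two projections of a point are traces of its own sublevel sets, so
  they belong to the projected chains.\<close>

lemma flat_cone_direct_sum:
  assumes C: "C \<in> flat_chains (direct_sum M N)"
  shows "flat_cone C \<subseteq> pair_cone ((vimage Inl ` C - {{}}) <+> (vimage Inr ` C - {{}}))"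
proof
  fix z assume "z \<in> flat_cone C"
  then have sub: "sublevels z \<subseteq> C"
    using C by (intro sublevels_flat_cone) (auto simp: flat_chains_def)
  have "left_vec z \<in> flat_cone (vimage Inl ` C - {{}})"
  proof (rule flat_coneI)
    show "sublevels (left_vec z) \<subseteq> vimage Inl ` C - {{}}"
      unfolding left_vec_def sublevels_comp using sub by blast
    show "UNIV \<in> vimage Inl ` C - {{}}"
      using flat_chains_proj(1)[OF C] by (simp add: flat_chains_def)
  qed
  moreover have "right_vec z \<in> flat_cone (vimage Inr ` C - {{}})"
  proof (rule flat_coneI)
    show "sublevels (right_vec z) \<subseteq> vimage Inr ` C - {{}}"
      unfolding right_vec_def sublevels_comp using sub by blast
    show "UNIV \<in> vimage Inr ` C - {{}}"
      using flat_chains_proj(2)[OF C] by (simp add: flat_chains_def)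
  qed
  ultimately show "z \<in> pair_cone ((vimage Inl ` C - {{}}) <+> (vimage Inr ` C - {{}}))"
    unfolding pair_cone_Plus using join_vec_proj[of z] by (intro CollectI exI[of _ "left_vec z"] exI[of _ "right_vec z"]) simp
qed

text \<open>The traces of a sublevel set of the joined vector are sublevel sets of the factors or
  empty, hence flats. Each point of a product cell thus lies in a cone of the fine
  subdivision.\<close>

lemma flat_chains_sublevels:
  assumes "C \<in> flat_chains M" "D \<in> flat_chains N" "x \<in> flat_cone C" "y \<in> flat_cone D"
  shows "sublevels (join_vec x y) \<in> flat_chains (direct_sum M N)"
proof -
  let ?z = "join_vec x y"
  have x: "x = (\<chi> a. ?z $ Inl a)" and y: "y = (\<chi> b. ?z $ Inr b)" by (simp_all add: vec_eq_iff)
  have "vimage Inl ` sublevels ?z - {{}} \<subseteq> C" "vimage Inr ` sublevels ?z - {{}} \<subseteq> D"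
    unfolding sublevels_comp[symmetric] x[symmetric] y[symmetric]
    using assms by (auto simp: flat_chains_def dest!: sublevels_flat_cone)
  then have "flat (direct_sum M N) F" if "F \<in> sublevels ?z" for F
    unfolding flat_direct_sum
    using that assms(1,2) M.flat_empty N.flat_empty by (auto simp: flat_chains_def image_subset_iff)
  then show ?thesis
    by (simp add: flat_chains_def chain_sublevels UNIV_sublevels empty_sublevels)
qed

lemma Union_cells_product: "\<Union> (cells (matroid_variety (direct_sum M N))) = \<Union> (cells product)"
proof (intro equalityI subsetI)
  fix z assume "z \<in> \<Union> (cells (matroid_variety (direct_sum M N)))"
  then obtain C where C: "C \<in> flat_chains (direct_sum M N)" "z \<in> flat_cone C"
    by (auto simp: sum.cells_mv)
  then have "(vimage Inl ` C - {{}}) <+> (vimage Inr ` C - {{}}) \<in> pair_chains"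
    using flat_chains_proj by (simp add: pair_chains_iff)
  then show "z \<in> \<Union> (cells product)"
    using flat_cone_direct_sum[OF C(1)] C(2) by (auto simp: cells_product)
next
  fix z assume "z \<in> \<Union> (cells product)"
  then obtain C D x y where "C \<in> flat_chains M" "D \<in> flat_chains N" "z = join_vec x y"
    "x \<in> flat_cone C" "y \<in> flat_cone D"
    by (auto simp: cells_product pair_chains_def pair_cone_Plus)
  then have "sublevels z \<in> flat_chains (direct_sum M N)" using flat_chains_sublevels by blast
  moreover have "z \<in> flat_cone (sublevels z)" by (intro flat_coneI UNIV_sublevels) simp
  ultimately show "z \<in> \<Union> (cells (matroid_variety (direct_sum M N)))"
    by (auto simp: sum.cells_mv)
qed

lemma cells_nonzero_part_product: "cells (nonzero_part product) = cells product"
  by (rule pair.cells_nonzero_part[OF cells_product]) simp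

text \<open>The fine subdivision of the direct sum is itself the common refinement; all weights are
  \<open>1\<close>.\<close>

lemma cycle_eq_product: "cycle_eq (matroid_variety (direct_sum M N)) product"
proof -
  have "refines (matroid_variety (direct_sum M N)) (nonzero_part product)"
    unfolding refines_def cells_nonzero_part_product
  proof (intro conjI ballI impI)
    show "pure_weighted_complex (matroid_variety (direct_sum M N))" by (rule sum.pure_mv)
    show "pure_weighted_complex (nonzero_part product)"
      using cells_nonzero_part_product cells_product by (intro pair.pure_fan) simp_all
    show "\<Union> (cells (matroid_variety (direct_sum M N))) = \<Union> (cells product)"
      by (rule Union_cells_product)
  next
    fix \<rho> assume "\<rho> \<in> cells (matroid_variety (direct_sum M N))"
    then obtain C where C: "C \<in> flat_chains (direct_sum M N)" "\<rho> = flat_cone C"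
      by (auto simp: sum.cells_mv)
    then have "(vimage Inl ` C - {{}}) <+> (vimage Inr ` C - {{}}) \<in> pair_chains"
      using flat_chains_proj by (simp add: pair_chains_iff)
    then show "\<exists>\<sigma>\<in>cells product. \<rho> \<subseteq> \<sigma>"
      using flat_cone_direct_sum[OF C(1)] C(2) unfolding cells_product by blast
  qed simp
  then show ?thesis
    unfolding cycle_eq_def using sum.tropical_mv tropical_product sum.refines_mv by blast
qed

end

section \<open>The intermediate matroids\<close>

text \<open>The intermediate matroids, transported to the ground set \<open>E <+> E\<close>.\<close>

definition diagonal_step :: "'n::finite matroid \<Rightarrow> nat \<Rightarrow> ('n + 'n) matroid" where
  "diagonal_step M i = \<lparr>ground = UNIV,
     rk = (\<lambda>S. min (rk M (Inl -` S \<union> Inr -` S) + i) (rk M (Inl -` S) + rk M (Inr -` S)))\<rparr>"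

lemma gcone_image:
  assumes "linear h" "inj_on p I" "\<And>i. i \<in> I \<Longrightarrow> h (g i) = g' (p i)" "\<And>i. i \<in> I \<Longrightarrow> p i \<in> L' \<longleftrightarrow> i \<in> L"
  shows "h ` gcone g L I = gcone g' L' (p ` I)"
proof (intro equalityI subsetI)
  fix y assume "y \<in> h ` gcone g L I"
  then obtain c where c: "y = h (\<Sum>i\<in>I. c i *\<^sub>R g i)" "\<forall>i\<in>I - L. 0 \<le> c i"
    unfolding gcone_def by auto
  have "y = (\<Sum>i\<in>I. c (inv_into I p (p i)) *\<^sub>R g' (p i))"
    unfolding c(1) linear_sum[OF assms(1)] using assms(2,3)
    by (intro sum.cong) (auto simp: linear_scale[OF assms(1)])
  also have "\<dots> = (\<Sum>j\<in>p ` I. c (inv_into I p j) *\<^sub>R g' j)"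
    by (simp add: sum.reindex[OF assms(2)])
  also have "\<dots> \<in> gcone g' L' (p ` I)"
    using c(2) assms(2,4) by (intro gconeI) auto
  finally show "y \<in> gcone g' L' (p ` I)" .
next
  fix y assume "y \<in> gcone g' L' (p ` I)"
  then obtain c where c: "y = (\<Sum>j\<in>p ` I. c j *\<^sub>R g' j)" "\<forall>j\<in>p ` I - L'. 0 \<le> c j"
    unfolding gcone_def by auto
  have "y = h (\<Sum>i\<in>I. c (p i) *\<^sub>R g i)"
    unfolding c(1) linear_sum[OF assms(1)] sum.reindex[OF assms(2)] o_def using assms(3)
    by (intro sum.cong) (auto simp: linear_scale[OF assms(1)])
  moreover have "(\<Sum>i\<in>I. c (p i) *\<^sub>R g i) \<in> gcone g L I"
    using c(2) assms(4) by (intro gconeI) auto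
  ultimately show "y \<in> h ` gcone g L I" by blast
qed

text \<open>Here \<open>f\<close> and \<open>g\<close> stand for the ranks in the direct sum and in
  the diagonal matroid at the union, the intersection and the two sets. If the minima on the right
  are of different kinds, submodularity of \<open>g\<close> is combined with the growth of
  \<open>f - g\<close> above the intersection.\<close>

lemma min_submodular:
  fixes fU fI fA fB gU gI gA gB i :: nat
  assumes "fI + gA \<le> fA + gI" "fI + gB \<le> fB + gI" "fU + fI \<le> fA + fB" "gU + gI \<le> gA + gB"
  shows "min (gU + i) fU + min (gI + i) fI \<le> min (gA + i) fA + min (gB + i) fB"
  using assms by linarith

context loopfree_matroid
begin

lemma ground_intermediate:
  assumes "i \<le> r UNIV"
  shows "ground (intermediate_matroid N i) = Inl ` UNIV"
proof -
  have "{1..r UNIV} - {1..i} - {i + 1..r UNIV} = {}" by auto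
  then show ?thesis
    by (auto simp: intermediate_matroid_def contraction_def deletion_def linking_matroid_def ground)
qed

text \<open>The contracted set consists of the last \<open>r UNIV - i\<close> elements and is
  independent in the linking matroid. Subtracting its rank from both terms of the minimum gives the
  formula.\<close>

lemma rk_intermediate:
  assumes "i \<le> r UNIV"
  shows "rk (intermediate_matroid N i) (Inl ` (A <+> B)) = min (r (A \<union> B) + i) (r A + r B)"
proof -
  have "Inl -` (Inl ` (A <+> B) \<union> Inr ` {i + 1..r UNIV}) = A <+> B"
    "Inr -` (Inl ` (A <+> B) \<union> Inr ` {i + 1..r UNIV}) = {i + 1..r UNIV}"
    "Inl -` (Inr ` {i + 1..r UNIV}) = ({} :: ('n + 'n) set)"
    "Inr -` (Inr ` {i + 1..r UNIV} :: (('n + 'n) + nat) set) = {i + 1..r UNIV}"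
    by auto
  then have "rk (intermediate_matroid N i) (Inl ` (A <+> B)) =
      min (r A + r B + (r UNIV - i)) (r (A \<union> B) + r UNIV) - min (r UNIV - i) (r UNIV)"
    by (simp add: intermediate_matroid_def contraction_def deletion_def linking_matroid_def
        direct_sum_def diagonal_matroid_def ground)
  then show ?thesis using assms by simp
qed

lemma rk_diagonal_step [simp]:
  "rk (diagonal_step N i) S = min (r (Inl -` S \<union> Inr -` S) + i) (r (Inl -` S) + r (Inr -` S))"
  by (simp add: diagonal_step_def)

lemma ground_diagonal_step [simp]: "ground (diagonal_step N i) = UNIV"
  by (simp add: diagonal_step_def)

lemma rk_union_le: "r (A \<union> B) \<le> r A + r B"
  using rk_submod[of A B] by simp

text \<open>The quantity \<open>r A + r B - r (A \<union> B)\<close> grows with both sets: first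
  \<open>A\<close> is enlarged, then \<open>B\<close>, with one use of submodularity each.\<close>

lemma nullity_mono:
  assumes "A \<subseteq> A'" "B \<subseteq> B'"
  shows "r A + r B + r (A' \<union> B') \<le> r A' + r B' + r (A \<union> B)"
proof -
  have "r (A' \<union> B) + r A \<le> r (A' \<union> (A \<union> B)) + r (A' \<inter> (A \<union> B))"
    using assms by (intro add_mono rk_mono) auto
  also have "\<dots> \<le> r A' + r (A \<union> B)" by (rule rk_submod)
  finally have 1: "r (A' \<union> B) + r A \<le> r A' + r (A \<union> B)" .
  have "r (A' \<union> B') + r B \<le> r (B' \<union> (A' \<union> B)) + r (B' \<inter> (A' \<union> B))"
    using assms by (intro add_mono rk_mono) auto
  also have "\<dots> \<le> r B' + r (A' \<union> B)" by (rule rk_submod)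
  finally show ?thesis using 1 by simp
qed

lemma loopfree_matroid_diagonal_step: "loopfree_matroid (diagonal_step N i)"
proof
  show "is_matroid (diagonal_step N i)"
    unfolding is_matroid_def
  proof (intro conjI allI impI)
    fix A :: "('n + 'n) set"
    have "r (Inl -` A) \<le> card (Inl -` A)" "r (Inr -` A) \<le> card (Inr -` A)"
      using matroid by (simp_all add: is_matroid_def ground)
    moreover have "card A = card (Inl -` A) + card (Inr -` A)"
      by (subst sum_Plus_vimage[of A]) (simp add: card_Plus)
    ultimately show "rk (diagonal_step N i) A \<le> card A" by simp
  next
    fix A B :: "('n + 'n) set" assume "A \<subseteq> B \<and> B \<subseteq> ground (diagonal_step N i)"
    then have "r (Inl -` A \<union> Inr -` A) \<le> r (Inl -` B \<union> Inr -` B)"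
      "r (Inl -` A) \<le> r (Inl -` B)" "r (Inr -` A) \<le> r (Inr -` B)"
      by (auto intro!: rk_mono)
    then show "rk (diagonal_step N i) A \<le> rk (diagonal_step N i) B"
      unfolding rk_diagonal_step by linarith
  next
    fix A B :: "('n + 'n) set"
    let ?f = "\<lambda>S. r (Inl -` S) + r (Inr -` S)" and ?g = "\<lambda>S. r (Inl -` S \<union> Inr -` S)"
    have f: "?f (A \<union> B) + ?f (A \<inter> B) \<le> ?f A + ?f B"
      using rk_submod[of "Inl -` A" "Inl -` B"] rk_submod[of "Inr -` A" "Inr -` B"] by simp
    have g: "?g (A \<union> B) + ?g (A \<inter> B) \<le> ?g A + ?g B"
    proof -
      have "?g (A \<union> B) + ?g (A \<inter> B) \<le> r ((Inl -` A \<union> Inr -` A) \<union> (Inl -` B \<union> Inr -` B))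
          + r ((Inl -` A \<union> Inr -` A) \<inter> (Inl -` B \<union> Inr -` B))"
        by (intro add_mono rk_mono) auto
      also have "\<dots> \<le> ?g A + ?g B" by (rule rk_submod)
      finally show ?thesis .
    qed
    have n: "?f S + ?g T \<le> ?f T + ?g S" if "S \<subseteq> T" for S T :: "('n + 'n) set"
      using that by (intro nullity_mono) auto
    have "?f (A \<inter> B) + ?g A \<le> ?f A + ?g (A \<inter> B)" "?f (A \<inter> B) + ?g B \<le> ?f B + ?g (A \<inter> B)"
      by (intro n; simp)+
    with f g show "rk (diagonal_step N i) (A \<union> B) + rk (diagonal_step N i) (A \<inter> B)
        \<le> rk (diagonal_step N i) A + rk (diagonal_step N i) B"
      unfolding rk_diagonal_step by (intro min_submodular)
  qed simp
  show "loopfree (diagonal_step N i)"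
    unfolding loopfree_def
  proof
    fix e :: "'n + 'n"
    show "rk (diagonal_step N i) {e} = 1" by (cases e) (simp_all add: rk_singleton)
  qed
qed simp

text \<open>The two ranks differ, by one, exactly where \<open>r A + r B - r (A \<union> B)\<close>
  exceeds \<open>i\<close>. This quantity is monotone and equals \<open>r UNIV\<close> on the whole
  ground set.\<close>

lemma elementary_quotient_diagonal_step:
  assumes "i < r UNIV"
  shows "elementary_quotient (diagonal_step N (Suc i)) (diagonal_step N i)"
proof -
  interpret N1: loopfree_matroid "diagonal_step N (Suc i)" by (rule loopfree_matroid_diagonal_step)
  interpret N2: loopfree_matroid "diagonal_step N i" by (rule loopfree_matroid_diagonal_step)
  show ?thesis
  proof
    fix A B :: "('n + 'n) set" assume AB: "A \<subseteq> B"
    have "r (Inl -` A) + r (Inr -` A) + r (Inl -` B \<union> Inr -` B)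
        \<le> r (Inl -` B) + r (Inr -` B) + r (Inl -` A \<union> Inr -` A)"
      using AB by (intro nullity_mono) auto
    moreover have "r (Inl -` A \<union> Inr -` A) \<le> r (Inl -` B \<union> Inr -` B)"
      using AB by (intro rk_mono) auto
    ultimately show "rk (diagonal_step N (Suc i)) A + rk (diagonal_step N i) B
        \<le> rk (diagonal_step N (Suc i)) B + rk (diagonal_step N i) A"
      unfolding rk_diagonal_step by linarith
  next
    fix A show "rk (diagonal_step N (Suc i)) A \<le> Suc (rk (diagonal_step N i) A)"
      by simp
  qed (use assms in simp)
qed

lemma diagonal_step_top: "diagonal_step N (r UNIV) = direct_sum N N"
proof -
  have "r A + r B \<le> r (A \<union> B) + r UNIV" for A B
    using rk_mono[of A "A \<union> B"] rk_mono[of B UNIV] by simp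
  then show ?thesis
    by (simp add: diagonal_step_def direct_sum_def ground min_absorb2)
qed

text \<open>Descending induction along the quotients. It makes the cones of every step cones of the
  fine subdivision of the direct sum, on which the functions are linear.\<close>

lemma flat_diagonal_step:
  assumes "i \<le> r UNIV" "flat (diagonal_step N i) F"
  shows "flat (direct_sum N N) F"
  using assms
proof (induction rule: inc_induct)
  case base
  then show ?case by (simp add: diagonal_step_top)
next
  case (step i)
  interpret elementary_quotient "diagonal_step N (Suc i)" "diagonal_step N i"
    using step by (intro elementary_quotient_diagonal_step) simp
  show ?case using step flat_of_quotient by blast
qed

text \<open>The two copies of an element are parallel in the diagonal matroid, so a flat contains
  both or neither. The map \<open>case_sum id id\<close> forgets the copy.\<close>

lemma flat_diagonal_step_0:
  "flat (diagonal_step N 0) F \<longleftrightarrow> (\<exists>G. F = G <+> G \<and> flat N G)"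
proof -
  interpret D: loopfree_matroid "diagonal_step N 0" by (rule loopfree_matroid_diagonal_step)
  have rk: "rk (diagonal_step N 0) S = r (Inl -` S \<union> Inr -` S)" for S
    using rk_union_le by (simp add: min_absorb1)
  have ins: "Inl -` insert e S \<union> Inr -` insert e S = insert (case_sum id id e) (Inl -` S \<union> Inr -` S)"
    for e :: "'n + 'n" and S by (cases e) auto
  show ?thesis
  proof
    assume F: "flat (diagonal_step N 0) F"
    have lt: "r (Inl -` F \<union> Inr -` F) < r (insert (case_sum id id e) (Inl -` F \<union> Inr -` F))"
      if "e \<notin> F" for e
      using F that unfolding D.flat_iff rk ins by blast
    have "Inl -` F = Inr -` F"
    proof (intro equalityI subsetI)
      fix e assume "e \<in> Inl -` F"
      then show "e \<in> Inr -` F" using lt[of "Inr e"] by (cases "Inr e \<in> F") (auto simp: insert_absorb)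
    next
      fix e assume "e \<in> Inr -` F"
      then show "e \<in> Inl -` F" using lt[of "Inl e"] by (cases "Inl e \<in> F") (auto simp: insert_absorb)
    qed
    moreover from this have "flat N (Inl -` F)"
      using lt[of "Inl _"] by (auto simp: flat_iff)
    ultimately show "\<exists>G. F = G <+> G \<and> flat N G"
      using sum_Plus_vimage[of F] by (intro exI[of _ "Inl -` F"]) simp
  next
    assume "\<exists>G. F = G <+> G \<and> flat N G"
    then obtain G where G: "F = G <+> G" "flat N G" by blast
    show "flat (diagonal_step N 0) F"
      unfolding D.flat_iff rk ins
    proof (intro allI impI)
      fix e assume "e \<notin> F"
      then have "case_sum id id e \<notin> G" using G(1) by (cases e) auto
      then show "r (Inl -` F \<union> Inr -` F) < r (insert (case_sum id id e) (Inl -` F \<union> Inr -` F))"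
        using G by (simp add: flat_iff)
    qed
  qed
qed

lemma flat_chains_diagonal_step_0:
  "flat_chains (diagonal_step N 0) = (\<lambda>C. (\<lambda>F. F <+> F) ` C) ` flat_chains N"
proof (intro equalityI subsetI)
  fix D assume D: "D \<in> flat_chains (diagonal_step N 0)"
  define C where "C = {G. G <+> G \<in> D}"
  have DC: "D = (\<lambda>F. F <+> F) ` C"
    using D flat_diagonal_step_0 by (auto simp: flat_chains_def C_def)
  have "UNIV <+> UNIV \<in> D" using D by (simp add: flat_chains_def)
  moreover have "{} <+> {} \<notin> D" using D by (simp add: flat_chains_def Plus_def)
  moreover have "G \<subseteq> G' \<or> G' \<subseteq> G" if "G <+> G \<in> D" "G' <+> G' \<in> D" for G G'
  proof -
    have "G <+> G \<subseteq> G' <+> G' \<or> G' <+> G' \<subseteq> G <+> G"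
      using D that by (simp add: flat_chains_def chain_subset_def)
    then show ?thesis by auto
  qed
  moreover have "flat N G" if "G <+> G \<in> D" for G
  proof -
    have "flat (diagonal_step N 0) (G <+> G)" using D that by (simp add: flat_chains_def)
    then obtain G' where "G <+> G = G' <+> G'" "flat N G'"
      unfolding flat_diagonal_step_0 by blast
    then show ?thesis by (metis vimage_Plus(1))
  qed
  ultimately have "C \<in> flat_chains N"
    by (simp add: flat_chains_def chain_subset_def C_def)
  then show "D \<in> (\<lambda>C. (\<lambda>F. F <+> F) ` C) ` flat_chains N" using DC by blast
next
  fix D assume "D \<in> (\<lambda>C. (\<lambda>F. F <+> F) ` C) ` flat_chains N"
  then obtain C where C: "C \<in> flat_chains N" "D = (\<lambda>F. F <+> F) ` C" by blast
  have "chain_subset D"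
    unfolding chain_subset_def C(2) ball_simps
  proof (intro ballI)
    fix F G assume "F \<in> C" "G \<in> C"
    then have "F \<subseteq> G \<or> G \<subseteq> F" using C(1) by (simp add: flat_chains_def chain_subset_def)
    then show "F <+> F \<subseteq> G <+> G \<or> G <+> G \<subseteq> F <+> F" by auto
  qed
  moreover have "UNIV \<in> D"
    using C by (auto simp: flat_chains_def intro!: image_eqI[of _ _ UNIV])
  moreover have "{} \<notin> D" using C by (auto simp: flat_chains_def Plus_def)
  moreover have "\<forall>F\<in>D. flat (diagonal_step N 0) F"
  proof
    fix F assume "F \<in> D"
    then obtain G where "F = G <+> G" "G \<in> C" using C(2) by blast
    moreover from this have "flat N G" using C(1) by (simp add: flat_chains_def)
    ultimately show "flat (diagonal_step N 0) F" unfolding flat_diagonal_step_0 by blast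
  qed
  ultimately show "D \<in> flat_chains (diagonal_step N 0)" by (simp add: flat_chains_def)
qed

text \<open>This is an equality of weighted complexes: the diagonal map sends the vector of
  \<open>F\<close> to that of \<open>F <+> F\<close>, and all weights are \<open>1\<close>.\<close>

lemma diagonal_complex_mv: "diagonal_complex (matroid_variety N) = matroid_variety (diagonal_step N 0)"
proof -
  have "(\<lambda>x. join_vec x x) ` flat_cone C = flat_cone ((\<lambda>F. F <+> F) ` C)" for C :: "'n set set"
  proof (rule gcone_image)
    show "linear (\<lambda>x :: real ^ 'n. join_vec x x)"
      by (auto simp: linear_iff intro!: vec_sum_eqI)
    show "inj_on (\<lambda>F. F <+> F) C" by (rule inj_onI) (metis vimage_Plus(1))
    show "F <+> F \<in> {UNIV} \<longleftrightarrow> F \<in> {UNIV}" for F :: "'n set"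
      using vimage_Plus(1)[of F F] by auto
  qed (simp add: flat_vec_Plus)
  then have "cells (diagonal_complex (matroid_variety N)) = cells (matroid_variety (diagonal_step N 0))"
    by (simp add: diagonal_complex_def cells_mv cells_matroid_variety flat_chains_diagonal_step_0 image_image)
  moreover have "weight (diagonal_complex (matroid_variety N)) = weight (matroid_variety (diagonal_step N 0))"
    by (rule ext) (simp add: diagonal_complex_def)
  ultimately show ?thesis by simp
qed

end

section \<open>The functions cutting out the diagonal\<close>

locale matroid_square = loopfree_matroid N + double: matroid_pair N N
  for N :: "'n::finite matroid"
begin

lemma diagonal_function_lin:
  assumes "is_diagonal_function N i \<phi>" "C \<in> flat_chains (direct_sum N N)"
  shows "\<exists>f. linear f \<and> (\<forall>x\<in>flat_cone C. \<phi> x = f x)"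
  using assms by (auto simp: is_diagonal_function_def double.sum.cells_mv)

lemma diagonal_function_val:
  assumes "is_diagonal_function N i \<phi>" "flat (direct_sum N N) F"
  shows "\<phi> (flat_vec F) = (if r (Inl -` F \<union> Inr -` F) + i \<le> r (Inl -` F) + r (Inr -` F) then - 1 else 0)"
proof -
  have F: "(Inl -` F) <+> (Inr -` F) = F" by (rule sum_Plus_vimage[symmetric])
  have "\<phi> (flat_vec ((Inl -` F) <+> (Inr -` F))) =
      (if int (r (Inl -` F)) + int (r (Inr -` F)) - int (r (Inl -` F \<union> Inr -` F)) \<ge> int i then - 1 else 0)"
    using assms unfolding is_diagonal_function_def by (metis F)
  moreover have "int a + int b - int c \<ge> int i \<longleftrightarrow> c + i \<le> a + b" for a b c by linarith
  ultimately show ?thesis by (simp only: F)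
qed

lemma diagonal_function_exists:
  assumes "0 < i"
  shows "\<exists>\<phi>. is_diagonal_function N i \<phi>"
proof -
  define val :: "('n + 'n) set \<Rightarrow> real" where "val F = (if int (r (Inl -` F)) + int (r (Inr -` F))
    - int (r (Inl -` F \<union> Inr -` F)) \<ge> int i then - 1 else 0)" for F
  obtain \<phi> where lin: "\<forall>C\<in>flat_chains (direct_sum N N). \<exists>f. linear f \<and> (\<forall>x\<in>flat_cone C. \<phi> x = f x)"
    and val: "\<forall>C\<in>flat_chains (direct_sum N N). \<forall>F\<in>C. \<phi> (flat_vec F) = val F"
    using double.sum.fan.piecewise_linear_exists[of val] by blast
  have "\<phi> (flat_vec (A <+> B)) = val (A <+> B)" if fl: "flat (direct_sum N N) (A <+> B)" for A B
  proof (cases "A <+> B = {}")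
    \<comment> \<open>A value is also prescribed at the empty flat, whose vector is
      \<open>0\<close>. Linearity forces \<open>0\<close> there, which fits because \<open>i\<close>
      is positive.\<close>
    case True
    have U: "{UNIV} \<in> flat_chains (direct_sum N N)"
      using double.sum.flat_UNIV by (auto simp: flat_chains_def chain_subset_def)
    then obtain f where "linear f" "\<forall>x\<in>flat_cone {UNIV}. \<phi> x = f x" using lin by blast
    then have "\<phi> 0 = 0" using double.sum.fan.zero_in_cone[OF U] linear_0 by metis
    then show ?thesis using assms by (simp add: True val_def)
  next
    case False
    have "{A <+> B, UNIV} \<in> flat_chains (direct_sum N N)"
      using double.sum.flat_UNIV fl False by (auto simp: flat_chains_def chain_subset_def)
    then show ?thesis using val by blast
  qed
  then have "is_diagonal_function N i \<phi>"
    using lin by (simp add: is_diagonal_function_def double.sum.cells_mv val_def)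
  then show ?thesis by blast
qed

text \<open>The polyhedral structure is the fine subdivision of the direct sum, where the values at
  the generators are \<open>0\<close> or \<open>- 1\<close>.\<close>

lemma rational_diagonal_function:
  assumes "is_diagonal_function N i \<phi>"
  shows "rational_function double.product \<phi>"
  unfolding rational_function_def
proof (intro conjI exI ballI)
  let ?X = "matroid_variety (direct_sum N N)"
  have "support double.product = \<Union> (flat_cone ` flat_chains (direct_sum N N))"
    using double.Union_cells_product
    by (simp add: support_def double.cells_nonzero_part_product double.sum.cells_mv)
  then show "continuous_on (support double.product) \<phi>"
    using double.sum.fan.continuous_on_fan[of \<phi>] diagonal_function_lin[OF assms] by simp
  show "cycle_eq ?X double.product" by (rule double.cycle_eq_product)
  fix \<sigma> assume "\<sigma> \<in> cells ?X"
  then obtain C where C: "C \<in> flat_chains (direct_sum N N)" "\<sigma> = flat_cone C"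
    by (auto simp: double.sum.cells_mv)
  obtain f where f: "linear f" "\<forall>x\<in>flat_cone C. \<phi> x = f x"
    using diagonal_function_lin[OF assms C(1)] by blast
  have "\<phi> (flat_vec F) \<in> \<int>" if "F \<in> C" for F
    using that C(1) diagonal_function_val[OF assms] by (auto simp: flat_chains_def)
  then show "integer_affine_on \<sigma> \<phi>"
    unfolding C(2) using double.sum.fan.integer_affine_on_cone[OF C(1) f(1)] f(2) by blast
qed

lemma has_divisor_diagonal_step:
  assumes i: "i < r UNIV" and \<phi>: "is_diagonal_function N (Suc i) \<phi>"
  shows "has_divisor \<phi> (matroid_variety (diagonal_step N (Suc i))) (matroid_variety (diagonal_step N i))"
proof -
  interpret Q: elementary_quotient "diagonal_step N (Suc i)" "diagonal_step N i"
    by (rule elementary_quotient_diagonal_step[OF i])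
  have fl: "flat (direct_sum N N) F" if "flat (diagonal_step N (Suc i)) F" for F
    using that i by (intro flat_diagonal_step) auto
  show ?thesis
  proof (rule Q.has_divisor_quotient)
    fix C assume "C \<in> flat_chains (diagonal_step N (Suc i))"
    then have "C \<in> flat_chains (direct_sum N N)" using fl by (auto simp: flat_chains_def)
    then show "\<exists>f. linear f \<and> (\<forall>x\<in>flat_cone C. \<phi> x = f x)"
      by (rule diagonal_function_lin[OF \<phi>])
  next
    fix F assume "flat (diagonal_step N (Suc i)) F"
    \<comment> \<open>The minima for \<open>Suc i\<close> and \<open>i\<close> differ exactly when
      the threshold \<open>Suc i\<close> is reached.\<close>
    then show "\<phi> (flat_vec F) = - Q.drop F"
      using diagonal_function_val[OF \<phi> fl] by (simp add: Q.drop_def min_def)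
  qed
qed

text \<open>Descending induction starting from the product itself. The last function of the list
  acts first, so each step adds the new function at the front.\<close>

lemma has_divisor_product_diagonal_step:
  assumes \<phi>: "\<And>i. i \<in> {1..r UNIV} \<Longrightarrow> is_diagonal_function N i (\<phi> i)" and "i \<le> r UNIV"
  shows "has_divisor_product (map \<phi> [Suc i..<Suc (r UNIV)]) double.product (matroid_variety (diagonal_step N i))"
  using assms(2)
proof (induction rule: inc_induct)
  case base
  then show ?case using double.cycle_eq_product by (simp add: diagonal_step_top)
next
  case (step i)
  then have "[Suc i..<Suc (r UNIV)] = Suc i # [Suc (Suc i)..<Suc (r UNIV)]"
    by (simp add: upt_conv_Cons)
  moreover have "has_divisor (\<phi> (Suc i)) (matroid_variety (diagonal_step N (Suc i)))
      (matroid_variety (diagonal_step N i))"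
    using step \<phi> by (intro has_divisor_diagonal_step) auto
  ultimately show ?case using step.IH by auto
qed

end

theorem corollary4p2:
  fixes M :: "'e::finite matroid" and r :: nat
  assumes "is_matroid M" and "loopfree M" and "ground M = (UNIV :: 'e set)"
    and "r = rk M (ground M)"
  shows "(\<exists>\<phi>. (\<forall>i \<in> {1..r}. rational_function (product_complex (matroid_variety M) (matroid_variety M)) (\<phi> i)) \<and>
              has_divisor_product (map \<phi> [1..<Suc r])
                (product_complex (matroid_variety M) (matroid_variety M))
                (diagonal_complex (matroid_variety M))) \<and>
         (\<forall>i \<le> r. ground (intermediate_matroid M i) = Inl ` (ground M <+> ground M) \<and>
              (\<forall>A \<subseteq> ground M. \<forall>B \<subseteq> ground M.
                 rk (intermediate_matroid M i) (Inl ` (A <+> B)) =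
                   min (rk M (A \<union> B) + i) (rk M A + rk M B))) \<and>
         (\<forall>i \<in> {1..r}. \<exists>\<psi>. is_diagonal_function M i \<psi>) \<and>
         (\<forall>\<phi>. (\<forall>i \<in> {1..r}. is_diagonal_function M i (\<phi> i)) \<longrightarrow>
              (\<forall>i \<in> {1..r}. rational_function (product_complex (matroid_variety M) (matroid_variety M)) (\<phi> i)) \<and>
              has_divisor_product (map \<phi> [1..<Suc r])
                (product_complex (matroid_variety M) (matroid_variety M))
                (diagonal_complex (matroid_variety M)))"
proof -
  interpret M: matroid_square M using assms by unfold_locales
  have r: "r = rk M UNIV" using assms by simp
  have ex: "\<forall>i\<in>{1..r}. \<exists>\<psi>. is_diagonal_function M i \<psi>"
    using M.diagonal_function_exists by simp
  have cut: "(\<forall>i\<in>{1..r}. rational_function M.double.product (\<phi> i)) \<and>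
      has_divisor_product (map \<phi> [1..<Suc r]) M.double.product (diagonal_complex (matroid_variety M))"
    if "\<forall>i\<in>{1..r}. is_diagonal_function M i (\<phi> i)" for \<phi>
  proof
    show "\<forall>i\<in>{1..r}. rational_function M.double.product (\<phi> i)"
      using that M.rational_diagonal_function by blast
    show "has_divisor_product (map \<phi> [1..<Suc r]) M.double.product (diagonal_complex (matroid_variety M))"
      using M.has_divisor_product_diagonal_step[of \<phi> 0] that by (simp add: M.diagonal_complex_mv r)
  qed
  \<comment> \<open>One choice of functions, fed into \<open>cut\<close>, gives the existence
    part.\<close>
  obtain \<phi> where "\<forall>i\<in>{1..r}. is_diagonal_function M i (\<phi> i)"
    using bchoice[OF ex] by blast
  then show ?thesis
    using cut ex M.ground_intermediate M.rk_intermediate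
    unfolding r M.ground UNIV_Plus_UNIV by blast
qed

end
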